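(* Fix a real number $b\neq 0$. There is a constant $C>0$, not depending on $\gamma$, such that for every $\gamma\in\mathbb{R}$ the number $T(\gamma)$ of non-real eigenvalues of the operator $$L=-\frac{d^2}{dx^2}+x^2+i\gamma\,[\delta(x-b)-\delta(x+b)]\quad\text{in } L^2(\mathbb{R})$$ is finite, and $$T(\gamma)\le\bigl(C\,(1+|\gamma|)\log(e+|\gamma|)\bigr)^2.$$
   Context: The operator $L$ is the closed operator in $L^2(\mathbb{R})$ associated (by the quadratic-form method) with the form $\int_{\mathbb{R}}(|f'|^2+x^2|f|^2)\,dx+i\gamma\,(|f(b)|^2-|f(-b)|^2)$ on $\{f\in H^1(\mathbb{R}): xf\in L^2(\mathbb{R})\}$. It has discrete spectrum. *)

theory Defs
  imports "HOL-Analysis.Analysis"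
begin

(* Elements of L^2(R) are represented by Borel functions; a class is determined by any of
   its representatives up to equality almost everywhere. *)

definition L2_fun :: "(real \<Rightarrow> complex) set" where
  "L2_fun = {f. f \<in> borel_measurable lborel \<and> integrable lborel (\<lambda>x. (cmod (f x))\<^sup>2)}"

definition L2_inner :: "(real \<Rightarrow> complex) \<Rightarrow> (real \<Rightarrow> complex) \<Rightarrow> complex" where
  "L2_inner f h = (LINT x|lborel. f x * cnj (h x))"

definition test_fun :: "(real \<Rightarrow> real) \<Rightarrow> bool" where
  "test_fun \<phi> \<longleftrightarrow>
     (\<forall>n x. (deriv ^^ n) \<phi> field_differentiable at x) \<and> compact (closure {x. \<phi> x \<noteq> 0})"

definition has_weak_deriv :: "(real \<Rightarrow> complex) \<Rightarrow> (real \<Rightarrow> complex) \<Rightarrow> bool" where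
  "has_weak_deriv f g \<longleftrightarrow>
     (\<forall>\<phi>. test_fun \<phi> \<longrightarrow>
        (LINT x|lborel. f x * of_real (deriv \<phi> x)) = - (LINT x|lborel. g x * of_real (\<phi> x)))"

(* Every class in H^1(R) has exactly one continuous representative. It is the one used here,
   since it is what the point values f(b) and f(-b) refer to. *)

definition H1_fun :: "(real \<Rightarrow> complex) set" where
  "H1_fun = {f \<in> L2_fun. continuous_on UNIV f \<and> (\<exists>g\<in>L2_fun. has_weak_deriv f g)}"

(* The weak derivative is unique only almost everywhere; the form below does not depend on
   the choice. *)

definition weak_deriv :: "(real \<Rightarrow> complex) \<Rightarrow> (real \<Rightarrow> complex)" where
  "weak_deriv f = (SOME g. g \<in> L2_fun \<and> has_weak_deriv f g)"

definition form_domain :: "(real \<Rightarrow> complex) set" where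
  "form_domain = {f \<in> H1_fun. (\<lambda>x. of_real x * f x) \<in> L2_fun}"

(* Sesquilinear form (linear in the first argument) whose diagonal is the quadratic form
   int (|f'|^2 + x^2 |f|^2) dx + i gamma (|f(b)|^2 - |f(-b)|^2). *)

definition osc_form ::
  "real \<Rightarrow> real \<Rightarrow> (real \<Rightarrow> complex) \<Rightarrow> (real \<Rightarrow> complex) \<Rightarrow> complex" where
  "osc_form b \<gamma> f h =
     (LINT x|lborel. weak_deriv f x * cnj (weak_deriv h x) + of_real (x\<^sup>2) * (f x * cnj (h x)))
     + \<i> * of_real \<gamma> * (f b * cnj (h b) - f (- b) * cnj (h (- b)))"

(* Graph of the operator L associated with the form (first representation theorem):
   f is in the domain of L with L f = w iff the form of f and h equals the inner product
   of w and h for every h in the form domain. *)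

definition osc_op :: "real \<Rightarrow> real \<Rightarrow> ((real \<Rightarrow> complex) \<times> (real \<Rightarrow> complex)) set" where
  "osc_op b \<gamma> =
     {(f, w). f \<in> form_domain \<and> w \<in> L2_fun \<and>
              (\<forall>h\<in>form_domain. osc_form b \<gamma> f h = L2_inner w h)}"

definition osc_eigenvalue :: "real \<Rightarrow> real \<Rightarrow> complex \<Rightarrow> bool" where
  "osc_eigenvalue b \<gamma> \<mu> \<longleftrightarrow>
     (\<exists>f. (f, \<lambda>x. \<mu> * f x) \<in> osc_op b \<gamma> \<and> \<not> (AE x in lborel. f x = 0))"

definition nonreal_eigenvalues :: "real \<Rightarrow> real \<Rightarrow> complex set" where
  "nonreal_eigenvalues b \<gamma> = {\<mu>. osc_eigenvalue b \<gamma> \<mu> \<and> \<mu> \<notin> \<real>}"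

end

theory Submission
  imports Defs "HOL-Probability.Distributions"
begin

text \<open>Let \<open>f\<close> be an eigenfunction for a non-real eigenvalue \<open>\<mu> = \<lambda> + i \<nu>\<close>. The operator is symmetric for the
  indefinite product \<open><f, Ph>\<close>, where \<open>P\<close> is the reflection of the line, hence \<open><f, Pf> = 0\<close>. Therefore no Hermite
  coefficient of \<open>f\<close> carries more than half of the mass. On the other hand, testing the eigenvalue equation
  with the k-th Hermite function bounds the k-th coefficient by \<open>\<bar>\<gamma>\<bar> / \<bar>2 k + 1 - \<mu>\<bar>\<close> times point values
  at \<open>b\<close> and \<open>- b\<close>, and an energy (Sonin type) estimate bounds the squared point values of \<open>f\<close> by a multiple of
  \<open>1 / sqrt \<lambda>\<close> and those of the Hermite function by a multiple of \<open>1 / sqrt k\<close>. Summing over all \<open>k\<close> except the one with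
  \<open>2 k + 1\<close> nearest to \<open>\<lambda>\<close> gives \<open>\<lambda> \<le> A (1 + \<gamma>^2)\<close>.

  For the count, orthogonalise the eigenfunctions of \<open>N\<close> distinct eigenvalues with real part at most \<open>R\<close>. The
  operator is then upper triangular, and its real part is the harmonic oscillator, whose trace on any
  N-dimensional space is at least of order \<open>N^2\<close>. Hence \<open>N^2 / 2 \<le> N R\<close>.\<close>

section \<open>Square-integrable functions\<close>

text \<open>Eigenfunctions are only weak solutions, and their derivative may jump at
  \<open>b\<close> and \<open>- b\<close>. Point values are therefore estimated from an interval to
  the right of \<open>b\<close>, where the equation has no delta term; the value at
  \<open>- b\<close> comes from the reflected function, which is an eigenfunction for
  \<open>- \<gamma>\<close>. The point estimate contains \<open>Im \<mu>\<close>, which is itself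
  controlled only through point values. This loop contracts once \<open>Re \<mu>\<close> exceeds a
  multiple of \<open>\<gamma>^2\<close>, and then \<open>\<bar>Im \<mu>\<bar> \<le> 1\<close>.

  The level nearest to \<lambda> must stay out of the sum because its denominator has no useful
  lower bound; its coefficient is the one that the reflection argument controls. For the other
  levels the squared coefficients are at most a multiple of \<gamma>^2 / (sqrt \<lambda> sqrt k |2 k
  + 1 - \<lambda>|^2), which sums to order \<gamma>^2 / \<lambda>: this is why \<gamma>^2 limits
  \<lambda>.

  Both halves of the proof rest on one spectral fact: orthogonality to the first K Hermite functions
  forces energy at least 2 K + 1 per unit of mass. It is obtained by solving the raising equation
  explicitly.\<close>

lemma L2_funI: "f \<in> borel_measurable lborel \<Longrightarrow> integrable lborel (\<lambda>x. (cmod (f x))\<^sup>2) \<Longrightarrow> f \<in> L2_fun"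
  by (simp add: L2_fun_def)

lemma L2_fun_measurable: "f \<in> L2_fun \<Longrightarrow> f \<in> borel_measurable borel"
  by (simp add: L2_fun_def)

lemma L2_fun_integrable_norm_sq: "f \<in> L2_fun \<Longrightarrow> integrable lborel (\<lambda>x. (cmod (f x))\<^sup>2)"
  by (simp add: L2_fun_def)

lemma L2_fun_dominated:
  assumes "f \<in> L2_fun" "h \<in> borel_measurable borel" "\<And>x. cmod (h x) \<le> c * cmod (f x)"
  shows "h \<in> L2_fun"
proof (rule L2_funI)
  show "h \<in> borel_measurable lborel" using assms by simp
  show "integrable lborel (\<lambda>x. (cmod (h x))\<^sup>2)"
  proof (rule Bochner_Integration.integrable_bound)
    show "integrable lborel (\<lambda>x. c\<^sup>2 * (cmod (f x))\<^sup>2)"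
      using L2_fun_integrable_norm_sq[OF assms(1)] by simp
    show "(\<lambda>x. (cmod (h x))\<^sup>2) \<in> borel_measurable lborel" using assms by simp
    have "(cmod (h x))\<^sup>2 \<le> c\<^sup>2 * (cmod (f x))\<^sup>2" for x
      using power_mono[OF assms(3)[of x], of 2] by (simp add: power_mult_distrib)
    then show "AE x in lborel. norm ((cmod (h x))\<^sup>2) \<le> norm (c\<^sup>2 * (cmod (f x))\<^sup>2)"
      by simp
  qed
qed

lemma L2_fun_zero [simp]: "(\<lambda>x. 0) \<in> L2_fun"
  by (simp add: L2_fun_def)

lemma L2_fun_scale: "f \<in> L2_fun \<Longrightarrow> (\<lambda>x. c * f x) \<in> L2_fun"
  by (rule L2_fun_dominated[of f _ "cmod c"]) (auto simp: norm_mult dest: L2_fun_measurable)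

lemma L2_fun_uminus: "f \<in> L2_fun \<Longrightarrow> (\<lambda>x. - f x) \<in> L2_fun"
  using L2_fun_scale[of f "-1"] by simp

lemma L2_fun_cnj: "f \<in> L2_fun \<Longrightarrow> (\<lambda>x. cnj (f x)) \<in> L2_fun"
  unfolding L2_fun_def by (auto intro!: borel_measurable_continuous_on[where g=f and f=cnj] continuous_intros)

lemma L2_fun_add:
  assumes "f \<in> L2_fun" "h \<in> L2_fun"
  shows "(\<lambda>x. f x + h x) \<in> L2_fun"
proof (rule L2_funI)
  show "(\<lambda>x. f x + h x) \<in> borel_measurable lborel"
    using assms by (auto dest!: L2_fun_measurable)
  show "integrable lborel (\<lambda>x. (cmod (f x + h x))\<^sup>2)"
  proof (rule Bochner_Integration.integrable_bound)
    show "integrable lborel (\<lambda>x. 2 * (cmod (f x))\<^sup>2 + 2 * (cmod (h x))\<^sup>2)"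
      using assms by (simp add: L2_fun_integrable_norm_sq)
    show "(\<lambda>x. (cmod (f x + h x))\<^sup>2) \<in> borel_measurable lborel"
      using assms by (auto dest!: L2_fun_measurable)
    have "(cmod (f x + h x))\<^sup>2 \<le> 2 * (cmod (f x))\<^sup>2 + 2 * (cmod (h x))\<^sup>2" for x
    proof -
      have "(cmod (f x + h x))\<^sup>2 \<le> (cmod (f x) + cmod (h x))\<^sup>2"
        by (intro power_mono norm_triangle_ineq) simp
      also have "\<dots> \<le> 2 * (cmod (f x))\<^sup>2 + 2 * (cmod (h x))\<^sup>2"
        using zero_le_power2[of "cmod (f x) - cmod (h x)"] by (simp add: power2_eq_square algebra_simps)
      finally show ?thesis .
    qed
    then show "AE x in lborel. norm ((cmod (f x + h x))\<^sup>2) \<le> norm (2 * (cmod (f x))\<^sup>2 + 2 * (cmod (h x))\<^sup>2)"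
      by simp
  qed
qed

lemma L2_fun_diff: "f \<in> L2_fun \<Longrightarrow> h \<in> L2_fun \<Longrightarrow> (\<lambda>x. f x - h x) \<in> L2_fun"
  using L2_fun_add[of f "\<lambda>x. - h x"] L2_fun_uminus[of h] by simp

lemma L2_fun_sum: "(\<And>i. i \<in> I \<Longrightarrow> f i \<in> L2_fun) \<Longrightarrow> (\<lambda>x. \<Sum>i\<in>I. f i x) \<in> L2_fun"
  by (induction I rule: infinite_finite_induct) (auto intro: L2_fun_add)

lemma L2_fun_reflect:
  assumes "f \<in> L2_fun"
  shows "(\<lambda>x. f (- x)) \<in> L2_fun"
proof (rule L2_funI)
  have [measurable]: "f \<in> borel_measurable borel" using assms by (rule L2_fun_measurable)
  show "(\<lambda>x. f (- x)) \<in> borel_measurable lborel" by simp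
  show "integrable lborel (\<lambda>x. (cmod (f (- x)))\<^sup>2)"
    using lborel_integrable_real_affine[OF L2_fun_integrable_norm_sq[OF assms], of "-1" 0] by simp
qed

lemma L2_mult_integrable:
  assumes "f \<in> L2_fun" "h \<in> L2_fun"
  shows "integrable lborel (\<lambda>x. f x * h x)"
proof (rule Bochner_Integration.integrable_bound)
  show "integrable lborel (\<lambda>x. (cmod (f x))\<^sup>2 + (cmod (h x))\<^sup>2)"
    using assms by (simp add: L2_fun_integrable_norm_sq)
  show "(\<lambda>x. f x * h x) \<in> borel_measurable lborel"
    using assms by (auto dest!: L2_fun_measurable)
  have "norm (f x * h x) \<le> (cmod (f x))\<^sup>2 + (cmod (h x))\<^sup>2" for x
    using sum_squares_bound[of "cmod (f x)" "cmod (h x)"] mult_nonneg_nonneg[OF norm_ge_zero norm_ge_zero, of "f x" "h x"]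
    unfolding norm_mult by linarith
  then show "AE x in lborel. norm (f x * h x) \<le> norm ((cmod (f x))\<^sup>2 + (cmod (h x))\<^sup>2)"
    by simp
qed

lemma L2_inner_integrable:
  "f \<in> L2_fun \<Longrightarrow> h \<in> L2_fun \<Longrightarrow> integrable lborel (\<lambda>x. f x * cnj (h x))"
  by (intro L2_mult_integrable L2_fun_cnj)

lemma L2_inner_add_left:
  "f \<in> L2_fun \<Longrightarrow> g \<in> L2_fun \<Longrightarrow> h \<in> L2_fun \<Longrightarrow>
    L2_inner (\<lambda>x. f x + g x) h = L2_inner f h + L2_inner g h"
  unfolding L2_inner_def by (simp add: distrib_right L2_inner_integrable)

lemma L2_inner_diff_left:
  "f \<in> L2_fun \<Longrightarrow> g \<in> L2_fun \<Longrightarrow> h \<in> L2_fun \<Longrightarrow>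
    L2_inner (\<lambda>x. f x - g x) h = L2_inner f h - L2_inner g h"
  unfolding L2_inner_def by (simp add: left_diff_distrib L2_inner_integrable)

lemma L2_inner_scale_left: "L2_inner (\<lambda>x. c * f x) h = c * L2_inner f h"
  unfolding L2_inner_def by (simp add: mult.assoc)

lemma L2_inner_uminus_left: "L2_inner (\<lambda>x. - f x) h = - L2_inner f h"
  unfolding L2_inner_def by simp

lemma L2_inner_cnj: "cnj (L2_inner f h) = L2_inner h f"
proof -
  have "cnj (L2_inner f h) = (LINT x|lborel. cnj (f x * cnj (h x)))"
    unfolding L2_inner_def by (rule Bochner_Integration.integral_cnj[symmetric])
  then show ?thesis unfolding L2_inner_def by (simp add: mult.commute)
qed

lemma L2_inner_add_right:
  "f \<in> L2_fun \<Longrightarrow> g \<in> L2_fun \<Longrightarrow> h \<in> L2_fun \<Longrightarrow>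
    L2_inner h (\<lambda>x. f x + g x) = L2_inner h f + L2_inner h g"
  unfolding L2_inner_def by (simp add: distrib_left L2_inner_integrable)

lemma L2_inner_diff_right:
  "f \<in> L2_fun \<Longrightarrow> g \<in> L2_fun \<Longrightarrow> h \<in> L2_fun \<Longrightarrow>
    L2_inner h (\<lambda>x. f x - g x) = L2_inner h f - L2_inner h g"
  unfolding L2_inner_def by (simp add: right_diff_distrib L2_inner_integrable)

lemma L2_inner_scale_right: "L2_inner h (\<lambda>x. c * f x) = cnj c * L2_inner h f"
  using L2_inner_cnj[of "\<lambda>x. c * f x" h] by (metis L2_inner_cnj L2_inner_scale_left complex_cnj_mult)

lemma L2_inner_uminus_right: "L2_inner h (\<lambda>x. - f x) = - L2_inner h f"
  unfolding L2_inner_def by simp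

lemma L2_inner_zero_left [simp]: "L2_inner (\<lambda>x. 0) h = 0"
  unfolding L2_inner_def by simp

lemma L2_inner_zero_right [simp]: "L2_inner h (\<lambda>x. 0) = 0"
  unfolding L2_inner_def by simp

lemma L2_inner_sum_left:
  "(\<And>i. i \<in> I \<Longrightarrow> f i \<in> L2_fun) \<Longrightarrow> h \<in> L2_fun \<Longrightarrow>
    L2_inner (\<lambda>x. \<Sum>i\<in>I. c i * f i x) h = (\<Sum>i\<in>I. c i * L2_inner (f i) h)"
proof (induction I rule: infinite_finite_induct)
  case (insert j I)
  then show ?case
    by (simp add: L2_inner_add_left L2_fun_scale L2_fun_sum L2_inner_scale_left)
qed simp_all

lemma L2_inner_sum_right:
  "(\<And>i. i \<in> I \<Longrightarrow> f i \<in> L2_fun) \<Longrightarrow> h \<in> L2_fun \<Longrightarrow>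
    L2_inner h (\<lambda>x. \<Sum>i\<in>I. c i * f i x) = (\<Sum>i\<in>I. cnj (c i) * L2_inner h (f i))"
proof (induction I rule: infinite_finite_induct)
  case (insert j I)
  then show ?case
    by (simp add: L2_inner_add_right L2_fun_scale L2_fun_sum L2_inner_scale_right)
qed simp_all

lemma L2_inner_cong_AE:
  assumes "AE x in lborel. f x = f' x" "AE x in lborel. h x = h' x"
    "f \<in> L2_fun" "f' \<in> L2_fun" "h \<in> L2_fun" "h' \<in> L2_fun"
  shows "L2_inner f h = L2_inner f' h'"
  unfolding L2_inner_def
proof (rule integral_cong_AE)
  show "(\<lambda>x. f x * cnj (h x)) \<in> borel_measurable lborel"
    using L2_inner_integrable[of f h] assms by (blast intro: borel_measurable_integrable)
  show "(\<lambda>x. f' x * cnj (h' x)) \<in> borel_measurable lborel"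
    using L2_inner_integrable[of f' h'] assms by (blast intro: borel_measurable_integrable)
qed (use assms in auto)

lemma L2_inner_reflect:
  "L2_inner (\<lambda>x. f (- x)) (\<lambda>x. h (- x)) = L2_inner f h"
  unfolding L2_inner_def
  using lborel_integral_real_affine[of "-1" "\<lambda>x. f x * cnj (h x)" 0] by simp

definition L2_sq :: "(real \<Rightarrow> complex) \<Rightarrow> real" where
  "L2_sq f = (LINT x|lborel. (cmod (f x))\<^sup>2)"

lemma L2_inner_self: "L2_inner f f = of_real (L2_sq f)"
  unfolding L2_inner_def L2_sq_def
  by (simp add: complex_norm_square[symmetric] del: of_real_power)

lemma L2_sq_nonneg [simp]: "0 \<le> L2_sq f"
  unfolding L2_sq_def by simp

lemma L2_sq_eq_0_iff:
  assumes "f \<in> L2_fun"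
  shows "L2_sq f = 0 \<longleftrightarrow> (AE x in lborel. f x = 0)"
  unfolding L2_sq_def
  by (subst integral_nonneg_eq_0_iff_AE) (auto simp: L2_fun_integrable_norm_sq assms)

lemma L2_sq_scale: "L2_sq (\<lambda>x. c * f x) = (cmod c)\<^sup>2 * L2_sq f"
  unfolding L2_sq_def by (simp add: norm_mult power_mult_distrib)

lemma L2_sq_reflect: "L2_sq (\<lambda>x. f (- x)) = L2_sq f"
  using L2_inner_reflect[of f f] unfolding L2_inner_self by simp

lemma L2_sq_add:
  assumes "f \<in> L2_fun" "h \<in> L2_fun"
  shows "L2_sq (\<lambda>x. f x + h x) = L2_sq f + L2_sq h + 2 * Re (L2_inner f h)"
proof -
  have "complex_of_real (L2_sq (\<lambda>x. f x + h x)) = L2_inner f f + L2_inner h h + (L2_inner f h + cnj (L2_inner f h))"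
    using assms by (simp add: L2_inner_self[symmetric] L2_inner_add_left L2_inner_add_right L2_fun_add L2_inner_cnj)
  also have "\<dots> = of_real (L2_sq f + L2_sq h + 2 * Re (L2_inner f h))"
    by (simp add: L2_inner_self complex_eq_iff)
  finally show ?thesis by (simp only: of_real_eq_iff)
qed

lemma L2_inner_AE_zero:
  assumes "f \<in> L2_fun" "h \<in> L2_fun" "L2_sq f = 0"
  shows "L2_inner h f = 0"
proof -
  have "L2_inner h f = L2_inner h (\<lambda>x. 0)"
    using assms by (intro L2_inner_cong_AE) (auto simp: L2_sq_eq_0_iff[symmetric])
  then show ?thesis by simp
qed

section \<open>Absolutely continuous functions\<close>

text \<open>Local absolute continuity with density \<open>g\<close>, stated through the fundamental
  theorem of calculus. The integrals determine \<open>g\<close> up to a null set, the same freedom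
  as for a weak derivative, and pointwise differentiability never enters.\<close>

definition has_ac_deriv :: "(real \<Rightarrow> complex) \<Rightarrow> (real \<Rightarrow> complex) \<Rightarrow> bool" where
  "has_ac_deriv f g \<longleftrightarrow> (\<forall>x y. x \<le> y \<longrightarrow>
     set_integrable lborel {x..y} g \<and> f y - f x = (LINT t:{x..y}|lborel. g t))"

lemma has_ac_deriv_integrable: "has_ac_deriv f g \<Longrightarrow> set_integrable lborel {x..y} g"
  by (cases "x \<le> y") (auto simp: has_ac_deriv_def)

lemma has_ac_deriv_diff: "has_ac_deriv f g \<Longrightarrow> x \<le> y \<Longrightarrow> f y - f x = (LINT t:{x..y}|lborel. g t)"
  by (auto simp: has_ac_deriv_def)

lemma has_ac_deriv_continuous:
  assumes "has_ac_deriv f g"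
  shows "continuous_on UNIV f"
proof -
  have "continuous_on {-R<..<R} f" for R
  proof -
    have "continuous_on {-R..R} (\<lambda>y. f (-R) + integral {-R..y} g)"
      using has_ac_deriv_integrable[OF assms, of "-R" R]
      by (intro continuous_intros indefinite_integral_continuous_1 set_borel_integral_eq_integral)
    moreover have "f (-R) + integral {-R..y} g = f y" if "y \<in> {-R..R}" for y
      using has_ac_deriv_diff[OF assms, of "-R" y] that
        set_borel_integral_eq_integral(2)[OF has_ac_deriv_integrable[OF assms, of "-R" y]]
      by (auto simp: algebra_simps)
    ultimately have "continuous_on {-R..R} f"
      using continuous_on_cong[OF refl, of "{-R..R}" "\<lambda>y. f (-R) + integral {-R..y} g" f] by blast
    then show ?thesis by (rule continuous_on_subset) auto
  qed
  moreover have "x \<in> interior {-(\<bar>x\<bar>+1)<..<\<bar>x\<bar>+1}" for x :: real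
    unfolding interior_open[OF open_greaterThanLessThan] by auto
  ultimately have "isCont f x" for x
    by (rule continuous_on_interior)
  then show ?thesis by (auto simp: continuous_at_imp_continuous_on)
qed

lemma has_ac_derivI_C1:
  assumes "\<And>x. (f has_vector_derivative g x) (at x)" "continuous_on UNIV g"
  shows "has_ac_deriv f g"
  unfolding has_ac_deriv_def
proof (intro allI impI conjI)
  fix x y :: real assume "x \<le> y"
  have cont: "continuous_on {x..y} g" using assms(2) by (rule continuous_on_subset) auto
  then show "set_integrable lborel {x..y} g" by (rule borel_integrable_atLeastAtMost')
  show "f y - f x = (LINT t:{x..y}|lborel. g t)"
    unfolding set_lebesgue_integral_def
    using assms(1) \<open>x \<le> y\<close> cont
    by (intro integral_FTC_Icc[symmetric]) (auto intro: has_vector_derivative_at_within)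
qed

lemma has_ac_deriv_const: "has_ac_deriv (\<lambda>x. c) (\<lambda>x. 0)"
  by (rule has_ac_derivI_C1) auto

lemma has_ac_deriv_add:
  "has_ac_deriv f g \<Longrightarrow> has_ac_deriv h k \<Longrightarrow> has_ac_deriv (\<lambda>x. f x + h x) (\<lambda>x. g x + k x)"
  by (auto simp: has_ac_deriv_def add_diff_add)

lemma has_ac_deriv_scale:
  "has_ac_deriv f g \<Longrightarrow> has_ac_deriv (\<lambda>x. c * f x) (\<lambda>x. c * g x)"
  by (simp add: has_ac_deriv_def right_diff_distrib[symmetric])

lemma has_ac_deriv_cnj:
  "has_ac_deriv f g \<Longrightarrow> has_ac_deriv (\<lambda>x. cnj (f x)) (\<lambda>x. cnj (g x))"
proof -
  have 1: "indicator A t *\<^sub>R cnj z = cnj (indicator A t *\<^sub>R z)" for A and t :: real and z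
    by (simp add: indicator_def)
  assume *: "has_ac_deriv f g"
  show ?thesis unfolding has_ac_deriv_def
  proof (intro allI impI conjI)
    fix x y :: real assume "x \<le> y"
    show "set_integrable lborel {x..y} (\<lambda>x. cnj (g x))"
      using has_ac_deriv_integrable[OF *, of x y] unfolding set_integrable_def 1 by (rule integrable_cnj)
    have "(LINT t:{x..y}|lborel. cnj (g t)) = cnj (LINT t:{x..y}|lborel. g t)"
      unfolding set_lebesgue_integral_def 1 by (rule Bochner_Integration.integral_cnj)
    then show "cnj (f y) - cnj (f x) = (LINT t:{x..y}|lborel. cnj (g t))"
      using has_ac_deriv_diff[OF * \<open>x \<le> y\<close>] by (simp flip: complex_cnj_diff)
  qed
qed

lemma has_ac_deriv_reflect:
  assumes "has_ac_deriv f g"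
  shows "has_ac_deriv (\<lambda>x. f (- x)) (\<lambda>x. - g (- x))"
  unfolding has_ac_deriv_def
proof (intro allI impI conjI)
  fix x y :: real assume "x \<le> y"
  have 1: "indicator {x..y} t *\<^sub>R g (- t) = (\<lambda>s. indicator {-y..-x} s *\<^sub>R g s) (0 + (-1) * t)" for t
    by (auto simp: indicator_def)
  have i: "integrable lborel (\<lambda>s. indicator {-y..-x} s *\<^sub>R g s)"
    using has_ac_deriv_integrable[OF assms, of "-y" "-x"] unfolding set_integrable_def .
  have i2: "set_integrable lborel {x..y} (\<lambda>t. g (- t))"
    unfolding set_integrable_def 1 by (rule lborel_integrable_real_affine[OF i]) simp
  show "set_integrable lborel {x..y} (\<lambda>t. - g (- t))"
    using set_integrable_mult_right[OF i2, of "-1"] by simp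
  have "(LINT t:{x..y}|lborel. g (- t)) = (LINT t:{-y..-x}|lborel. g t)"
    unfolding set_lebesgue_integral_def 1
    by (subst (2) lborel_integral_real_affine[of "-1" _ 0]) auto
  then have "(LINT t:{x..y}|lborel. - g (- t)) = - (LINT t:{-y..-x}|lborel. g t)"
    using set_integral_uminus[OF i2] by simp
  then show "f (- y) - f (- x) = (LINT t:{x..y}|lborel. - g (- t))"
    using has_ac_deriv_diff[OF assms, of "-y" "-x"] \<open>x \<le> y\<close>
    by (metis minus_diff_eq neg_le_iff_le)
qed

section \<open>Product rule and total derivatives\<close>

lemma integrable_lborel_pair_mult:
  fixes g k :: "real \<Rightarrow> complex"
  assumes "integrable lborel g" "integrable lborel k"
  shows "integrable (lborel \<Otimes>\<^sub>M lborel) (\<lambda>(s,t). g s * k t)"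
proof (rule lborel_pair.Fubini_integrable)
  have [measurable]: "g \<in> borel_measurable borel" "k \<in> borel_measurable borel"
    using assms by (auto dest: borel_measurable_integrable)
  show "(\<lambda>(s,t). g s * k t) \<in> borel_measurable (lborel \<Otimes>\<^sub>M lborel)" by measurable
  show "integrable lborel (\<lambda>x. \<integral>y. norm (case (x, y) of (s, t) \<Rightarrow> g s * k t) \<partial>lborel)"
    using assms by (simp add: norm_mult integrable_norm)
  show "AE x in lborel. integrable lborel (\<lambda>y. case (x, y) of (s, t) \<Rightarrow> g s * k t)"
    using assms by simp
qed

lemma set_integrable_mult_continuous:
  fixes f g :: "real \<Rightarrow> complex"
  assumes "set_integrable lborel {x..y} g" "continuous_on {x..y} f"
  shows "set_integrable lborel {x..y} (\<lambda>t. g t * f t)"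
proof -
  obtain B where B: "\<And>t. t \<in> {x..y} \<Longrightarrow> norm (f t) \<le> B"
    using compact_imp_bounded[OF compact_continuous_image[OF assms(2) compact_Icc]]
    unfolding bounded_iff by blast
  have m1: "(\<lambda>t. indicator {x..y} t *\<^sub>R g t) \<in> borel_measurable lborel"
    using assms(1) unfolding set_integrable_def by (rule borel_measurable_integrable)
  have m2: "(\<lambda>t. indicator {x..y} t *\<^sub>R f t) \<in> borel_measurable lborel"
    using borel_integrable_atLeastAtMost'[OF assms(2)] unfolding set_integrable_def
    by (rule borel_measurable_integrable)
  show ?thesis unfolding set_integrable_def
  proof (rule Bochner_Integration.integrable_bound)
    show "integrable lborel (\<lambda>t. B *\<^sub>R (indicator {x..y} t *\<^sub>R g t))"
      using assms(1) unfolding set_integrable_def by (rule integrable_scaleR_right)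
    have "(\<lambda>t. indicator {x..y} t *\<^sub>R (g t * f t)) = (\<lambda>t. (indicator {x..y} t *\<^sub>R g t) * (indicator {x..y} t *\<^sub>R f t))"
      by (auto simp: indicator_def)
    then show "(\<lambda>t. indicator {x..y} t *\<^sub>R (g t * f t)) \<in> borel_measurable lborel"
      using borel_measurable_times[OF m1 m2] by (simp only:)
    show "AE t in lborel. norm (indicator {x..y} t *\<^sub>R (g t * f t)) \<le> norm (B *\<^sub>R (indicator {x..y} t *\<^sub>R g t))"
    proof (intro AE_I2)
      fix t
      show "norm (indicator {x..y} t *\<^sub>R (g t * f t)) \<le> norm (B *\<^sub>R (indicator {x..y} t *\<^sub>R g t))"
        using B[of t] by (auto simp: indicator_def norm_mult mult.commute[of "cmod (g t)"] intro!: mult_right_mono)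
    qed
  qed
qed

text \<open>Integrate \<open>g s * k t\<close> over the triangle s \<le> t of the square over
  \<open>{x..y}\<close>. The inner integral is \<open>f t - f x\<close> in one order and
  \<open>h y - h s\<close> in the other, so Fubini gives the product rule.\<close>

lemma has_ac_deriv_mult:
  assumes f: "has_ac_deriv f g" and h: "has_ac_deriv h k"
  shows "has_ac_deriv (\<lambda>x. f x * h x) (\<lambda>x. g x * h x + f x * k x)"
  unfolding has_ac_deriv_def
proof (intro allI impI conjI)
  fix x y :: real assume xy: "x \<le> y"
  have cf: "continuous_on {x..y} f" and ch: "continuous_on {x..y} h"
    using has_ac_deriv_continuous[OF f] has_ac_deriv_continuous[OF h] by (auto intro: continuous_on_subset)
  have i1: "set_integrable lborel {x..y} (\<lambda>t. g t * h t)"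
    by (rule set_integrable_mult_continuous[OF has_ac_deriv_integrable[OF f] ch])
  have i2: "set_integrable lborel {x..y} (\<lambda>t. f t * k t)"
    using set_integrable_mult_continuous[OF has_ac_deriv_integrable[OF h] cf] by (simp add: mult.commute)
  show "set_integrable lborel {x..y} (\<lambda>t. g t * h t + f t * k t)"
    using i1 i2 by (rule set_integral_add)
  define g0 where "g0 = (\<lambda>t. indicator {x..y} t *\<^sub>R g t)"
  define k0 where "k0 = (\<lambda>t. indicator {x..y} t *\<^sub>R k t)"
  have g0: "integrable lborel g0" and k0: "integrable lborel k0"
    using has_ac_deriv_integrable[OF f, of x y] has_ac_deriv_integrable[OF h, of x y]
    unfolding g0_def k0_def set_integrable_def by auto
  have [measurable]: "g0 \<in> borel_measurable borel" "k0 \<in> borel_measurable borel"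
    using g0 k0 by (auto dest: borel_measurable_integrable)
  define D where "D = (\<lambda>s t. indicator {..t} s *\<^sub>R (g0 s * k0 t))"
  have D: "integrable (lborel \<Otimes>\<^sub>M lborel) (case_prod D)"
  proof (rule Bochner_Integration.integrable_bound[OF integrable_lborel_pair_mult[OF g0 k0]])
    have "case_prod D = (\<lambda>p. if fst p \<le> snd p then g0 (fst p) * k0 (snd p) else 0)"
      by (auto simp: D_def indicator_def fun_eq_iff)
    then show "case_prod D \<in> borel_measurable (lborel \<Otimes>\<^sub>M lborel)" by simp
    show "AE p in lborel \<Otimes>\<^sub>M lborel. norm (case_prod D p) \<le> norm (case p of (s, t) \<Rightarrow> g0 s * k0 t)"
      by (intro AE_I2) (auto simp: D_def indicator_def)
  qed
  have s1: "(\<integral>s. D s t \<partial>lborel) = indicator {x..y} t *\<^sub>R ((f t - f x) * k t)" for t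
  proof (cases "t \<in> {x..y}")
    case True
    have "D s t = (indicator {x..t} s *\<^sub>R g s) * k t" for s
      using True by (auto simp: D_def g0_def k0_def indicator_def)
    then have "(\<integral>s. D s t \<partial>lborel) = (LINT s:{x..t}|lborel. g s) * k t"
      unfolding set_lebesgue_integral_def by (simp only: integral_mult_left_zero)
    then show ?thesis using has_ac_deriv_diff[OF f, of x t] True by simp
  qed (auto simp: D_def k0_def)
  have s2: "(\<integral>t. D s t \<partial>lborel) = indicator {x..y} s *\<^sub>R (g s * (h y - h s))" for s
  proof (cases "s \<in> {x..y}")
    case True
    have "D s t = g s * (indicator {s..y} t *\<^sub>R k t)" for t
      using True by (auto simp: D_def g0_def k0_def indicator_def)
    then have "(\<integral>t. D s t \<partial>lborel) = g s * (LINT t:{s..y}|lborel. k t)"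
      unfolding set_lebesgue_integral_def by (simp only: integral_mult_right_zero)
    then show ?thesis using has_ac_deriv_diff[OF h, of s y] True by simp
  qed (auto simp: D_def g0_def)
  have "(LINT t:{x..y}|lborel. (f t - f x) * k t) = (LINT s:{x..y}|lborel. g s * (h y - h s))"
    using lborel_pair.Fubini_integral[OF D] unfolding s1 s2 set_lebesgue_integral_def .
  moreover have "(LINT t:{x..y}|lborel. (f t - f x) * k t)
      = (LINT t:{x..y}|lborel. f t * k t) - f x * (LINT t:{x..y}|lborel. k t)"
    unfolding left_diff_distrib
    by (subst set_integral_diff) (use i2 has_ac_deriv_integrable[OF h, of x y] in simp_all)
  moreover have "(LINT s:{x..y}|lborel. g s * (h y - h s))
      = (LINT t:{x..y}|lborel. g t) * h y - (LINT t:{x..y}|lborel. g t * h t)"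
    unfolding right_diff_distrib
    by (subst set_integral_diff) (use i1 has_ac_deriv_integrable[OF f, of x y] in simp_all)
  ultimately show "f y * h y - f x * h x = (LINT t:{x..y}|lborel. g t * h t + f t * k t)"
    unfolding set_integral_add(2)[OF i1 i2] has_ac_deriv_diff[OF f xy, symmetric] has_ac_deriv_diff[OF h xy, symmetric]
    by algebra
qed

text \<open>Otherwise the norm would stay above \<open>e\<close> on a half-line, which has infinite
  measure.\<close>

lemma integrable_has_small_values:
  fixes F :: "real \<Rightarrow> complex"
  assumes "integrable lborel F" "0 < e"
  shows "\<exists>x\<ge>a. norm (F x) < e"
proof (rule ccontr)
  assume "\<not> (\<exists>x\<ge>a. norm (F x) < e)"
  then have big: "e \<le> norm (F x)" if "a \<le> x" for x using that by force
  have "integrable lborel (\<lambda>x. indicator {a..} x :: real)"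
  proof (rule Bochner_Integration.integrable_bound)
    show "integrable lborel (\<lambda>x. (1/e) *\<^sub>R F x)" using assms by simp
    show "AE x in lborel. norm (indicator {a..} x :: real) \<le> norm ((1/e) *\<^sub>R F x)"
      using big assms(2) by (intro AE_I2) (auto simp: indicator_def field_simps)
  qed simp
  then have "emeasure lborel {a..} < \<infinity>"
    by (simp add: integrable_indicator_iff)
  moreover have "emeasure lborel {a..a + real n} \<le> emeasure lborel {a..}" for n
    by (rule emeasure_mono) auto
  ultimately have *: "emeasure lborel {a..} < \<infinity>" "\<And>n. ennreal (real n) \<le> emeasure lborel {a..}" by auto
  then obtain r where r: "emeasure lborel {a..} = ennreal r" "0 \<le> r"
    by (cases "emeasure lborel {a..}") auto
  obtain n :: nat where "r < real n" using reals_Archimedean2 by blast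
  with *(2)[of n] r show False by (simp add: ennreal_le_iff)
qed

text \<open>A limit of \<open>F\<close> at infinity is not known in advance, but integrability
  supplies endpoints tending to both ends along which \<open>F\<close> is small. This carries the
  integrations by parts over the whole line.\<close>

lemma integral_ac_deriv_eq_0:
  assumes F: "has_ac_deriv F G" and "integrable lborel F" "integrable lborel G"
  shows "(LINT x|lborel. G x) = 0"
proof -
  have "\<exists>x\<ge>real n. norm (F x) < 1 / Suc n" for n
    by (rule integrable_has_small_values[OF assms(2)]) simp
  then obtain X where X: "\<And>n. X n \<ge> real n" "\<And>n. norm (F (X n)) < 1 / Suc n" by metis
  have "integrable lborel (\<lambda>x. F (- x))"
    using lborel_integrable_real_affine[OF assms(2), of "-1" 0] by simp
  then have "\<exists>x\<ge>real n. norm (F (- x)) < 1 / Suc n" for n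
    by (rule integrable_has_small_values) simp
  then obtain Y where Y: "\<And>n. Y n \<ge> real n" "\<And>n. norm (F (- Y n)) < 1 / Suc n" by metis
  have "(\<lambda>n. LINT t:{- Y n..X n}|lborel. G t) \<longlonglongrightarrow> (LINT x|lborel. G x)"
    unfolding set_lebesgue_integral_def
  proof (rule integral_dominated_convergence)
    show "integrable lborel (\<lambda>x. norm (G x))" using assms(3) by (rule integrable_norm)
    have [measurable]: "G \<in> borel_measurable borel" using assms(3) by (auto dest: borel_measurable_integrable)
    show "G \<in> borel_measurable lborel" by simp
    show "(\<lambda>x. indicator {- Y n..X n} x *\<^sub>R G x) \<in> borel_measurable lborel" for n by simp
    show "AE x in lborel. norm (indicator {- Y n..X n} x *\<^sub>R G x) \<le> norm (G x)" for n
      by (intro AE_I2) (auto simp: indicator_def)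
    show "AE x in lborel. (\<lambda>n. indicator {- Y n..X n} x *\<^sub>R G x) \<longlonglongrightarrow> G x"
    proof (intro AE_I2 tendsto_eventually)
      fix x
      obtain N :: nat where N: "\<bar>x\<bar> \<le> real N" using real_arch_simple by blast
      have "x \<in> {- Y n..X n}" if "n \<ge> N" for n using N X(1)[of n] Y(1)[of n] that by auto
      then show "\<forall>\<^sub>F n in sequentially. indicator {- Y n..X n} x *\<^sub>R G x = G x"
        by (intro eventually_sequentiallyI[of N]) simp
    qed
  qed
  moreover have "(LINT t:{- Y n..X n}|lborel. G t) = F (X n) - F (- Y n)" for n
    using has_ac_deriv_diff[OF F, of "- Y n" "X n"] X(1)[of n] Y(1)[of n] by simp
  moreover have "(\<lambda>n. F (X n) - F (- Y n)) \<longlonglongrightarrow> 0 - 0"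
  proof (intro tendsto_diff)
    show "(\<lambda>n. F (X n)) \<longlonglongrightarrow> 0"
      using X(2) by (intro Lim_null_comparison[OF _ LIMSEQ_inverse_real_of_nat])
        (auto simp: divide_inverse intro!: always_eventually less_imp_le)
    show "(\<lambda>n. F (- Y n)) \<longlonglongrightarrow> 0"
      using Y(2) by (intro Lim_null_comparison[OF _ LIMSEQ_inverse_real_of_nat])
        (auto simp: divide_inverse intro!: always_eventually less_imp_le)
  qed
  ultimately show ?thesis using LIMSEQ_unique by fastforce
qed

section \<open>Weak derivatives\<close>

primrec differentiable_upto :: "nat \<Rightarrow> (real \<Rightarrow> real) \<Rightarrow> bool" where
  "differentiable_upto 0 f = True"
| "differentiable_upto (Suc n) f =
     (\<exists>f'. (\<forall>x. (f has_field_derivative f' x) (at x)) \<and> differentiable_upto n f')"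

lemma differentiable_upto_SucD: "differentiable_upto (Suc n) f \<Longrightarrow> differentiable_upto n f"
  by (induction n arbitrary: f) auto

lemma differentiable_upto_deriv:
  assumes "differentiable_upto (Suc n) f"
  shows "f field_differentiable at x" "differentiable_upto n (deriv f)"
proof -
  from assms obtain f' where f': "\<And>x. (f has_field_derivative f' x) (at x)" "differentiable_upto n f'"
    by auto
  then have "deriv f = f'" by (auto simp: fun_eq_iff DERIV_imp_deriv)
  with f' show "f field_differentiable at x" "differentiable_upto n (deriv f)"
    by (auto simp: field_differentiable_def)
qed

text \<open>\<open>test_fun\<close> iterates \<open>deriv\<close>, which is awkward under sums and
  products. The recursive predicate exhibits some derivative at each order, so its closure
  properties are plain inductions; this lemma translates back.\<close>

lemma differentiable_upto_imp_higher_deriv: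
  assumes "\<And>n. differentiable_upto n f"
  shows "(deriv ^^ n) f field_differentiable at x"
proof -
  have "differentiable_upto m ((deriv ^^ n) f)" for m
    by (induction n arbitrary: m) (use assms differentiable_upto_deriv(2) in \<open>auto simp del: differentiable_upto.simps\<close>)
  then show ?thesis by (rule differentiable_upto_deriv(1))
qed

lemma differentiable_upto_const: "differentiable_upto n (\<lambda>x. c)"
  by (induction n arbitrary: c) (auto intro!: exI[of _ "\<lambda>x. 0"])

lemma differentiable_upto_add:
  "differentiable_upto n f \<Longrightarrow> differentiable_upto n g \<Longrightarrow> differentiable_upto n (\<lambda>x. f x + g x)"
proof (induction n arbitrary: f g)
  case (Suc n)
  then obtain f' g' where "\<And>x. (f has_field_derivative f' x) (at x)" "differentiable_upto n f'"
    "\<And>x. (g has_field_derivative g' x) (at x)" "differentiable_upto n g'" by auto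
  with Suc.IH[of f' g'] show ?case
    by (auto intro!: exI[of _ "\<lambda>x. f' x + g' x"] DERIV_add)
qed simp

lemma differentiable_upto_mult:
  "differentiable_upto n f \<Longrightarrow> differentiable_upto n g \<Longrightarrow> differentiable_upto n (\<lambda>x. f x * g x)"
proof (induction n arbitrary: f g)
  case (Suc n)
  then obtain f' g' where fg: "\<And>x. (f has_field_derivative f' x) (at x)" "differentiable_upto n f'"
    "\<And>x. (g has_field_derivative g' x) (at x)" "differentiable_upto n g'" by auto
  have "differentiable_upto n f" "differentiable_upto n g"
    using Suc.prems by (auto intro: differentiable_upto_SucD simp del: differentiable_upto.simps)
  then have "differentiable_upto n (\<lambda>x. f' x * g x + g' x * f x)"
    by (intro differentiable_upto_add Suc.IH fg)
  with fg show ?case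
    by (auto intro!: exI[of _ "\<lambda>x. f' x * g x + g' x * f x"] DERIV_mult)
qed simp

lemma differentiable_upto_affine:
  "differentiable_upto n f \<Longrightarrow> differentiable_upto n (\<lambda>x. f (a * x + c))"
proof (induction n arbitrary: f)
  case (Suc n)
  then obtain f' where f: "\<And>x. (f has_field_derivative f' x) (at x)" "differentiable_upto n f'" by auto
  have "((\<lambda>x. f (a * x + c)) has_field_derivative f' (a * x + c) * a) (at x)" for x
  proof -
    have "((\<lambda>x. a * x + c) has_field_derivative a) (at x)" by (auto intro!: derivative_eq_intros)
    from DERIV_chain'[OF this f(1)] show ?thesis .
  qed
  moreover have "differentiable_upto n (\<lambda>x. f' (a * x + c) * a)"
    by (rule differentiable_upto_mult[OF Suc.IH[OF f(2)] differentiable_upto_const])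
  ultimately show ?case by (auto intro!: exI[of _ "\<lambda>x. f' (a * x + c) * a"])
qed simp

lemma poly_exp_tendsto_0: "((\<lambda>y. poly p y * exp (- y)) \<longlongrightarrow> 0) at_top" for p :: "real poly"
proof -
  have "((\<lambda>y. \<Sum>i\<le>degree p. coeff p i * (y ^ i / exp y)) \<longlongrightarrow> (\<Sum>i\<le>degree p. coeff p i * 0)) at_top"
    by (intro tendsto_intros tendsto_power_div_exp_0)
  then show ?thesis
    by (simp add: poly_altdef sum_distrib_right exp_minus divide_inverse mult.assoc)
qed

text \<open>A class closed under differentiation: the derivative of p(1/x) exp(-1/x) is q(1/x)
  exp(-1/x) with q = X^2 (p - p'), and \<open>[:0,0,1:]\<close> is X^2. Smoothness at 0 is thereby
  reduced to one first-order limit valid for all polynomials.\<close>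

definition flat_exp :: "real poly \<Rightarrow> real \<Rightarrow> real" where
  "flat_exp p x = (if x > 0 then poly p (1 / x) * exp (- 1 / x) else 0)"

lemma flat_exp_has_derivative:
  "(flat_exp p has_field_derivative flat_exp ([:0,0,1:] * (p - pderiv p)) x) (at x)"
proof (cases x "0::real" rule: linorder_cases)
  case less
  have "((\<lambda>x. 0) has_field_derivative 0) (at x)" by simp
  then have "(flat_exp p has_field_derivative 0) (at x)"
    by (rule DERIV_cong_ev[THEN iffD2, rotated 3, OF _ refl _ refl])
       (use less in \<open>auto simp: flat_exp_def intro!: eventually_mono[OF eventually_nhds_in_open[of "{..<0}"]]\<close>)
  then show ?thesis using less by (simp add: flat_exp_def)
next
  case greater
  have "((\<lambda>x. poly p (1 / x) * exp (- 1 / x)) has_field_derivative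
      poly ([:0,0,1:] * (p - pderiv p)) (1 / x) * exp (- 1 / x)) (at x)"
    using greater
    by (auto intro!: derivative_eq_intros DERIV_chain'[where g="poly p"] poly_DERIV
        simp: field_simps power2_eq_square)
  then have "(flat_exp p has_field_derivative poly ([:0,0,1:] * (p - pderiv p)) (1 / x) * exp (- 1 / x)) (at x)"
    by (rule DERIV_cong_ev[THEN iffD2, rotated 3, OF _ refl _ refl])
       (use greater in \<open>auto simp: flat_exp_def intro!: eventually_mono[OF eventually_nhds_in_open[of "{0<..}"]]\<close>)
  then show ?thesis using greater by (simp add: flat_exp_def)
next
  case equal
  have "((\<lambda>h. (flat_exp p (0 + h) - flat_exp p 0) / h) \<longlongrightarrow> 0) (at 0)"
  proof (rule filterlim_split_at)
    show "((\<lambda>h. (flat_exp p (0 + h) - flat_exp p 0) / h) \<longlongrightarrow> 0) (at_left 0)"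
      by (rule tendsto_eventually)
        (auto simp: flat_exp_def eventually_at_filter intro!: always_eventually)
    have "((\<lambda>h. poly ([:0,1:] * p) (inverse h) * exp (- inverse h)) \<longlongrightarrow> 0) (at_right 0)"
      by (rule filterlim_compose[OF poly_exp_tendsto_0 filterlim_inverse_at_top_right])
    then show "((\<lambda>h. (flat_exp p (0 + h) - flat_exp p 0) / h) \<longlongrightarrow> 0) (at_right 0)"
      by (rule Lim_transform_eventually)
        (auto simp: flat_exp_def eventually_at_filter divide_inverse intro!: always_eventually)
  qed
  then show ?thesis using equal by (simp add: DERIV_def flat_exp_def)
qed

lemma differentiable_upto_flat_exp: "differentiable_upto n (flat_exp p)"
  by (induction n arbitrary: p) (auto intro: flat_exp_has_derivative)

text \<open>The normalised antiderivative of the bump exp(-1/x) exp(-1/(1 - x)) supported on the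
  unit interval.\<close>

lemma smooth_step_exists:
  "\<exists>\<Psi> \<rho> :: real \<Rightarrow> real. (\<forall>x. (\<Psi> has_field_derivative \<rho> x) (at x)) \<and> (\<forall>n. differentiable_upto n \<Psi>) \<and>
     (\<forall>x\<le>0. \<Psi> x = 0) \<and> (\<forall>x\<ge>1. \<Psi> x = 1) \<and> (\<forall>x. 0 \<le> \<Psi> x \<and> \<Psi> x \<le> 1) \<and> (\<forall>x. x \<notin> {0..1} \<longrightarrow> \<rho> x = 0) \<and>
     continuous_on UNIV \<rho>"
proof -
  define r where "r = (\<lambda>x. flat_exp 1 x * flat_exp 1 ((-1) * x + 1))"
  have smooth: "differentiable_upto n r" for n
    unfolding r_def by (intro differentiable_upto_mult differentiable_upto_flat_exp differentiable_upto_affine)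
  have cont: "continuous_on UNIV r"
    using differentiable_upto_deriv(1)[OF smooth[of 1, unfolded One_nat_def]]
    by (auto intro!: continuous_at_imp_continuous_on field_differentiable_imp_continuous_at)
  have nonneg: "r x \<ge> 0" for x by (simp add: r_def flat_exp_def)
  have zero: "r x = 0" if "x \<le> 0 \<or> x \<ge> 1" for x using that by (auto simp: r_def flat_exp_def)
  have pos: "r (1/2) > 0" by (simp add: r_def flat_exp_def)
  obtain G where G: "\<And>x. (G has_field_derivative r x) (at x)"
    using einterval_antiderivative[of "-\<infinity>" "\<infinity>" r] cont
    by (auto simp: continuous_on_eq_continuous_at has_real_derivative_iff_has_vector_derivative)
  have mono: "G x \<le> G y" if "x \<le> y" for x y
    by (rule DERIV_nonneg_imp_nondecreasing[OF that]) (use G nonneg in blast)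
  have left: "G x = G 0" if "x \<le> 0" for x
  proof (cases "x = 0")
    case False
    have "\<exists>z>x. z < 0 \<and> G 0 - G x = (0 - x) * r z"
      using False that G by (intro MVT2) auto
    then show ?thesis using zero by force
  qed simp
  have right: "G x = G 1" if "x \<ge> 1" for x
  proof (cases "x = 1")
    case False
    have "\<exists>z>1. z < x \<and> G x - G 1 = (x - 1) * r z"
      using False that G by (intro MVT2) auto
    then show ?thesis using zero by force
  qed simp
  \<comment> \<open>Equality would make the nondecreasing \<open>G\<close> constant on the unit
    interval, against the positive derivative at 1/2.\<close>
  have "G 1 \<noteq> G 0"
  proof
    assume eq: "G 1 = G 0"
    have "((\<lambda>x. G 0) has_field_derivative 0) (at (1/2))" by simp
    then have "(G has_field_derivative 0) (at (1/2))"
    proof (rule DERIV_cong_ev[THEN iffD2, rotated 3, OF _ refl _ refl])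
      have "G x = G 0" if "x \<in> {0<..<1}" for x using mono[of 0 x] mono[of x 1] eq that by auto
      then show "\<forall>\<^sub>F x in nhds (1/2). G x = G 0"
        by (intro eventually_mono[OF eventually_nhds_in_open[of "{0<..<1}"]]) auto
    qed
    with G[of "1/2"] have "r (1/2) = 0" by (rule DERIV_unique)
    with pos show False by simp
  qed
  moreover have "G 0 \<le> G 1" using mono[of 0 1] by simp
  ultimately have c: "G 1 - G 0 > 0" by simp
  define P where "P = (\<lambda>x. (G x + - G 0) * (1 / (G 1 - G 0)))"
  define q where "q = (\<lambda>x. r x * (1 / (G 1 - G 0)))"
  have P: "(P has_field_derivative q x) (at x)" for x
    unfolding P_def q_def using c by (auto intro!: derivative_eq_intros G)
  have "differentiable_upto n G" for n
    using differentiable_upto_SucD[of n G] G smooth[of n] by auto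
  then have "differentiable_upto n P" for n
    unfolding P_def by (intro differentiable_upto_mult differentiable_upto_add differentiable_upto_const)
  moreover have "0 \<le> P x \<and> P x \<le> 1" for x
  proof -
    have "G 0 \<le> G x" using mono[of 0 x] left[of x] by (cases "x \<le> 0") auto
    moreover have "G x \<le> G 1" using mono[of x 1] right[of x] by (cases "x \<ge> 1") auto
    ultimately show ?thesis using c by (auto simp: P_def field_simps)
  qed
  moreover have "continuous_on UNIV q" unfolding q_def by (intro continuous_intros cont)
  moreover have "P x = 0" if "x \<le> 0" for x using left[OF that] by (simp add: P_def)
  moreover have "P x = 1" if "x \<ge> 1" for x using right[OF that] c by (simp add: P_def)
  moreover have "\<forall>x. x \<notin> {0..1} \<longrightarrow> q x = 0" using zero by (auto simp: q_def)
  ultimately show ?thesis using P by blast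
qed

section \<open>Weak derivatives as densities\<close>

lemma L2_set_integrable:
  assumes "g \<in> L2_fun"
  shows "set_integrable lborel {x..y} g"
  unfolding set_integrable_def
proof (rule Bochner_Integration.integrable_bound)
  have [measurable]: "g \<in> borel_measurable borel" using assms by (rule L2_fun_measurable)
  show "integrable lborel (\<lambda>t. indicator {x..y} t + (cmod (g t))\<^sup>2)"
    using L2_fun_integrable_norm_sq[OF assms]
    by (intro Bochner_Integration.integrable_add integrable_real_indicator)
      (auto simp: emeasure_lborel_Icc_eq simp del: emeasure_lborel_Icc)
  show "(\<lambda>t. indicator {x..y} t *\<^sub>R g t) \<in> borel_measurable lborel" by simp
  have "a \<le> 1 + a\<^sup>2" for a :: real
    using zero_le_power2[of "a - 1/2"] by (simp add: power2_eq_square algebra_simps)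
  then show "AE t in lborel. norm (indicator {x..y} t *\<^sub>R g t) \<le> norm (indicator {x..y} t + (cmod (g t))\<^sup>2)"
    by (intro AE_I2) (auto simp: indicator_def)
qed

text \<open>Test with smoothed indicators of \<open>{x..y}\<close>, differences of two steps of
  width \<open>1 / Suc n\<close>. Their derivatives are approximate deltas at \<open>x\<close> and
  \<open>y\<close>, so in the limit the weak identity reads: f x - f y is minus the integral of
  g.\<close>

lemma weak_deriv_imp_ac_deriv:
  assumes cont: "continuous_on UNIV f" and g: "g \<in> L2_fun" and weak: "has_weak_deriv f g"
  shows "has_ac_deriv f g"
proof -
  obtain P r :: "real \<Rightarrow> real" where P: "\<And>x. (P has_field_derivative r x) (at x)" "\<And>n. differentiable_upto n P"
     "\<And>x. x \<le> 0 \<Longrightarrow> P x = 0" "\<And>x. x \<ge> 1 \<Longrightarrow> P x = 1" "\<And>x. 0 \<le> P x" "\<And>x. P x \<le> 1"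
     "\<And>x. x \<notin> {0..1} \<Longrightarrow> r x = 0" and rc: "continuous_on UNIV r"
    using smooth_step_exists by metis
  have Pc: "continuous_on UNIV P" using P(1) by (meson DERIV_continuous continuous_at_imp_continuous_on)
  have [measurable]: "P \<in> borel_measurable borel" "r \<in> borel_measurable borel" "f \<in> borel_measurable borel"
    using rc cont Pc by (auto intro: borel_measurable_continuous_onI)
  have [measurable]: "g \<in> borel_measurable borel" using g by (rule L2_fun_measurable)
  have r1: "(LINT s|lborel. of_real (r s)) = (1 :: complex)"
  proof -
    have "(LINT s|lborel. indicator {0..1} s *\<^sub>R r s) = P 1 - P 0"
      using P(1) rc by (intro integral_FTC_Icc)
        (auto simp: has_real_derivative_iff_has_vector_derivative[symmetric]
          intro: has_field_derivative_at_within continuous_on_subset)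
    also have "(LINT s|lborel. indicator {0..1} s *\<^sub>R r s) = (LINT s|lborel. r s)"
      using P(7) by (intro Bochner_Integration.integral_cong) (auto simp: indicator_def)
    finally show ?thesis using P(3,4) by simp
  qed
  \<comment> \<open>The substitution t = x + s / (n + 1) moves the concentration into the argument
    of \<open>f\<close>; continuity of \<open>f\<close> and \<open>r1\<close> then give the
    limit.\<close>
  have mollify: "(\<lambda>n. LINT t|lborel. f t * of_real (Suc n * r (Suc n * t + - Suc n * x))) \<longlonglongrightarrow> f x" for x :: real
  proof -
    have eq: "(LINT t|lborel. f t * of_real (Suc n * r (Suc n * t + - Suc n * x)))
        = (LINT s|lborel. f (x + (1 / Suc n) * s) * of_real (r s))" for n
    proof -
      have "real (Suc n) * (x + (1 / Suc n) * s) + - real (Suc n) * x = s" for s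
        by (simp add: field_simps del: of_nat_Suc)
      then show ?thesis
        by (subst lborel_integral_real_affine[where c="1 / Suc n" and t=x])
          (simp_all add: scaleR_conv_of_real mult.left_commute del: of_nat_Suc flip: integral_mult_right_zero)
    qed
    have "bounded (f ` {x..x+1})"
      using compact_continuous_image[OF continuous_on_subset[OF cont subset_UNIV] compact_Icc[of x "x + 1"]]
      by (rule compact_imp_bounded)
    then obtain B where B: "\<And>t. t \<in> {x..x+1} \<Longrightarrow> cmod (f t) \<le> B"
      unfolding bounded_iff by (metis imageI)
    have "(\<lambda>n. LINT s|lborel. f (x + (1 / Suc n) * s) * of_real (r s)) \<longlonglongrightarrow> (LINT s|lborel. f x * of_real (r s))"
    proof (rule integral_dominated_convergence)
      show "integrable lborel (\<lambda>s. indicator {0..1} s *\<^sub>R (B * \<bar>r s\<bar>))"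
        by (intro borel_integrable_compact continuous_intros continuous_on_subset[OF rc]) auto
      show "(\<lambda>s. f x * of_real (r s)) \<in> borel_measurable lborel" by simp
      show "(\<lambda>s. f (x + (1 / Suc n) * s) * of_real (r s)) \<in> borel_measurable lborel" for n by simp
      show "AE s in lborel. norm (f (x + (1 / Suc n) * s) * of_real (r s)) \<le> indicator {0..1} s *\<^sub>R (B * \<bar>r s\<bar>)" for n
      proof (intro AE_I2)
        fix s :: real
        show "norm (f (x + (1 / Suc n) * s) * of_real (r s)) \<le> indicator {0..1} s *\<^sub>R (B * \<bar>r s\<bar>)"
        proof (cases "s \<in> {0..1}")
          case True
          then have "x + (1 / Suc n) * s \<in> {x..x+1}"
            by (auto simp: field_simps intro: order_trans[of _ 1])
          with B True show ?thesis by (auto simp: norm_mult intro!: mult_right_mono)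
        qed (use P(7) in auto)
      qed
      show "AE s in lborel. (\<lambda>n. f (x + (1 / Suc n) * s) * of_real (r s)) \<longlonglongrightarrow> f x * of_real (r s)"
      proof (intro AE_I2 tendsto_mult tendsto_const)
        fix s :: real
        have "(\<lambda>n. x + (1 / Suc n) * s) \<longlonglongrightarrow> x + 0 * s"
          using LIMSEQ_inverse_real_of_nat
          by (intro tendsto_intros) (simp add: divide_inverse)
        then show "(\<lambda>n. f (x + (1 / Suc n) * s)) \<longlonglongrightarrow> f x"
          using cont by (intro continuous_on_tendsto_compose[OF cont]) auto
      qed
    qed
    then show ?thesis using r1 unfolding eq by simp
  qed
  show ?thesis unfolding has_ac_deriv_def
  proof (intro allI impI conjI)
    fix x y :: real assume xy: "x \<le> y"
    show "set_integrable lborel {x..y} g" using g by (rule L2_set_integrable)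
    define \<phi> where "\<phi> = (\<lambda>n (t::real). P (Suc n * t + - Suc n * x) + (-1) * P (Suc n * t + - Suc n * y))"
    define \<phi>' where "\<phi>' = (\<lambda>n (t::real). Suc n * r (Suc n * t + - Suc n * x) - Suc n * r (Suc n * t + - Suc n * y))"
    have d: "(\<phi> n has_field_derivative \<phi>' n t) (at t)" for n t
      unfolding \<phi>_def \<phi>'_def
      by (auto intro!: derivative_eq_intros DERIV_chain'[where g=P] P(1) simp del: of_nat_Suc)
    then have deriv: "deriv (\<phi> n) = \<phi>' n" for n by (auto simp: fun_eq_iff DERIV_imp_deriv)
    have out: "\<phi> n t = 0" if "t \<notin> {x..y+1}" for n t
    proof (cases "t < x")
      case True
      then have "Suc n * t \<le> Suc n * x" "Suc n * t \<le> Suc n * y" using xy by (auto intro!: mult_left_mono simp del: of_nat_Suc)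
      then show ?thesis by (simp add: \<phi>_def P(3) del: of_nat_Suc)
    next
      case False
      with that have "t - y \<ge> 1" "t - x \<ge> 1" using xy by auto
      then have "1 * 1 \<le> real (Suc n) * (t - y)" "1 * 1 \<le> real (Suc n) * (t - x)" by (intro mult_mono; simp)+
      then show ?thesis by (simp add: \<phi>_def P(4) right_diff_distrib del: of_nat_Suc)
    qed
    have test: "test_fun (\<phi> n)" for n
      unfolding test_fun_def
    proof (intro conjI allI)
      show "(deriv ^^ k) (\<phi> n) field_differentiable at t" for k t
        unfolding \<phi>_def
        by (rule differentiable_upto_imp_higher_deriv[OF differentiable_upto_add[OF
              differentiable_upto_affine[OF P(2)] differentiable_upto_mult[OF differentiable_upto_const
              differentiable_upto_affine[OF P(2)]]]])
      have "{t. \<phi> n t \<noteq> 0} \<subseteq> {x..y+1}" using out by blast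
      then have "closure {t. \<phi> n t \<noteq> 0} \<subseteq> {x..y+1}" by (rule closure_minimal) simp
      then show "compact (closure {t. \<phi> n t \<noteq> 0})"
        by (metis bounded_closed_interval bounded_subset closed_closure compact_eq_bounded_closed)
    qed
    have i: "integrable lborel (\<lambda>t. f t * of_real (Suc n * r (Suc n * t + - Suc n * z)))" for n and z :: real
    proof -
      have sub: "t \<in> {z..z+1}" if nz: "r (Suc n * t + - Suc n * z) \<noteq> 0" for t :: real
      proof -
        have "Suc n * t + - Suc n * z \<in> {0..1}" using P(7) nz by blast
        then have "0 \<le> real (Suc n) * (t - z)" "real (Suc n) * (t - z) \<le> 1"
          by (auto simp: right_diff_distrib simp del: of_nat_Suc)
        moreover from this(1) have "0 \<le> t - z" by (simp add: zero_le_mult_iff del: of_nat_Suc)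
        moreover have "1 * (t - z) \<le> real (Suc n) * (t - z)" by (rule mult_right_mono) (use calculation in auto)
        ultimately show ?thesis by auto
      qed
      have "integrable lborel (\<lambda>t. indicator {z..z+1} t *\<^sub>R (f t * of_real (Suc n * r (Suc n * t + - Suc n * z))))"
        by (intro borel_integrable_compact continuous_intros continuous_on_compose2[OF rc]
            continuous_on_subset[OF cont]) auto
      also have "(\<lambda>t::real. indicator {z..z+1} t *\<^sub>R (f t * of_real (Suc n * r (Suc n * t + - Suc n * z)))) =
         (\<lambda>t::real. f t * of_real (Suc n * r (Suc n * t + - Suc n * z)))"
        using sub by (fastforce simp: indicator_def fun_eq_iff)
      finally show ?thesis .
    qed
    have "(\<lambda>n. LINT t|lborel. f t * of_real (\<phi>' n t)) \<longlonglongrightarrow> f x - f y"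
    proof -
      have "(LINT t|lborel. f t * of_real (\<phi>' n t)) =
         (LINT t|lborel. f t * of_real (Suc n * r (Suc n * t + - Suc n * x)))
         - (LINT t|lborel. f t * of_real (Suc n * r (Suc n * t + - Suc n * y)))" for n
        unfolding \<phi>'_def of_real_diff right_diff_distrib by (rule Bochner_Integration.integral_diff[OF i i])
      then show ?thesis using tendsto_diff[OF mollify mollify] by simp
    qed
    moreover have "(\<lambda>n. LINT t|lborel. g t * of_real (\<phi> n t)) \<longlonglongrightarrow> (LINT t|lborel. indicator {x..y} t *\<^sub>R g t)"
    proof (rule integral_dominated_convergence)
      show "integrable lborel (\<lambda>t. norm (indicator {x..y+1} t *\<^sub>R g t))"
        using L2_set_integrable[OF g, of x "y+1"] unfolding set_integrable_def by (rule integrable_norm)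
      show "(\<lambda>t. indicator {x..y} t *\<^sub>R g t) \<in> borel_measurable lborel" by simp
      show "(\<lambda>t. g t * of_real (\<phi> n t)) \<in> borel_measurable lborel" for n unfolding \<phi>_def by simp
      show "AE t in lborel. norm (g t * of_real (\<phi> n t)) \<le> norm (indicator {x..y+1} t *\<^sub>R g t)" for n
      proof (intro AE_I2)
        fix t
        have "\<bar>\<phi> n t\<bar> \<le> 1"
          unfolding \<phi>_def using P(5,6)[of "Suc n * t + - Suc n * x"] P(5,6)[of "Suc n * t + - Suc n * y"]
          by (auto simp del: of_nat_Suc simp: abs_le_iff)
        then show "norm (g t * of_real (\<phi> n t)) \<le> norm (indicator {x..y+1} t *\<^sub>R g t)"
          using out[of t n] by (cases "t \<in> {x..y+1}") (auto simp: norm_mult mult_left_le)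
      qed
      have lim1: "(\<lambda>n. P (Suc n * t + - Suc n * z)) \<longlonglongrightarrow> (if t \<le> z then 0 else 1)" for t z :: real
      proof (cases "t \<le> z")
        case True
        then have "Suc n * t \<le> Suc n * z" for n by (intro mult_left_mono) (auto simp del: of_nat_Suc)
        then show ?thesis using True by (simp add: P(3) del: of_nat_Suc)
      next
        case False
        obtain N :: nat where N: "1 / (t - z) \<le> real N" using real_arch_simple by blast
        have "P (Suc n * t + - Suc n * z) = 1" if "n \<ge> N" for n
        proof (rule P(4))
          have "1 / (t - z) \<le> real (Suc n)" using N that by simp
          then have "1 \<le> real (Suc n) * (t - z)" using False by (simp add: field_simps del: of_nat_Suc)
          then show "1 \<le> Suc n * t + - Suc n * z" by (simp add: right_diff_distrib del: of_nat_Suc)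
        qed
        then have "\<forall>\<^sub>F n in sequentially. P (Suc n * t + - Suc n * z) = 1"
          by (intro eventually_sequentiallyI[of N]) blast
        then show ?thesis using False by (simp add: tendsto_eventually)
      qed
      \<comment> \<open>At t = x the cutoffs are 0 while the indicator is 1, so this single point is
        discarded.\<close>
      show "AE t in lborel. (\<lambda>n. g t * of_real (\<phi> n t)) \<longlonglongrightarrow> indicator {x..y} t *\<^sub>R g t"
      proof (rule AE_mp[OF AE_lborel_singleton[of x]], intro AE_I2 impI)
        fix t assume "t \<noteq> x"
        have "(\<lambda>n. g t * of_real (\<phi> n t)) \<longlonglongrightarrow> g t * of_real ((if t \<le> x then 0 else 1) + (-1) * (if t \<le> y then 0 else 1))"
          unfolding \<phi>_def by (intro tendsto_intros lim1)
        also have "g t * of_real ((if t \<le> x then 0 else 1) + (-1) * (if t \<le> y then 0 else 1)) = indicator {x..y} t *\<^sub>R g t"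
          using xy \<open>t \<noteq> x\<close> by (auto simp: indicator_def)
        finally show "(\<lambda>n. g t * of_real (\<phi> n t)) \<longlonglongrightarrow> indicator {x..y} t *\<^sub>R g t" .
      qed
    qed
    moreover have "(LINT t|lborel. f t * of_real (\<phi>' n t)) = - (LINT t|lborel. g t * of_real (\<phi> n t))" for n
      using weak test[of n] unfolding has_weak_deriv_def by (simp add: deriv[symmetric])
    ultimately have "f x - f y = - (LINT t|lborel. indicator {x..y} t *\<^sub>R g t)"
      using LIMSEQ_unique[OF _ tendsto_minus] by (metis (no_types, lifting) LIMSEQ_unique ext tendsto_minus)
    then show "f y - f x = (LINT t:{x..y}|lborel. g t)"
      unfolding set_lebesgue_integral_def by (metis minus_diff_eq minus_minus)
  qed
qed

text \<open>The product of \<open>f\<close> with the test function has compact support, so its total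
  derivative integrates to 0.\<close>

lemma ac_deriv_imp_weak_deriv:
  assumes f: "has_ac_deriv f g"
  shows "has_weak_deriv f g"
  unfolding has_weak_deriv_def
proof (intro allI impI)
  fix \<phi> assume test: "test_fun \<phi>"
  have d1: "\<phi> field_differentiable at x" for x using test unfolding test_fun_def by (metis funpow_0)
  have d2: "deriv \<phi> field_differentiable at x" for x
    using test unfolding test_fun_def by (metis funpow_0 funpow_simps_right(2) comp_apply)
  have c1: "continuous_on UNIV \<phi>" and c2: "continuous_on UNIV (deriv \<phi>)"
    using d1 d2 by (auto intro!: continuous_at_imp_continuous_on field_differentiable_imp_continuous_at)
  have "bounded (closure {x. \<phi> x \<noteq> 0})" using test unfolding test_fun_def by (auto intro: compact_imp_bounded)
  then obtain R where R: "\<And>x. x \<in> closure {x. \<phi> x \<noteq> 0} \<Longrightarrow> norm x \<le> R" unfolding bounded_iff by blast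
  have z1: "\<phi> x = 0" if "x \<notin> {-R..R}" for x
    using R[of x] closure_subset[of "{x. \<phi> x \<noteq> 0}"] that by auto
  have z2: "deriv \<phi> x = 0" if "x \<notin> {-R..R}" for x
  proof -
    have "\<forall>\<^sub>F t in nhds x. \<phi> t = 0"
      using that z1 by (intro eventually_mono[OF eventually_nhds_in_open[of "- {-R..R}"]]) auto
    then have "deriv \<phi> x = deriv (\<lambda>x. 0) x" by (rule deriv_cong_ev) simp
    then show ?thesis by simp
  qed
  have ac: "has_ac_deriv (\<lambda>x. of_real (\<phi> x)) (\<lambda>x. of_real (deriv \<phi> x))"
  proof (rule has_ac_derivI_C1)
    show "((\<lambda>x. complex_of_real (\<phi> x)) has_vector_derivative of_real (deriv \<phi> x)) (at x)" for x
      using d1[of x] by (intro has_vector_derivative_of_real)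
        (simp add: DERIV_deriv_iff_field_differentiable flip: has_real_derivative_iff_has_vector_derivative)
    show "continuous_on UNIV (\<lambda>x. complex_of_real (deriv \<phi> x))" by (intro continuous_intros c2)
  qed
  have cf: "continuous_on UNIV f" using f by (rule has_ac_deriv_continuous)
  have i1: "integrable lborel (\<lambda>x. f x * of_real (\<phi> x))"
  proof -
    have "integrable lborel (\<lambda>x. indicator {-R..R} x *\<^sub>R (f x * of_real (\<phi> x)))"
      by (intro borel_integrable_compact continuous_intros continuous_on_subset[OF cf] continuous_on_subset[OF c1]) auto
    also have "(\<lambda>x. indicator {-R..R} x *\<^sub>R (f x * of_real (\<phi> x))) = (\<lambda>x. f x * of_real (\<phi> x))"
      using z1 by (fastforce simp: indicator_def)
    finally show ?thesis .
  qed
  have i2: "integrable lborel (\<lambda>x. f x * of_real (deriv \<phi> x))"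
  proof -
    have "integrable lborel (\<lambda>x. indicator {-R..R} x *\<^sub>R (f x * of_real (deriv \<phi> x)))"
      by (intro borel_integrable_compact continuous_intros continuous_on_subset[OF cf] continuous_on_subset[OF c2]) auto
    also have "(\<lambda>x. indicator {-R..R} x *\<^sub>R (f x * of_real (deriv \<phi> x))) = (\<lambda>x. f x * of_real (deriv \<phi> x))"
      using z2 by (fastforce simp: indicator_def)
    finally show ?thesis .
  qed
  have i3: "integrable lborel (\<lambda>x. g x * of_real (\<phi> x))"
  proof -
    have "continuous_on {-R..R} (\<lambda>x. complex_of_real (\<phi> x))"
      by (intro continuous_intros continuous_on_subset[OF c1]) auto
    from set_integrable_mult_continuous[OF has_ac_deriv_integrable[OF f] this]
    have "integrable lborel (\<lambda>x. indicator {-R..R} x *\<^sub>R (g x * of_real (\<phi> x)))"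
      unfolding set_integrable_def .
    also have "(\<lambda>x. indicator {-R..R} x *\<^sub>R (g x * of_real (\<phi> x))) = (\<lambda>x. g x * of_real (\<phi> x))"
      using z1 by (fastforce simp: indicator_def)
    finally show ?thesis .
  qed
  have "(LINT x|lborel. g x * of_real (\<phi> x) + f x * of_real (deriv \<phi> x)) = 0"
    by (rule integral_ac_deriv_eq_0[OF has_ac_deriv_mult[OF f ac] i1]) (use i2 i3 in simp)
  then show "(LINT x|lborel. f x * of_real (deriv \<phi> x)) = - (LINT x|lborel. g x * of_real (\<phi> x))"
    using i2 i3 by (simp add: add_eq_0_iff)
qed

text \<open>All integrals of \<open>d\<close> over compact intervals vanish. Half-lines are stable
  under intersection and generate the Borel sets, so on each bounded window the integral over every
  Borel set vanishes, and hence \<open>d\<close> itself almost everywhere.\<close>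

lemma ac_deriv_of_const_AE:
  assumes d: "has_ac_deriv (\<lambda>x. c) d"
  shows "AE x in lborel. d x = 0"
proof -
  have "AE x in lborel. indicator {-real n..real n} x *\<^sub>R d x = 0" for n
  proof (rule sigma_finite_measure.density_zero[OF sigma_finite_lborel])
    let ?d = "\<lambda>x. indicator {-real n..real n} x *\<^sub>R d x"
    show i: "integrable lborel ?d"
      using has_ac_deriv_integrable[OF d] unfolding set_integrable_def .
    have [measurable]: "?d \<in> borel_measurable borel" using i by (auto dest: borel_measurable_integrable)
    have ii: "set_integrable lborel A ?d" if "A \<in> sets borel" for A
      unfolding set_integrable_def by (rule integrable_mult_indicator[OF _ i]) (use that in simp)
    have tot: "(LINT x|lborel. ?d x) = 0"
      using has_ac_deriv_diff[OF d, of "-real n" "real n"] unfolding set_lebesgue_integral_def by simp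
    fix A :: "real set" assume "A \<in> sets lborel"
    then have A: "A \<in> sigma_sets UNIV (range (\<lambda>a. {..a}))"
      by (simp add: borel_eq_atMost)
    have 1: "Int_stable (range (\<lambda>a::real. {..a}))" by (auto simp: Int_stable_def)
    have 2: "range (\<lambda>a::real. {..a}) \<subseteq> Pow UNIV" by auto
    from 1 2 A show "set_lebesgue_integral lborel A ?d = 0"
    proof (induction rule: sigma_sets_induct_disjoint)
      case (basic A)
      then obtain a where A: "A = {..a}" by auto
      show ?case
      proof (cases "- real n \<le> a")
        case True
        have "(\<lambda>x. indicator {..a} x *\<^sub>R ?d x) = (\<lambda>x. indicator {-real n..min a (real n)} x *\<^sub>R d x)"
          by (auto simp: indicator_def fun_eq_iff)
        then show ?thesis
          using has_ac_deriv_diff[OF d, of "-real n" "min a (real n)"] True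
          unfolding A set_lebesgue_integral_def by simp
      next
        case False
        then have "(\<lambda>x. indicator {..a} x *\<^sub>R ?d x) = (\<lambda>x. 0)" by (auto simp: indicator_def fun_eq_iff)
        then show ?thesis unfolding A set_lebesgue_integral_def by simp
      qed
    next
      case empty
      then show ?case by (simp add: set_lebesgue_integral_def)
    next
      case (compl A)
      then have A: "A \<in> sets borel" by (simp add: borel_eq_atMost)
      have "indicator (UNIV - A) x *\<^sub>R ?d x = ?d x - indicator A x *\<^sub>R ?d x" for x
        by (auto simp: indicator_def)
      then have "set_lebesgue_integral lborel (UNIV - A) ?d = (LINT x|lborel. ?d x) - set_lebesgue_integral lborel A ?d"
        unfolding set_lebesgue_integral_def using i ii[OF A] unfolding set_integrable_def
        by (simp only: Bochner_Integration.integral_diff)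
      then show ?case using compl tot by simp
    next
      case (union A)
      then have A: "A i \<in> sets borel" for i by (auto simp: borel_eq_atMost)
      have "set_lebesgue_integral lborel (\<Union>i. A i) ?d = (\<Sum>i. set_lebesgue_integral lborel (A i) ?d)"
      proof (rule lebesgue_integral_countable_add)
        show "A i \<inter> A j = {}" if "i \<noteq> j" for i j using union(1) that by (auto simp: disjoint_family_on_def)
        show "set_integrable lborel (\<Union>i. A i) ?d" by (rule ii) (use A in auto)
      qed (use A in auto)
      then show ?case using union by simp
    qed
  qed
  then have "AE x in lborel. \<forall>n. indicator {-real n..real n} x *\<^sub>R d x = 0"
    by (subst AE_all_countable) (intro allI)
  then show ?thesis
  proof (rule AE_mp, intro AE_I2 impI)
    fix x assume *: "\<forall>n. indicator {-real n..real n} x *\<^sub>R d x = 0"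
    obtain n :: nat where n: "\<bar>x\<bar> \<le> real n" using real_arch_simple by blast
    then have "x \<in> {-real n..real n}" by auto
    with spec[OF *, of n] show "d x = 0" by simp
  qed
qed

section \<open>The form and its eigenpairs\<close>

text \<open>An element of the form domain together with an explicit derivative.
  \<open>weak_deriv\<close> is an arbitrary choice, whereas sums, reflections and Hermite functions
  come with a natural \<open>g\<close>.\<close>

definition osc_pair :: "(real \<Rightarrow> complex) \<Rightarrow> (real \<Rightarrow> complex) \<Rightarrow> bool" where
  "osc_pair f g \<longleftrightarrow> f \<in> L2_fun \<and> (\<lambda>x. of_real x * f x) \<in> L2_fun \<and> g \<in> L2_fun \<and> has_ac_deriv f g"

lemma osc_pairD:
  assumes "osc_pair f g"
  shows "f \<in> L2_fun" "(\<lambda>x. of_real x * f x) \<in> L2_fun" "g \<in> L2_fun" "has_ac_deriv f g"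
  using assms by (auto simp: osc_pair_def)

lemma osc_pair_zero: "osc_pair (\<lambda>x. 0) (\<lambda>x. 0)"
  by (simp add: osc_pair_def has_ac_deriv_const)

lemma osc_pair_add:
  assumes "osc_pair f g" "osc_pair h k"
  shows "osc_pair (\<lambda>x. f x + h x) (\<lambda>x. g x + k x)"
  using assms L2_fun_add[OF osc_pairD(2)[OF assms(1)] osc_pairD(2)[OF assms(2)]]
  by (auto simp: osc_pair_def L2_fun_add has_ac_deriv_add distrib_left)

lemma osc_pair_scale:
  assumes "osc_pair f g"
  shows "osc_pair (\<lambda>x. c * f x) (\<lambda>x. c * g x)"
  using assms L2_fun_scale[OF osc_pairD(2)[OF assms], of c]
  by (auto simp: osc_pair_def L2_fun_scale has_ac_deriv_scale mult.left_commute)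

lemma osc_pair_sum:
  "(\<And>i. i \<in> I \<Longrightarrow> osc_pair (f i) (g i)) \<Longrightarrow>
    osc_pair (\<lambda>x. \<Sum>i\<in>I. c i * f i x) (\<lambda>x. \<Sum>i\<in>I. c i * g i x)"
proof (induction I rule: infinite_finite_induct)
  case (insert j I)
  then show ?case
    using osc_pair_add[OF osc_pair_scale[of "f j" "g j" "c j"], of "\<lambda>x. \<Sum>i\<in>I. c i * f i x" "\<lambda>x. \<Sum>i\<in>I. c i * g i x"]
    by simp
qed (simp_all add: osc_pair_zero)

lemma osc_pair_reflect:
  assumes "osc_pair f g"
  shows "osc_pair (\<lambda>x. f (- x)) (\<lambda>x. - g (- x))"
  unfolding osc_pair_def
proof (intro conjI)
  show "(\<lambda>x. of_real x * f (- x)) \<in> L2_fun"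
    using L2_fun_uminus[OF L2_fun_reflect[OF osc_pairD(2)[OF assms]]] by simp
qed (use assms in \<open>auto simp: osc_pair_def intro: L2_fun_reflect L2_fun_uminus has_ac_deriv_reflect\<close>)

lemma form_domain_imp_osc_pair:
  assumes "f \<in> form_domain"
  shows "osc_pair f (weak_deriv f)"
proof -
  have f: "f \<in> L2_fun" "continuous_on UNIV f" "\<exists>g. g \<in> L2_fun \<and> has_weak_deriv f g" "(\<lambda>x. of_real x * f x) \<in> L2_fun"
    using assms by (auto simp: form_domain_def H1_fun_def)
  from someI_ex[OF f(3)] have "weak_deriv f \<in> L2_fun" "has_weak_deriv f (weak_deriv f)"
    by (auto simp: weak_deriv_def)
  with f show ?thesis by (auto simp: osc_pair_def intro: weak_deriv_imp_ac_deriv)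
qed

lemma osc_pair_imp_form_domain:
  assumes "osc_pair f g"
  shows "f \<in> form_domain"
  using osc_pairD[OF assms] ac_deriv_imp_weak_deriv[of f g] has_ac_deriv_continuous[of f g]
  by (auto simp: form_domain_def H1_fun_def)

lemma osc_pair_AE_unique:
  assumes "osc_pair f g" "osc_pair f g'"
  shows "AE x in lborel. g x = g' x"
proof -
  have "has_ac_deriv (\<lambda>x. f x + (-1) * f x) (\<lambda>x. g x + (-1) * g' x)"
    by (intro has_ac_deriv_add has_ac_deriv_scale osc_pairD assms)
  then have "has_ac_deriv (\<lambda>x. 0) (\<lambda>x. g x - g' x)" by simp
  from ac_deriv_of_const_AE[OF this] show ?thesis by simp
qed

text \<open>The polarised form of the harmonic oscillator, that is, the part of the form without
  \<gamma>; \<open>g\<close> and \<open>k\<close> stand for the derivatives of \<open>f\<close> and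
  \<open>h\<close>.\<close>

definition osc_energy where
  "osc_energy f g h k = L2_inner g k + L2_inner (\<lambda>x. of_real x * f x) (\<lambda>x. of_real x * h x)"

lemma osc_form_eq_energy:
  assumes f: "osc_pair f g" and h: "osc_pair h k"
  shows "osc_form b \<gamma> f h =
    osc_energy f g h k + \<i> * of_real \<gamma> * (f b * cnj (h b) - f (- b) * cnj (h (- b)))"
proof -
  have f': "osc_pair f (weak_deriv f)" and h': "osc_pair h (weak_deriv h)"
    using f h by (auto intro: form_domain_imp_osc_pair osc_pair_imp_form_domain)
  have "(LINT x|lborel. weak_deriv f x * cnj (weak_deriv h x) + of_real (x\<^sup>2) * (f x * cnj (h x)))
    = (LINT x|lborel. weak_deriv f x * cnj (weak_deriv h x) + (of_real x * f x) * cnj (of_real x * h x))"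
    by (intro Bochner_Integration.integral_cong) (auto simp: power2_eq_square)
  also have "\<dots> = L2_inner (weak_deriv f) (weak_deriv h) + L2_inner (\<lambda>x. of_real x * f x) (\<lambda>x. of_real x * h x)"
    unfolding L2_inner_def
    by (intro Bochner_Integration.integral_add L2_inner_integrable osc_pairD[OF f'] osc_pairD[OF h'])
  also have "L2_inner (weak_deriv f) (weak_deriv h) = L2_inner g k"
    by (intro L2_inner_cong_AE osc_pair_AE_unique[OF f' f] osc_pair_AE_unique[OF h' h] osc_pairD[OF f'] osc_pairD[OF h']
        osc_pairD[OF f] osc_pairD[OF h])
  finally show ?thesis unfolding osc_form_def osc_energy_def by simp
qed

section \<open>Algebra of the oscillator form\<close>

lemma integration_by_parts:
  assumes f: "osc_pair f g" and h: "osc_pair h k"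
  shows "L2_inner g h + L2_inner f k = 0"
proof -
  have "(LINT x|lborel. g x * cnj (h x) + f x * cnj (k x)) = 0"
    by (rule integral_ac_deriv_eq_0[OF has_ac_deriv_mult[OF osc_pairD(4)[OF f] has_ac_deriv_cnj[OF osc_pairD(4)[OF h]]]])
      (auto intro!: L2_inner_integrable Bochner_Integration.integrable_add osc_pairD[OF f] osc_pairD[OF h])
  then show ?thesis
    unfolding L2_inner_def using osc_pairD[OF f] osc_pairD[OF h] by (simp add: L2_inner_integrable)
qed

lemma has_ac_deriv_ident: "has_ac_deriv (\<lambda>x. of_real x) (\<lambda>x. 1)"
  by (rule has_ac_derivI_C1) (auto intro!: derivative_eq_intros)

text \<open>Weak form of the relation [d/dx, x] = 1, obtained from the total derivative of x f times
  the conjugate of h. It produces the shifts by one in \<open>lower_lower\<close> and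
  \<open>raise_raise\<close>.\<close>

lemma commutation_identity:
  assumes f: "osc_pair f g" and h: "osc_pair h k"
  shows "L2_inner g (\<lambda>x. of_real x * h x) + L2_inner (\<lambda>x. of_real x * f x) k + L2_inner f h = 0"
proof -
  have i: "integrable lborel (\<lambda>x. f x * cnj (h x))" "integrable lborel (\<lambda>x. g x * cnj (of_real x * h x))"
    "integrable lborel (\<lambda>x. (of_real x * f x) * cnj (k x))" "integrable lborel (\<lambda>x. (of_real x * f x) * cnj (h x))"
    by (intro L2_inner_integrable osc_pairD[OF f] osc_pairD[OF h])+
  have eq: "(1 * f x + of_real x * g x) * cnj (h x) + of_real x * f x * cnj (k x) =
     f x * cnj (h x) + g x * cnj (of_real x * h x) + of_real x * f x * cnj (k x)" for x
    by (simp add: algebra_simps)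
  have "(LINT x|lborel. f x * cnj (h x) + g x * cnj (of_real x * h x) + of_real x * f x * cnj (k x)) = 0"
    by (rule integral_ac_deriv_eq_0[OF has_ac_deriv_mult[OF has_ac_deriv_mult[OF has_ac_deriv_ident osc_pairD(4)[OF f]]
          has_ac_deriv_cnj[OF osc_pairD(4)[OF h]], unfolded eq]])
      (use i in \<open>auto intro!: Bochner_Integration.integrable_add\<close>)
  moreover have "(LINT x|lborel. f x * cnj (h x) + g x * cnj (of_real x * h x) + of_real x * f x * cnj (k x))
    = (LINT x|lborel. f x * cnj (h x)) + (LINT x|lborel. g x * cnj (of_real x * h x)) + (LINT x|lborel. of_real x * f x * cnj (k x))"
    using i by (simp only: Bochner_Integration.integral_add Bochner_Integration.integrable_add)
  ultimately show ?thesis unfolding L2_inner_def by (simp add: algebra_simps)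
qed

lemma osc_energy_add_left:
  assumes "osc_pair f g" "osc_pair f' g'" "osc_pair h k"
  shows "osc_energy (\<lambda>x. f x + f' x) (\<lambda>x. g x + g' x) h k = osc_energy f g h k + osc_energy f' g' h k"
  unfolding osc_energy_def distrib_left
  by (simp add: L2_inner_add_left osc_pairD[OF assms(1)] osc_pairD[OF assms(2)] osc_pairD[OF assms(3)])

lemma osc_energy_scale_left:
  "osc_energy (\<lambda>x. c * f x) (\<lambda>x. c * g x) h k = c * osc_energy f g h k"
  unfolding osc_energy_def mult.left_commute[of "of_real _" c] by (simp add: L2_inner_scale_left distrib_left)

lemma osc_energy_cnj: "cnj (osc_energy f g h k) = osc_energy h k f g"
  unfolding osc_energy_def by (simp add: L2_inner_cnj)

lemma osc_energy_self:
  "osc_energy f g f g = of_real (L2_sq g + L2_sq (\<lambda>x. of_real x * f x))"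
  unfolding osc_energy_def by (simp add: L2_inner_self)

lemma osc_energy_reflect:
  "osc_energy (\<lambda>x. f (- x)) (\<lambda>x. - g (- x)) (\<lambda>x. h (- x)) (\<lambda>x. - k (- x)) = osc_energy f g h k"
  using L2_inner_reflect[of "\<lambda>x. - g x" "\<lambda>x. - k x"]
    L2_inner_reflect[of "\<lambda>x. of_real x * f x" "\<lambda>x. of_real x * h x"]
  unfolding osc_energy_def by (simp add: L2_inner_uminus_left L2_inner_uminus_right)

section \<open>Eigenpairs and reflection\<close>

definition osc_eigenpair :: "real \<Rightarrow> real \<Rightarrow> complex \<Rightarrow> (real \<Rightarrow> complex) \<Rightarrow> (real \<Rightarrow> complex) \<Rightarrow> bool" where
  "osc_eigenpair b \<gamma> \<mu> f g \<longleftrightarrow> osc_pair f g \<and> L2_sq f \<noteq> 0 \<and>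
     (\<forall>h k. osc_pair h k \<longrightarrow>
        osc_energy f g h k + \<i> * of_real \<gamma> * (f b * cnj (h b) - f (- b) * cnj (h (- b))) = \<mu> * L2_inner f h)"

lemma osc_eigenvalue_imp_eigenpair:
  assumes "osc_eigenvalue b \<gamma> \<mu>"
  shows "\<exists>f g. osc_eigenpair b \<gamma> \<mu> f g"
proof -
  from assms obtain f where f: "f \<in> form_domain" "\<not> (AE x in lborel. f x = 0)"
      "\<And>h. h \<in> form_domain \<Longrightarrow> osc_form b \<gamma> f h = L2_inner (\<lambda>x. \<mu> * f x) h"
    unfolding osc_eigenvalue_def osc_op_def by auto
  have p: "osc_pair f (weak_deriv f)" by (rule form_domain_imp_osc_pair[OF f(1)])
  have "osc_eigenpair b \<gamma> \<mu> f (weak_deriv f)"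
    unfolding osc_eigenpair_def
    using p f(2) f(3)[OF osc_pair_imp_form_domain] osc_form_eq_energy[OF p, of _ _ b \<gamma>] L2_sq_eq_0_iff[OF osc_pairD(1)[OF p]]
    by (auto simp: L2_inner_scale_left)
  then show ?thesis by blast
qed

lemma osc_eigenpairD:
  assumes "osc_eigenpair b \<gamma> \<mu> f g"
  shows "osc_pair f g" "L2_sq f > 0"
    "osc_pair h k \<Longrightarrow>
        osc_energy f g h k + \<i> * of_real \<gamma> * (f b * cnj (h b) - f (- b) * cnj (h (- b))) = \<mu> * L2_inner f h"
  using assms L2_sq_nonneg[of f] by (auto simp: osc_eigenpair_def less_le)

lemma osc_eigenpair_swap:
  "osc_eigenpair b \<gamma> \<mu> f g \<Longrightarrow> osc_eigenpair (- b) (- \<gamma>) \<mu> f g"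
  unfolding osc_eigenpair_def by (simp add: algebra_simps)

text \<open>Reflection exchanges the two deltas and so turns \<gamma> into - \<gamma>. It transfers
  estimates at \<open>b\<close> to \<open>- b\<close>.\<close>

lemma osc_eigenpair_reflect:
  assumes "osc_eigenpair b \<gamma> \<mu> f g"
  shows "osc_eigenpair b (- \<gamma>) \<mu> (\<lambda>x. f (- x)) (\<lambda>x. - g (- x))"
  unfolding osc_eigenpair_def
proof (intro conjI allI impI)
  show "osc_pair (\<lambda>x. f (- x)) (\<lambda>x. - g (- x))" by (intro osc_pair_reflect osc_eigenpairD[OF assms])
  show "L2_sq (\<lambda>x. f (- x)) \<noteq> 0" using osc_eigenpairD(2)[OF assms] by (simp add: L2_sq_reflect)
next
  fix h k assume h: "osc_pair h k"
  have "osc_energy f g (\<lambda>x. h (- x)) (\<lambda>x. - k (- x)) = osc_energy (\<lambda>x. f (- x)) (\<lambda>x. - g (- x)) h k"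
    using osc_energy_reflect[of f g "\<lambda>x. h (- x)" "\<lambda>x. - k (- x)"] by simp
  moreover have "L2_inner f (\<lambda>x. h (- x)) = L2_inner (\<lambda>x. f (- x)) h"
    using L2_inner_reflect[of f "\<lambda>x. h (- x)"] by simp
  ultimately show "osc_energy (\<lambda>x. f (- x)) (\<lambda>x. - g (- x)) h k
     + \<i> * of_real (- \<gamma>) * (f (- b) * cnj (h b) - f (- (- b)) * cnj (h (- b))) = \<mu> * L2_inner (\<lambda>x. f (- x)) h"
    using osc_eigenpairD(3)[OF assms osc_pair_reflect[OF h]] by (simp add: algebra_simps)
qed

text \<open>Test the equation with \<open>f\<close> itself: the deltas contribute only to the
  imaginary part. The first identity controls the energy by \<open>Re \<mu>\<close>, the second
  expresses \<open>Im \<mu>\<close> through point values.\<close>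

lemma osc_eigenpair_real_part:
  assumes "osc_eigenpair b \<gamma> \<mu> f g"
  shows "L2_sq g + L2_sq (\<lambda>x. of_real x * f x) = Re \<mu> * L2_sq f"
    "\<gamma> * ((cmod (f b))\<^sup>2 - (cmod (f (- b)))\<^sup>2) = Im \<mu> * L2_sq f"
proof -
  have "of_real (L2_sq g + L2_sq (\<lambda>x. of_real x * f x)) +
      \<i> * of_real (\<gamma> * ((cmod (f b))\<^sup>2 - (cmod (f (- b)))\<^sup>2)) = \<mu> * of_real (L2_sq f)"
    using osc_eigenpairD(3)[OF assms osc_eigenpairD(1)[OF assms]]
    unfolding osc_energy_self L2_inner_self complex_norm_square[symmetric] by (simp add: mult.assoc)
  then show "L2_sq g + L2_sq (\<lambda>x. of_real x * f x) = Re \<mu> * L2_sq f"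
    "\<gamma> * ((cmod (f b))\<^sup>2 - (cmod (f (- b)))\<^sup>2) = Im \<mu> * L2_sq f"
    by (simp_all add: complex_eq_iff)
qed

text \<open>The form is symmetric up to the reflection \<open>f (- x)\<close>, which makes its value at \<open>f\<close> and the
  reflected \<open>f\<close> real.\<close>

lemma osc_eigenpair_reflect_orthogonal:
  assumes "osc_eigenpair b \<gamma> \<mu> f g" "Im \<mu> \<noteq> 0"
  shows "L2_inner f (\<lambda>x. f (- x)) = 0"
proof -
  let ?h = "\<lambda>x. f (- x)" and ?k = "\<lambda>x. - g (- x)"
  have h: "osc_pair ?h ?k" by (intro osc_pair_reflect osc_eigenpairD[OF assms(1)])
  have "cnj (osc_energy f g ?h ?k) = osc_energy ?h ?k f g" by (rule osc_energy_cnj)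
  also have "\<dots> = osc_energy f g ?h ?k"
    using osc_energy_reflect[of f g ?h ?k] by simp
  finally have e: "Im (osc_energy f g ?h ?k) = 0" by (simp add: complex_eq_iff)
  have "cnj (L2_inner f ?h) = L2_inner ?h f" by (rule L2_inner_cnj)
  also have "\<dots> = L2_inner f ?h" using L2_inner_reflect[of f ?h] by simp
  finally have i: "Im (L2_inner f ?h) = 0" by (simp add: complex_eq_iff)
  have "osc_energy f g ?h ?k + \<i> * of_real \<gamma> * (f b * cnj (f (- b)) - f (- b) * cnj (f b)) = \<mu> * L2_inner f ?h"
    using osc_eigenpairD(3)[OF assms(1) h] by simp
  \<comment> \<open>The bracket in the delta term is a number minus its conjugate, so the factor
    \<open>\<i>\<close> makes that term real.\<close>
  then have "Im (\<mu> * L2_inner f ?h) = Im (osc_energy f g ?h ?k) +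
     Im (\<i> * of_real \<gamma> * (f b * cnj (f (- b)) - f (- b) * cnj (f b)))"
    by (metis plus_complex.sel(2))
  then have "Im \<mu> * Re (L2_inner f ?h) = 0" using e i by simp
  with assms(2) i show ?thesis by (simp add: complex_eq_iff)
qed

section \<open>Hermite functions\<close>

definition poly_gauss :: "real poly \<Rightarrow> real \<Rightarrow> complex" where
  "poly_gauss p x = of_real (poly p x * exp (- x\<^sup>2 / 2))"

lemma poly_gauss_integrable: "integrable lborel (\<lambda>x::real. poly p x * exp (- x\<^sup>2 / 2))"
proof -
  have "integrable lborel (\<lambda>x. \<Sum>i\<le>degree p. (coeff p i * sqrt (2 * pi)) * (std_normal_density x * x ^ i))"
    by (intro Bochner_Integration.integrable_sum integrable_mult_right integrable_std_normal_moment)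
  also have "(\<lambda>x. \<Sum>i\<le>degree p. (coeff p i * sqrt (2 * pi)) * (std_normal_density x * x ^ i)) = (\<lambda>x. poly p x * exp (- x\<^sup>2 / 2))"
    by (auto simp: fun_eq_iff poly_altdef std_normal_density_def sum_distrib_right intro!: sum.cong)
  finally show ?thesis .
qed

lemma poly_gauss_L2 [simp]: "poly_gauss p \<in> L2_fun"
proof (rule L2_funI)
  have cont: "continuous_on UNIV (poly_gauss p)"
    unfolding poly_gauss_def by (intro continuous_intros) auto
  then have [measurable]: "poly_gauss p \<in> borel_measurable borel" by (rule borel_measurable_continuous_onI)
  show "poly_gauss p \<in> borel_measurable lborel" by simp
  show "integrable lborel (\<lambda>x. (cmod (poly_gauss p x))\<^sup>2)"
  proof (rule Bochner_Integration.integrable_bound[OF poly_gauss_integrable[of "p * p"]])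
    have "(exp (- x\<^sup>2 / 2))\<^sup>2 \<le> exp (- x\<^sup>2 / 2)" for x :: real
      by (simp add: exp_double[symmetric])
    then have "(poly p x)\<^sup>2 * (exp (- x\<^sup>2 / 2))\<^sup>2 \<le> (poly p x)\<^sup>2 * exp (- x\<^sup>2 / 2)" for x
      by (rule mult_left_mono) simp
    then have "(cmod (poly_gauss p x))\<^sup>2 \<le> poly (p * p) x * exp (- x\<^sup>2 / 2)" for x
      unfolding poly_gauss_def norm_of_real power2_abs poly_mult power_mult_distrib
        power2_eq_square[of "poly p x", symmetric] .
    then show "AE x in lborel. norm ((cmod (poly_gauss p x))\<^sup>2) \<le> norm (poly (p * p) x * exp (- x\<^sup>2 / 2))"
      by (intro AE_I2) (metis abs_ge_self abs_power2 order_trans real_norm_def)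
  qed simp
qed

lemma of_real_mult_poly_gauss: "of_real x * poly_gauss p x = poly_gauss ([:0,1:] * p) x"
  by (simp add: poly_gauss_def)

lemma poly_gauss_diff: "poly_gauss (p - q) x = poly_gauss p x - poly_gauss q x"
  by (simp add: poly_gauss_def left_diff_distrib)

lemma poly_gauss_smult: "poly_gauss (smult c p) x = of_real c * poly_gauss p x"
  by (simp add: poly_gauss_def)

lemma osc_pair_poly_gauss: "osc_pair (poly_gauss p) (poly_gauss (pderiv p - [:0,1:] * p))"
  unfolding osc_pair_def
proof (intro conjI)
  show "has_ac_deriv (poly_gauss p) (poly_gauss (pderiv p - [:0,1:] * p))"
  proof (rule has_ac_derivI_C1)
    fix x
    have "((\<lambda>x. poly p x * exp (- x\<^sup>2 / 2)) has_field_derivative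
        poly (pderiv p - [:0,1:] * p) x * exp (- x\<^sup>2 / 2)) (at x)"
      by (auto intro!: derivative_eq_intros poly_DERIV simp: algebra_simps)
    then show "(poly_gauss p has_vector_derivative poly_gauss (pderiv p - [:0,1:] * p) x) (at x)"
      unfolding poly_gauss_def
      by (intro has_vector_derivative_of_real) (simp add: has_real_derivative_iff_has_vector_derivative)
    show "continuous_on UNIV (poly_gauss (pderiv p - [:0,1:] * p))"
      unfolding poly_gauss_def by (intro continuous_intros) auto
  qed
qed (simp_all add: of_real_mult_poly_gauss del: mult_pCons_left)

definition gauss_const :: real where
  "gauss_const = 1 / sqrt (L2_sq (poly_gauss 1))"

text \<open>On functions p exp(-x^2/2) the raising operator x - d/dx acts by sending p to 2 x p -
  p'. Dividing by \<open>sqrt (2 * real k + 2)\<close> preserves unit norm, so these are the Hermite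
  polynomials normalised in L^2.\<close>

primrec hermite_poly :: "nat \<Rightarrow> real poly" where
  "hermite_poly 0 = [:gauss_const:]"
| "hermite_poly (Suc k) =
     smult (1 / sqrt (2 * real k + 2)) ([:0, 2:] * hermite_poly k - pderiv (hermite_poly k))"

definition hermite :: "nat \<Rightarrow> real \<Rightarrow> complex" where
  "hermite k = poly_gauss (hermite_poly k)"

definition hermite_deriv :: "nat \<Rightarrow> real \<Rightarrow> complex" where
  "hermite_deriv k = poly_gauss (pderiv (hermite_poly k) - [:0,1:] * hermite_poly k)"

lemma osc_pair_hermite: "osc_pair (hermite k) (hermite_deriv k)"
  unfolding hermite_def hermite_deriv_def by (rule osc_pair_poly_gauss)

lemma hermite_L2 [simp]: "hermite k \<in> L2_fun" "hermite_deriv k \<in> L2_fun"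
  by (auto simp: hermite_def hermite_deriv_def)

text \<open>The lowering relation on the level of polynomials. Differentiating the recursion and
  inserting the induction hypothesis produces the factor 2 + c^2 with c^2 = 2 k + 2, which is d^2
  for the next level.\<close>

lemma pderiv_hermite_poly:
  "pderiv (hermite_poly (Suc k)) = smult (sqrt (2 * real k + 2)) (hermite_poly k)"
proof (induction k)
  case 0
  show ?case using real_div_sqrt[of 2]
    by (simp add: pderiv_smult pderiv_pCons pderiv_diff mult.commute flip: times_divide_eq_right)
next
  case (Suc k)
  define c where "c = sqrt (2 * real k + 2)"
  define d where "d = sqrt (2 * real (Suc k) + 2)"
  let ?p = "hermite_poly k" and ?q = "hermite_poly (Suc k)"
  have c: "c > 0" "c * c = 2 * real k + 2" and d: "d > 0" "d * d = 2 * real k + 4"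
    by (auto simp: c_def d_def)
  have q: "smult c ?q = [:0, 2:] * ?p - pderiv ?p"
    using c by (simp add: c_def[symmetric])
  have "pderiv ([:0, 2:] * ?q - pderiv ?q) = smult 2 ?q + [:0,2:] * pderiv ?q - pderiv (pderiv ?q)"
    by (simp add: pderiv_diff pderiv_mult pderiv_pCons pderiv_add pderiv_smult del: hermite_poly.simps)
  also have "\<dots> = smult 2 ?q + smult c ([:0,2:] * ?p - pderiv ?p)"
    unfolding Suc.IH[folded c_def] by (simp add: pderiv_smult smult_diff_right del: mult_pCons_left)
  also have "\<dots> = smult 2 ?q + smult (c * c) ?q" unfolding q[symmetric] by simp
  also have "\<dots> = smult (d * d) ?q" unfolding c d smult_add_left[symmetric] by (simp add: add.commute del: hermite_poly.simps)
  finally have "pderiv (hermite_poly (Suc (Suc k))) = smult (1 / d) (smult (d * d) ?q)"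
    unfolding d_def by (simp only: hermite_poly.simps(2)[of "Suc k"] pderiv_smult)
  also have "\<dots> = smult d ?q" using d(1) by (simp del: hermite_poly.simps)
  finally show ?case unfolding d_def .
qed

lemma hermite_lower_0: "hermite_deriv 0 x + of_real x * hermite 0 x = 0"
  by (simp add: hermite_def hermite_deriv_def pderiv_pCons poly_gauss_def)

lemma hermite_lower_Suc:
  "hermite_deriv (Suc k) x + of_real x * hermite (Suc k) x = of_real (sqrt (2 * real k + 2)) * hermite k x"
  unfolding hermite_def hermite_deriv_def poly_gauss_diff of_real_mult_poly_gauss pderiv_hermite_poly
  by (simp add: poly_gauss_smult del: mult_pCons_left hermite_poly.simps)

lemma hermite_raise:
  "of_real x * hermite k x - hermite_deriv k x = of_real (sqrt (2 * real k + 2)) * hermite (Suc k) x"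
proof -
  have "poly ([:0,1:] * hermite_poly k - (pderiv (hermite_poly k) - [:0,1:] * hermite_poly k)) x =
     sqrt (2 * real k + 2) * poly (hermite_poly (Suc k)) x"
    by (simp add: field_simps)
  then show ?thesis
    unfolding hermite_def hermite_deriv_def of_real_mult_poly_gauss poly_gauss_diff[symmetric]
    by (simp add: poly_gauss_def del: poly_diff poly_mult hermite_poly.simps mult_pCons_left)
qed

lemma hermite_reflect: "hermite k (- x) = (-1) ^ k * hermite k x"
proof -
  have "poly (pderiv p) (- x) = - (s * poly (pderiv p) x)" if "\<And>x. poly p (- x) = s * poly p x" for p :: "real poly" and s x
  proof -
    have "((\<lambda>x. poly p (- x)) has_field_derivative poly (pderiv p) (- x) * (-1)) (at x)"
      by (rule DERIV_chain'[where g="poly p"]) (auto intro!: derivative_eq_intros poly_DERIV)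
    moreover have "((\<lambda>x. s * poly p x) has_field_derivative s * poly (pderiv p) x) (at x)"
      by (auto intro!: derivative_eq_intros poly_DERIV)
    ultimately show ?thesis using that DERIV_unique by fastforce
  qed
  note * = this
  have "poly (hermite_poly k) (- x) = (-1) ^ k * poly (hermite_poly k) x" for x
  proof (induction k arbitrary: x)
    case (Suc k)
    show ?case using Suc.IH *[OF Suc.IH, of x] by (simp add: divide_simps) (simp add: algebra_simps)
  qed simp
  then show ?thesis by (simp add: hermite_def poly_gauss_def)
qed

section \<open>Ladder operators\<close>

lemma lower_adjoint:
  assumes "osc_pair f g" "osc_pair h k"
  shows "L2_inner (\<lambda>x. g x + of_real x * f x) h = L2_inner f (\<lambda>x. of_real x * h x - k x)"
proof -
  have "L2_inner (\<lambda>x. of_real x * f x) h = L2_inner f (\<lambda>x. of_real x * h x)"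
    unfolding L2_inner_def by (intro Bochner_Integration.integral_cong) (auto simp: mult_ac)
  then show ?thesis
    using integration_by_parts[OF assms]
    by (simp add: L2_inner_add_left L2_inner_diff_right osc_pairD[OF assms(1)] osc_pairD[OF assms(2)] add_eq_0_iff)
qed

lemma raise_adjoint:
  assumes "osc_pair f g" "osc_pair h k"
  shows "L2_inner (\<lambda>x. of_real x * f x - g x) h = L2_inner f (\<lambda>x. k x + of_real x * h x)"
proof -
  have "cnj (L2_inner (\<lambda>x. of_real x * f x - g x) h) = cnj (L2_inner f (\<lambda>x. k x + of_real x * h x))"
    unfolding L2_inner_cnj by (rule lower_adjoint[OF assms(2,1), symmetric])
  then show ?thesis by simp
qed

text \<open>With A = d/dx + x and H the harmonic oscillator this is A* A = H - 1 in the sense of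
  forms; \<open>raise_raise\<close> is A A* = H + 1.\<close>

lemma lower_lower:
  assumes "osc_pair f g" "osc_pair h k"
  shows "L2_inner (\<lambda>x. g x + of_real x * f x) (\<lambda>x. k x + of_real x * h x) = osc_energy f g h k - L2_inner f h"
  using commutation_identity[OF assms]
  by (simp add: osc_energy_def L2_inner_add_left L2_inner_add_right L2_fun_add osc_pairD[OF assms(1)] osc_pairD[OF assms(2)]
      algebra_simps add_eq_0_iff)

lemma raise_raise:
  assumes "osc_pair f g" "osc_pair h k"
  shows "L2_inner (\<lambda>x. of_real x * f x - g x) (\<lambda>x. of_real x * h x - k x) = osc_energy f g h k + L2_inner f h"
  using commutation_identity[OF assms]
  by (simp add: osc_energy_def L2_inner_diff_left L2_inner_diff_right L2_fun_diff osc_pairD[OF assms(1)] osc_pairD[OF assms(2)]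
      algebra_simps add_eq_0_iff)

lemma L2_inner_lower_hermite:
  assumes "osc_pair f g"
  shows "L2_inner (\<lambda>x. g x + of_real x * f x) (hermite k) = of_real (sqrt (2 * real k + 2)) * L2_inner f (hermite (Suc k))"
  unfolding lower_adjoint[OF assms osc_pair_hermite] hermite_raise by (simp add: L2_inner_scale_right)

lemma L2_sq_poly_gauss_1: "L2_sq (poly_gauss 1) > 0"
proof (rule ccontr)
  assume "\<not> ?thesis"
  then have "AE x in lborel. poly_gauss 1 x = 0"
    using L2_sq_nonneg[of "poly_gauss 1"] by (subst L2_sq_eq_0_iff[symmetric]) auto
  then have "AE x::real in lborel. False" by (simp add: poly_gauss_def)
  then show False by (simp add: AE_iff_measurable[of UNIV])
qed

text \<open>Moving one raising operator across the product lowers both indices by one; index 0 is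
  settled because the lowering operator annihilates \<open>hermite 0\<close>.\<close>

lemma hermite_orthonormal: "L2_inner (hermite i) (hermite j) = (if i = j then 1 else 0)"
proof (induction j arbitrary: i)
  case 0
  have h0: "hermite 0 = (\<lambda>x. of_real gauss_const * poly_gauss 1 x)"
    by (auto simp: hermite_def poly_gauss_def)
  show ?case
  proof (cases i)
    case 0
    have "L2_sq (hermite 0) = 1"
      using L2_sq_poly_gauss_1 unfolding h0 L2_sq_scale
      by (simp add: gauss_const_def norm_divide power_divide)
    then show ?thesis using 0 by (simp add: L2_inner_self)
  next
    case (Suc i)
    have "of_real (sqrt (2 * real i + 2)) * L2_inner (hermite 0) (hermite (Suc i)) = 0"
      unfolding L2_inner_lower_hermite[OF osc_pair_hermite[of 0], symmetric] hermite_lower_0 by simp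
    then have "L2_inner (hermite 0) (hermite (Suc i)) = 0" by (auto simp: add_nonneg_eq_0_iff)
    then have "cnj (L2_inner (hermite 0) (hermite (Suc i))) = 0" by simp
    then show ?thesis using Suc by (simp add: L2_inner_cnj)
  qed
next
  case (Suc j)
  have nz: "sqrt (2 * real j + 2) \<noteq> 0" by (simp add: add_nonneg_eq_0_iff)
  show ?case
  proof (cases i)
    case 0
    have "of_real (sqrt (2 * real j + 2)) * L2_inner (hermite 0) (hermite (Suc j)) = 0"
      unfolding L2_inner_lower_hermite[OF osc_pair_hermite[of 0], symmetric] hermite_lower_0 by simp
    then show ?thesis using 0 nz by simp
  next
    case (Suc i')
    have "of_real (sqrt (2 * real j + 2)) * L2_inner (hermite (Suc i')) (hermite (Suc j))
      = of_real (sqrt (2 * real i' + 2)) * L2_inner (hermite i') (hermite j)"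
      unfolding L2_inner_lower_hermite[OF osc_pair_hermite[of "Suc i'"], symmetric] hermite_lower_Suc
      by (simp add: L2_inner_scale_left)
    then show ?thesis unfolding Suc.IH using Suc nz by (cases "i' = j") auto
  qed
qed

lemma L2_sq_hermite [simp]: "L2_sq (hermite k) = 1"
  using hermite_orthonormal[of k k] unfolding L2_inner_self by simp

text \<open>Lowering the k-th Hermite function and raising it again multiplies it by 2 k, so
  \<open>lower_lower\<close> shows it to be a weak eigenfunction of the oscillator.\<close>

lemma osc_energy_hermite:
  assumes "osc_pair f g"
  shows "osc_energy f g (hermite k) (hermite_deriv k) = of_real (2 * real k + 1) * L2_inner f (hermite k)"
proof -
  note ll = lower_lower[OF assms osc_pair_hermite[of k]]
  show ?thesis
  proof (cases k)
    case 0
    then show ?thesis using ll by (simp add: hermite_lower_0)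
  next
    case (Suc j)
    have "L2_inner (\<lambda>x. g x + of_real x * f x) (\<lambda>x. hermite_deriv k x + of_real x * hermite k x)
      = of_real (sqrt (2 * real j + 2) * sqrt (2 * real j + 2)) * L2_inner f (hermite k)"
      unfolding Suc hermite_lower_Suc L2_inner_scale_right L2_inner_lower_hermite[OF assms] of_real_mult by simp
    also have "sqrt (2 * real j + 2) * sqrt (2 * real j + 2) = 2 * real j + 2" by simp
    finally show ?thesis using ll Suc by (simp add: algebra_simps)
  qed
qed

section \<open>Spectral lower bound for the oscillator form\<close>

lemma integral_AE_add:
  fixes f :: "real \<Rightarrow> complex"
  assumes "AE x in M. f x = g x + h x" "integrable M f" "integrable M g" "integrable M h"
  shows "integral\<^sup>L M f = integral\<^sup>L M g + integral\<^sup>L M h"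
proof -
  have "integral\<^sup>L M f = (LINT x|M. g x + h x)"
    using assms by (intro integral_cong_AE) (auto intro: borel_measurable_integrable)
  then show ?thesis using assms by simp
qed

lemma exp_tail_integral:
  fixes x :: real
  assumes "x > 0"
  shows "has_bochner_integral lborel (\<lambda>t. indicator {x..} t * exp (- (2 * x * (t - x)))) (1 / (2 * x))"
proof -
  have e: "has_bochner_integral lborel (\<lambda>s. indicator {0..} s * exp (- s)) (1::real)"
  proof (rule has_bochner_integral_nn_integral)
    have "(\<integral>\<^sup>+ s. ennreal (indicator {0..} s * exp (- s)) \<partial>lborel) = (\<integral>\<^sup>+ s. ennreal (s ^ 0 * exp (- s)) * indicator {0..} s \<partial>lborel)"
      by (intro nn_integral_cong) (auto simp: indicator_def)
    then show "(\<integral>\<^sup>+ s. ennreal (indicator {0..} s * exp (- s)) \<partial>lborel) = ennreal 1"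
      using nn_intergal_power_times_exp_Ici[of 0] by simp
  qed auto
  have eq: "indicator {x..} t * exp (- (2 * x * (t - x))) =
     (\<lambda>s. indicator {0..} s * exp (- s)) (- (2 * x * x) + (2 * x) * t)" for t :: real
  proof -
    have "0 \<le> - (2 * x * x) + (2 * x) * t \<longleftrightarrow> x \<le> t"
      using assms by (simp add: mult.assoc)
    then show ?thesis by (auto simp: indicator_def algebra_simps)
  qed
  show ?thesis unfolding has_bochner_integral_iff
  proof
    show "integrable lborel (\<lambda>t. indicator {x..} t * exp (- (2 * x * (t - x))))"
      unfolding eq
      by (rule lborel_integrable_real_affine) (use e assms in \<open>auto dest: integrable.intros\<close>)
    have "1 = (LINT s|lborel. indicator {0..} s * exp (- s :: real))"
      using e by (rule has_bochner_integral_integral_eq[symmetric])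
    also have "\<dots> = \<bar>2 * x\<bar> *\<^sub>R (LINT t|lborel. indicator {x..} t * exp (- (2 * x * (t - x))))"
      unfolding eq by (rule lborel_integral_real_affine) (use assms in simp)
    finally show "(LINT t|lborel. indicator {x..} t * exp (- (2 * x * (t - x)))) = 1 / (2 * x)"
      using assms by (simp add: field_simps)
  qed
qed

text \<open>For the solution \<open>u\<close> of \<open>raise_surj\<close> this bounds x |u x|^2.
  The inequality between arithmetic and geometric mean with weight \<open>sqrt x\<close>, applied
  under the integral, makes the Gaussian contribute 1 / (4 sqrt x) and \<open>f\<close> contribute
  L2_sq f / (2 sqrt x).\<close>

lemma gauss_tail_bound:
  fixes x :: real
  assumes f: "f \<in> L2_fun" and x: "x \<ge> 1"
  shows "x * (exp (x\<^sup>2 / 2) * cmod (LINT t:{x..}|lborel. f t * of_real (exp (- t\<^sup>2 / 2))))\<^sup>2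
    \<le> (1 / 4 + L2_sq f / 2)\<^sup>2"
proof -
  have [measurable]: "f \<in> borel_measurable borel" using f by (rule L2_fun_measurable)
  let ?e = "\<lambda>t. indicator {x..} t * exp (- (2 * x * (t - x)))"
  let ?r = "\<lambda>t. (sqrt x * ?e t + (cmod (f t))\<^sup>2 / sqrt x) / 2"
  have sx: "sqrt x > 0" using x by simp
  have e: "integrable lborel ?e" "(LINT t|lborel. ?e t) = 1 / (2 * x)"
    using exp_tail_integral[of x] x by (auto simp: has_bochner_integral_iff)
  have f2: "integrable lborel (\<lambda>t. (cmod (f t))\<^sup>2)" using f by (rule L2_fun_integrable_norm_sq)
  have r: "integrable lborel ?r"
    using e(1) f2 by (intro integrable_divide_zero Bochner_Integration.integrable_add integrable_mult_right) auto
  have bound: "norm (of_real (exp (x\<^sup>2 / 2)) * (indicator {x..} t *\<^sub>R (f t * of_real (exp (- t\<^sup>2 / 2))))) \<le> ?r t" for t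
  proof (cases "t \<ge> x")
    case True
    \<comment> \<open>Since (t - x)^2 \<ge> 0, x^2 - t^2 \<le> - 2 x (t - x); this replaces the
      Gaussian tail by an exponential one.\<close>
    define a where "a = exp (x\<^sup>2 / 2) * exp (- t\<^sup>2 / 2)"
    have "a\<^sup>2 = exp (x\<^sup>2 - t\<^sup>2)"
      unfolding a_def by (simp add: power_mult_distrib exp_double[symmetric] exp_add[symmetric])
    also have "\<dots> \<le> exp (- (2 * x * (t - x)))"
      using zero_le_power2[of "t - x"] by (simp add: power2_eq_square algebra_simps)
    finally have a: "a\<^sup>2 \<le> exp (- (2 * x * (t - x)))" .
    have "0 \<le> (sqrt x * a - cmod (f t))\<^sup>2 / sqrt x" using sx by simp
    also have "\<dots> = sqrt x * a\<^sup>2 + (cmod (f t))\<^sup>2 / sqrt x - 2 * (a * cmod (f t))"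
      using sx by (simp add: power2_eq_square field_simps)
    finally have "2 * (a * cmod (f t)) \<le> sqrt x * a\<^sup>2 + (cmod (f t))\<^sup>2 / sqrt x" by simp
    also have "\<dots> \<le> sqrt x * exp (- (2 * x * (t - x))) + (cmod (f t))\<^sup>2 / sqrt x"
      using a sx by (intro add_mono mult_left_mono) auto
    finally show ?thesis using True by (simp add: norm_mult a_def mult_ac)
  qed (use sx in simp)
  have "exp (x\<^sup>2 / 2) * cmod (LINT t:{x..}|lborel. f t * of_real (exp (- t\<^sup>2 / 2)))
    = cmod (LINT t|lborel. of_real (exp (x\<^sup>2 / 2)) * (indicator {x..} t *\<^sub>R (f t * of_real (exp (- t\<^sup>2 / 2)))))"
    unfolding set_lebesgue_integral_def integral_mult_right_zero norm_mult by simp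
  also have "\<dots> \<le> (LINT t|lborel. ?r t)"
  proof (rule Bochner_Integration.integral_norm_bound_integral[OF Bochner_Integration.integrable_bound[OF r] r bound])
    show "AE t in lborel. norm (of_real (exp (x\<^sup>2 / 2)) * (indicator {x..} t *\<^sub>R (f t * of_real (exp (- t\<^sup>2 / 2))))) \<le> norm (?r t)"
      unfolding real_norm_def by (intro AE_I2 order_trans[OF bound abs_ge_self])
  qed simp
  also have "\<dots> = (sqrt x * (1 / (2 * x)) + L2_sq f / sqrt x) / 2"
    using e f2 by (simp add: L2_sq_def)
  also have "\<dots> = (1 / 4 + L2_sq f / 2) / sqrt x"
    using sx x by (simp add: field_simps)
  finally have le: "exp (x\<^sup>2 / 2) * cmod (LINT t:{x..}|lborel. f t * of_real (exp (- t\<^sup>2 / 2)))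
     \<le> (1 / 4 + L2_sq f / 2) / sqrt x" .
  have "x * (exp (x\<^sup>2 / 2) * cmod (LINT t:{x..}|lborel. f t * of_real (exp (- t\<^sup>2 / 2))))\<^sup>2
     \<le> x * ((1 / 4 + L2_sq f / 2) / sqrt x)\<^sup>2"
    using x le by (intro mult_left_mono power_mono) auto
  also have "\<dots> = (1 / 4 + L2_sq f / 2)\<^sup>2" using x by (simp add: power_divide)
  finally show ?thesis .
qed

text \<open>The solution is \<open>u x = exp (x^2/2) * integral of f t * exp (- t^2/2) over t \<ge> x\<close>; orthogonality to
  the ground state makes it decay at both ends.\<close>

lemma raise_surj:
  assumes f: "osc_pair f f'" and orth: "L2_inner f (hermite 0) = 0"
  shows "\<exists>u u'. osc_pair u u' \<and> (\<forall>x. of_real x * u x - u' x = f x)"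
proof -
  have fL2: "f \<in> L2_fun" by (rule osc_pairD[OF f])
  have fc: "continuous_on UNIV f" by (rule has_ac_deriv_continuous[OF osc_pairD(4)[OF f]])
  have [measurable]: "f \<in> borel_measurable borel" using fL2 by (rule L2_fun_measurable)
  define w where "w = (\<lambda>t. f t * of_real (exp (- t\<^sup>2 / 2)))"
  have wc: "continuous_on UNIV w" unfolding w_def by (intro continuous_intros fc) auto
  have pg1: "poly_gauss 1 t = of_real (exp (- t\<^sup>2 / 2))" for t by (simp add: poly_gauss_def)
  have wi: "integrable lborel w"
    using L2_mult_integrable[OF fL2 poly_gauss_L2[of 1]] unfolding w_def pg1 .
  have gc: "gauss_const \<noteq> 0" using L2_sq_poly_gauss_1 by (simp add: gauss_const_def)
  have w0: "(LINT t|lborel. w t) = 0"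
  proof -
    have "hermite 0 t = of_real gauss_const * of_real (exp (- t\<^sup>2 / 2))" for t
      by (simp add: hermite_def poly_gauss_def)
    then have "L2_inner f (hermite 0) = of_real gauss_const * (LINT t|lborel. w t)"
      unfolding L2_inner_def w_def integral_mult_right_zero[symmetric]
      by (intro Bochner_Integration.integral_cong) auto
    then show ?thesis using orth gc by simp
  qed
  have wset: "set_integrable lborel A w" if "A \<in> sets borel" for A
    unfolding set_integrable_def by (rule integrable_mult_indicator[OF _ wi]) (use that in simp)
  define V where "V = (\<lambda>x. LINT t:{x..}|lborel. w t)"
  have V: "has_ac_deriv V (\<lambda>x. (-1) * w x)"
    unfolding has_ac_deriv_def
  proof (intro allI impI conjI)
    fix x y :: real assume xy: "x \<le> y"
    show "set_integrable lborel {x..y} (\<lambda>x. (-1) * w x)"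
      using wset[of "{x..y}"] by (rule set_integrable_mult_right) simp
    have ae: "AE t in lborel. indicator {x..} t *\<^sub>R w t = indicator {x..y} t *\<^sub>R w t + indicator {y..} t *\<^sub>R w t"
      by (rule AE_mp[OF AE_lborel_singleton[of y]]) (use xy in \<open>auto simp: indicator_def intro!: AE_I2\<close>)
    have "V x = (LINT t:{x..y}|lborel. w t) + V y"
      unfolding V_def set_lebesgue_integral_def
      by (rule integral_AE_add[OF ae]) (use wset in \<open>auto simp: set_integrable_def\<close>)
    then show "V y - V x = (LINT t:{x..y}|lborel. (-1) * w t)"
      unfolding set_integral_mult_right by simp
  qed
  \<comment> \<open>The total integral of \<open>w\<close> is 0, so the integral over
    \<open>{- x..}\<close> is minus the one over \<open>{..- x}\<close>. After reflection the latter
    has the shape treated in \<open>gauss_tail_bound\<close>, which gives decay at the left end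
    too.\<close>
  have Vneg: "V (- x) = - (LINT t:{x..}|lborel. w (- t))" for x
  proof -
    have ae: "AE t in lborel. w t = indicator {- x..} t *\<^sub>R w t + indicator {..- x} t *\<^sub>R w t"
      by (rule AE_mp[OF AE_lborel_singleton[of "- x"]]) (auto simp: indicator_def intro!: AE_I2)
    have "0 = V (- x) + (LINT t:{..- x}|lborel. w t)"
      unfolding V_def set_lebesgue_integral_def w0[symmetric]
      by (rule integral_AE_add[OF ae]) (use wset wi in \<open>auto simp: set_integrable_def\<close>)
    moreover have "(LINT t:{..- x}|lborel. w t) = (LINT t:{x..}|lborel. w (- t))"
      unfolding set_lebesgue_integral_def
      by (subst lborel_integral_real_affine[of "-1" _ 0]) (auto simp: indicator_def intro!: Bochner_Integration.integral_cong)
    ultimately show ?thesis by (simp add: eq_neg_iff_add_eq_0)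
  qed
  define E where "E = (\<lambda>x::real. complex_of_real (exp (x\<^sup>2 / 2)))"
  have E: "has_ac_deriv E (\<lambda>x. of_real x * E x)"
  proof (rule has_ac_derivI_C1)
    fix x :: real
    have "((\<lambda>x. exp (x\<^sup>2 / 2)) has_field_derivative x * exp (x\<^sup>2 / 2)) (at x)"
      by (auto intro!: derivative_eq_intros)
    then show "(E has_vector_derivative of_real x * E x) (at x)"
      unfolding E_def of_real_mult[symmetric]
      by (intro has_vector_derivative_of_real) (simp add: has_real_derivative_iff_has_vector_derivative)
    show "continuous_on UNIV (\<lambda>x. of_real x * E x)" unfolding E_def by (intro continuous_intros) auto
  qed
  define u where "u = (\<lambda>x. E x * V x)"
  define u' where "u' = (\<lambda>x. of_real x * u x - f x)"
  have u: "has_ac_deriv u u'"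
  proof -
    have "E x * w x = f x" for x
      unfolding E_def w_def by (simp add: exp_minus field_simps flip: of_real_mult)
    then have "(\<lambda>x. of_real x * E x * V x + E x * ((-1) * w x)) = u'"
      by (auto simp: fun_eq_iff u'_def u_def)
    then show ?thesis using has_ac_deriv_mult[OF E V] by (simp add: u_def)
  qed
  define B where "B = (1 / 4 + L2_sq f / 2)\<^sup>2"
  have bound: "x * (cmod (u x))\<^sup>2 \<le> B" "x * (cmod (u (- x)))\<^sup>2 \<le> B" if "x \<ge> 1" for x
  proof -
    show "x * (cmod (u x))\<^sup>2 \<le> B"
      using gauss_tail_bound[OF fL2 that] unfolding B_def u_def E_def V_def w_def
      by (simp add: norm_mult)
    show "x * (cmod (u (- x)))\<^sup>2 \<le> B"
      using gauss_tail_bound[OF L2_fun_reflect[OF fL2] that] unfolding B_def u_def E_def Vneg w_def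
      by (simp add: norm_mult L2_sq_reflect)
  qed
  have uc: "continuous_on UNIV u" using u by (rule has_ac_deriv_continuous)
  have u'c: "continuous_on UNIV u'" unfolding u'_def by (intro continuous_intros uc fc)
  have [measurable]: "u \<in> borel_measurable borel" "u' \<in> borel_measurable borel"
    using uc u'c by (auto intro: borel_measurable_continuous_onI)
  \<comment> \<open>On a bounded interval the integral of \<open>P\<close> equals that of |f|^2 plus
    the increment of x |u|^2. This is \<open>raise_raise\<close> with boundary terms, usable before
    \<open>u\<close> is known to be square integrable; \<open>bound\<close> controls these terms
    uniformly in the interval.\<close>
  define P where "P = (\<lambda>x. (cmod (of_real x * u x))\<^sup>2 + (cmod (u' x))\<^sup>2 + (cmod (u x))\<^sup>2)"
  have Pc: "continuous_on UNIV P" unfolding P_def by (intro continuous_intros uc u'c)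
  have [measurable]: "P \<in> borel_measurable borel" using Pc by (rule borel_measurable_continuous_onI)
  have P0: "P x \<ge> 0" for x by (simp add: P_def)
  define F where "F = (\<lambda>x. of_real x * u x * cnj (u x))"
  define F' where "F' = (\<lambda>x. (1 * u x + of_real x * u' x) * cnj (u x) + of_real x * u x * cnj (u' x))"
  have F: "has_ac_deriv F F'"
    unfolding F_def F'_def by (intro has_ac_deriv_mult has_ac_deriv_ident has_ac_deriv_cnj u)
  have PF: "complex_of_real (P x) = of_real ((cmod (f x))\<^sup>2) + F' x" for x
  proof -
    have fx: "f x = of_real x * u x - u' x" by (simp add: u'_def)
    show ?thesis
      unfolding P_def F'_def of_real_add complex_norm_square fx by (simp add: algebra_simps)
  qed
  have Pint: "set_integrable lborel {- R..R} P" for R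
    by (rule borel_integrable_atLeastAtMost') (rule continuous_on_subset[OF Pc subset_UNIV])
  have Pbound: "(LINT x:{- R..R}|lborel. P x) \<le> L2_sq f + 2 * B" if R: "R \<ge> 1" for R
  proof -
    have i1: "set_integrable lborel {- R..R} (\<lambda>x. (cmod (f x))\<^sup>2)"
      unfolding set_integrable_def
      by (rule integrable_mult_indicator[OF _ L2_fun_integrable_norm_sq[OF fL2]]) simp
    have i2: "set_integrable lborel {- R..R} F'" by (rule has_ac_deriv_integrable[OF F])
    have "complex_of_real (LINT x:{- R..R}|lborel. P x) = (LINT x:{- R..R}|lborel. of_real (P x))"
      by (rule set_integral_complex_of_real[symmetric])
    also have "\<dots> = (LINT x:{- R..R}|lborel. of_real ((cmod (f x))\<^sup>2) + F' x)" by (simp only: PF)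
    also have "\<dots> = (LINT x:{- R..R}|lborel. of_real ((cmod (f x))\<^sup>2)) + (LINT x:{- R..R}|lborel. F' x)"
    proof (rule set_integral_add(2)[OF _ i2])
      have "integrable lborel (\<lambda>x. complex_of_real (indicator {- R..R} x *\<^sub>R (cmod (f x))\<^sup>2))"
        using i1 unfolding set_integrable_def by (rule integrable_of_real)
      moreover have "complex_of_real (indicator {- R..R} x *\<^sub>R (cmod (f x))\<^sup>2) =
          indicator {- R..R} x *\<^sub>R complex_of_real ((cmod (f x))\<^sup>2)" for x
        by (simp add: indicator_def)
      ultimately show "set_integrable lborel {- R..R} (\<lambda>x. complex_of_real ((cmod (f x))\<^sup>2))"
        unfolding set_integrable_def by simp
    qed
    also have "(LINT x:{- R..R}|lborel. F' x) = F R - F (- R)"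
      using has_ac_deriv_diff[OF F, of "- R" R] R by simp
    also have "F R - F (- R) = of_real (R * (cmod (u R))\<^sup>2 + R * (cmod (u (- R)))\<^sup>2)"
      unfolding F_def of_real_add of_real_mult complex_norm_square by (simp add: mult.assoc)
    finally have "complex_of_real (LINT x:{- R..R}|lborel. P x) = of_real ((LINT x:{- R..R}|lborel. (cmod (f x))\<^sup>2)
        + (R * (cmod (u R))\<^sup>2 + R * (cmod (u (- R)))\<^sup>2))"
      unfolding set_integral_complex_of_real of_real_add .
    then have "(LINT x:{- R..R}|lborel. P x) = (LINT x:{- R..R}|lborel. (cmod (f x))\<^sup>2)
        + (R * (cmod (u R))\<^sup>2 + R * (cmod (u (- R)))\<^sup>2)"
      by (simp only: of_real_eq_iff)
    also have "(LINT x:{- R..R}|lborel. (cmod (f x))\<^sup>2) \<le> L2_sq f"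
      unfolding set_lebesgue_integral_def L2_sq_def
      by (rule integral_mono) (use i1 L2_fun_integrable_norm_sq[OF fL2] in \<open>auto simp: set_integrable_def indicator_def\<close>)
    finally show ?thesis using bound[OF R] by simp
  qed
  have "integrable lborel P"
  proof -
    define a where "a = (\<lambda>n x. indicator {- real (Suc n)..real (Suc n)} x *\<^sub>R P x)"
    have ai: "integrable lborel (a n)" for n using Pint unfolding set_integrable_def a_def .
    have amono: "a m x \<le> a n x" if "m \<le> n" for m n x
      using that P0 by (auto simp: a_def indicator_def)
    have inc: "incseq (\<lambda>n. LINT x|lborel. a n x)"
      by (auto simp: incseq_def intro!: integral_mono ai amono)
    have bd: "(LINT x|lborel. a n x) \<le> L2_sq f + 2 * B" for n
      using Pbound[of "real (Suc n)"] unfolding set_lebesgue_integral_def a_def by simp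
    obtain L where L: "(\<lambda>n. LINT x|lborel. a n x) \<longlonglongrightarrow> L"
      using incseq_convergent[OF inc] bd by blast
    show ?thesis
    proof (rule integral_monotone_convergence_nonneg(1)[OF ai _ _ _ L])
      show "AE x in lborel. mono (\<lambda>n. a n x)" by (intro AE_I2) (auto simp: mono_def intro: amono)
      show "AE x in lborel. 0 \<le> a n x" for n by (intro AE_I2) (auto simp: a_def P0)
      show "AE x in lborel. (\<lambda>n. a n x) \<longlonglongrightarrow> P x"
      proof (intro AE_I2 tendsto_eventually)
        fix x
        obtain N :: nat where N: "\<bar>x\<bar> \<le> real N" using real_arch_simple by blast
        then have "a n x = P x" if "n \<ge> N" for n using that by (auto simp: a_def indicator_def)
        then show "\<forall>\<^sub>F n in sequentially. a n x = P x" by (intro eventually_sequentiallyI)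
      qed
    qed simp
  qed
  then have dom: "h \<in> L2_fun" if [measurable]: "h \<in> borel_measurable borel" and "\<And>x. (cmod (h x))\<^sup>2 \<le> P x" for h
    by (intro L2_funI) (auto intro!: Bochner_Integration.integrable_bound[OF \<open>integrable lborel P\<close>] AE_I2 simp: that P0)
  have "osc_pair u u'"
    unfolding osc_pair_def
  proof (intro conjI u)
    show "u \<in> L2_fun" "u' \<in> L2_fun" by (rule dom; simp add: P_def)+
    show "(\<lambda>x. of_real x * u x) \<in> L2_fun" by (rule dom; simp add: P_def)
  qed
  moreover have "\<forall>x. of_real x * u x - u' x = f x" by (simp add: u'_def)
  ultimately show ?thesis by blast
qed

text \<open>Put A = d/dx + x. A function f orthogonal to \<open>hermite 0\<close> has the form A* u,
  and u is orthogonal to one Hermite function fewer. The induction hypothesis gives (2 K + 2) |u|^2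
  \<le> |f|^2, and <A f, u> = |f|^2 then forces |A f|^2 \<ge> (2 K + 2) |f|^2. The identity A* A = H
  - 1 converts this into the bound for K + 1.\<close>

lemma energy_lower_bound:
  assumes "osc_pair f g" "\<And>k. k < K \<Longrightarrow> L2_inner f (hermite k) = 0"
  shows "(2 * real K + 1) * L2_sq f \<le> L2_sq g + L2_sq (\<lambda>x. of_real x * f x)"
  using assms
proof (induction K arbitrary: f g)
  case 0
  have "complex_of_real (L2_sq (\<lambda>x. g x + of_real x * f x)) = of_real (L2_sq g + L2_sq (\<lambda>x. of_real x * f x) - L2_sq f)"
    using lower_lower[OF 0(1) 0(1)] unfolding osc_energy_self L2_inner_self by simp
  then have "L2_sq (\<lambda>x. g x + of_real x * f x) = L2_sq g + L2_sq (\<lambda>x. of_real x * f x) - L2_sq f"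
    by (simp only: of_real_eq_iff)
  then show ?case using L2_sq_nonneg[of "\<lambda>x. g x + of_real x * f x"] by simp
next
  case (Suc K)
  note f = Suc.prems(1)
  obtain u u' where u: "osc_pair u u'" and uf: "\<And>x. of_real x * u x - u' x = f x"
    using raise_surj[OF f Suc.prems(2)[of 0]] by auto
  have "L2_inner u (hermite k) = 0" if "k < K" for k
  proof -
    have "of_real (sqrt (2 * real k + 2)) * L2_inner u (hermite k) = L2_inner f (hermite (Suc k))"
      using raise_adjoint[OF u osc_pair_hermite[of "Suc k"]] unfolding uf hermite_lower_Suc
      by (simp add: L2_inner_scale_right)
    then show ?thesis using Suc.prems(2)[of "Suc k"] that by (auto simp: add_nonneg_eq_0_iff)
  qed
  from Suc.IH[OF u this] have IH: "(2 * real K + 1) * L2_sq u \<le> L2_sq u' + L2_sq (\<lambda>x. of_real x * u x)" by simp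
  have "complex_of_real (L2_sq f) = of_real (L2_sq u' + L2_sq (\<lambda>x. of_real x * u x) + L2_sq u)"
    using raise_raise[OF u u] unfolding osc_energy_self L2_inner_self uf by simp
  then have fu: "L2_sq f = L2_sq u' + L2_sq (\<lambda>x. of_real x * u x) + L2_sq u"
    by (simp only: of_real_eq_iff)
  define s where "s = 2 * real K + 2"
  have su: "s * L2_sq u \<le> L2_sq f" using IH fu by (simp add: s_def algebra_simps)
  let ?A = "\<lambda>x. g x + of_real x * f x"
  have "complex_of_real (L2_sq ?A) = of_real (L2_sq g + L2_sq (\<lambda>x. of_real x * f x) - L2_sq f)"
    using lower_lower[OF f f] unfolding osc_energy_self L2_inner_self by simp
  then have A: "L2_sq ?A = L2_sq g + L2_sq (\<lambda>x. of_real x * f x) - L2_sq f"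
    by (simp only: of_real_eq_iff)
  have AL2: "?A \<in> L2_fun" by (intro L2_fun_add osc_pairD[OF f])
  have Au: "L2_inner ?A u = of_real (L2_sq f)"
    using lower_adjoint[OF f u] unfolding uf by (simp add: L2_inner_self)
  \<comment> \<open>Cauchy-Schwarz as the square of A f - s u; the value of \<open>s\<close> is the
    one for which this difference vanishes when f is \<open>hermite (Suc K)\<close>.\<close>
  have "0 \<le> L2_sq (\<lambda>x. ?A x + (- of_real s) * u x)" by simp
  also have "\<dots> = L2_sq ?A + s\<^sup>2 * L2_sq u - 2 * s * L2_sq f"
    unfolding L2_sq_add[OF AL2 L2_fun_scale[OF osc_pairD(1)[OF u]]] L2_sq_scale L2_inner_scale_right Au
    by simp
  finally have "2 * s * L2_sq f \<le> L2_sq ?A + s * (s * L2_sq u)" by (simp add: power2_eq_square)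
  also have "\<dots> \<le> L2_sq ?A + s * L2_sq f" using su by (intro add_left_mono mult_left_mono) (auto simp: s_def)
  finally have "s * L2_sq f \<le> L2_sq ?A" by simp
  then show ?case unfolding A s_def by (simp add: algebra_simps)
qed

section \<open>Point values of eigenfunctions\<close>

lemma compact_support_integrable:
  fixes \<phi> :: "real \<Rightarrow> complex"
  assumes "continuous_on UNIV \<phi>" "\<And>x. x \<notin> {a..c} \<Longrightarrow> \<phi> x = 0"
  shows "integrable lborel \<phi>"
proof -
  have "integrable lborel (\<lambda>x. indicator {a..c} x *\<^sub>R \<phi> x)"
    by (intro borel_integrable_compact compact_Icc continuous_on_subset[OF assms(1)]) simp
  also have "(\<lambda>x. indicator {a..c} x *\<^sub>R \<phi> x) = \<phi>"
    using assms(2) by (auto simp: indicator_def fun_eq_iff)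
  finally show ?thesis .
qed

lemma indicator_continuous_L2:
  fixes \<phi> :: "real \<Rightarrow> complex"
  assumes cont: "continuous_on UNIV \<phi>" and "A \<subseteq> {a..c}" "A \<in> sets borel"
  shows "(\<lambda>x. indicator A x *\<^sub>R \<phi> x) \<in> L2_fun"
proof (rule L2_funI)
  have [measurable]: "\<phi> \<in> borel_measurable borel" using cont by (rule borel_measurable_continuous_onI)
  show m: "(\<lambda>x. indicator A x *\<^sub>R \<phi> x) \<in> borel_measurable lborel" using assms(3) by simp
  have "integrable lborel (\<lambda>x. indicator {a..c} x *\<^sub>R (cmod (\<phi> x))\<^sup>2)"
    by (intro borel_integrable_compact compact_Icc continuous_on_subset[OF cont] continuous_intros) simp
  then show "integrable lborel (\<lambda>x. (cmod (indicator A x *\<^sub>R \<phi> x))\<^sup>2)"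
  proof (rule Bochner_Integration.integrable_bound)
    show "AE x in lborel. norm ((cmod (indicator A x *\<^sub>R \<phi> x))\<^sup>2) \<le> norm (indicator {a..c} x *\<^sub>R (cmod (\<phi> x))\<^sup>2)"
      using assms(2) by (intro AE_I2) (auto simp: indicator_def)
  qed (use assms(3) in simp)
qed

lemma osc_pair_compact_support:
  assumes "has_ac_deriv h k" "k \<in> L2_fun" "\<And>x. x \<notin> {a..c} \<Longrightarrow> h x = 0"
  shows "osc_pair h k"
proof -
  have hc: "continuous_on UNIV h" using assms(1) by (rule has_ac_deriv_continuous)
  have eq: "(\<lambda>x. indicator {a..c} x *\<^sub>R h x) = h" "(\<lambda>x. indicator {a..c} x *\<^sub>R (of_real x * h x)) = (\<lambda>x. of_real x * h x)"
    using assms(3) by (auto simp: indicator_def fun_eq_iff)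
  have "h \<in> L2_fun" using indicator_continuous_L2[OF hc subset_refl, of a c] unfolding eq by simp
  moreover have "continuous_on UNIV (\<lambda>x. of_real x * h x)" by (intro continuous_intros hc)
  from indicator_continuous_L2[OF this subset_refl, of a c] have "(\<lambda>x. of_real x * h x) \<in> L2_fun"
    unfolding eq by simp
  ultimately show ?thesis using assms by (simp add: osc_pair_def)
qed

text \<open>Interior regularity: testing with \<open>h\<close> such that \<open>h'\<close> is \<open>g - W\<close> minus its mean on the interval.\<close>

lemma eigenpair_regularity:
  assumes ep: "osc_eigenpair b \<gamma> \<mu> f g" and b: "b > 0" and R: "b < R"
    and W: "\<And>x. (W has_vector_derivative (of_real (x\<^sup>2) - \<mu>) * f x) (at x)"
  shows "\<exists>m. AE x in lborel. x \<in> {b<..R} \<longrightarrow> g x = W x + m"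
proof -
  note fg = osc_eigenpairD(1)[OF ep]
  have fc: "continuous_on UNIV f" by (rule has_ac_deriv_continuous[OF osc_pairD(4)[OF fg]])
  have Wac: "has_ac_deriv W (\<lambda>x. (of_real (x\<^sup>2) - \<mu>) * f x)"
    by (rule has_ac_derivI_C1[OF W]) (intro continuous_intros fc)
  then have Wc: "continuous_on UNIV W" by (rule has_ac_deriv_continuous)
  have [measurable]: "g \<in> borel_measurable borel" "W \<in> borel_measurable borel"
    using osc_pairD(3)[OF fg] Wc by (auto dest: L2_fun_measurable intro: borel_measurable_continuous_onI)
  define I where "I = {b<..R}"
  have I [measurable]: "I \<in> sets borel" and IR: "I \<subseteq> {b..R}" by (auto simp: I_def)
  have gi: "set_integrable lborel I g"
    by (rule set_integrable_subset[OF L2_set_integrable[OF osc_pairD(3)[OF fg], of b R]]) (use IR in auto)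
  have Wi: "set_integrable lborel I W"
    by (rule set_integrable_subset[OF borel_integrable_atLeastAtMost'[of b R]]) (use IR continuous_on_subset[OF Wc] in auto)
  have ci: "set_integrable lborel I (\<lambda>x. c)" for c :: complex
    by (rule set_integrable_subset[OF borel_integrable_atLeastAtMost'[of b R]]) (use IR in auto)
  \<comment> \<open>Subtracting the mean makes the integral of \<open>k\<close> vanish, so its
    primitive \<open>h\<close> returns to 0 at \<open>R\<close>.\<close>
  define m where "m = (LINT t:I|lborel. g t - W t) / of_real (R - b)"
  define k where "k = (\<lambda>t. indicator I t *\<^sub>R (g t - W t - m))"
  have ki: "integrable lborel k"
    using set_integral_diff(1)[OF set_integral_diff(1)[OF gi Wi] ci[of m]] unfolding k_def set_integrable_def .
  have [measurable]: "k \<in> borel_measurable borel" unfolding k_def by simp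
  have k0: "(LINT t|lborel. k t) = 0"
  proof -
    have "(LINT t|lborel. k t) = (LINT t:I|lborel. g t - W t) - (LINT t:I|lborel. m)"
      using set_integral_diff(2)[OF set_integral_diff(1)[OF gi Wi] ci[of m]] unfolding k_def set_lebesgue_integral_def .
    also have "(LINT t:I|lborel. m) = of_real (R - b) * m"
      unfolding set_lebesgue_integral_def I_def using R
      by (simp add: scaleR_conv_of_real)
    finally show ?thesis using R by (simp add: m_def)
  qed
  have kL2: "k \<in> L2_fun"
  proof -
    have "(\<lambda>t. indicator I t *\<^sub>R g t) \<in> L2_fun"
      by (rule L2_fun_dominated[OF osc_pairD(3)[OF fg], of _ 1]) (auto simp: indicator_def)
    moreover have "(\<lambda>t. indicator I t *\<^sub>R (W t + m)) \<in> L2_fun"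
      by (rule indicator_continuous_L2[OF _ IR I]) (intro continuous_intros Wc)
    ultimately have "(\<lambda>t. indicator I t *\<^sub>R g t - indicator I t *\<^sub>R (W t + m)) \<in> L2_fun" by (rule L2_fun_diff)
    also have "(\<lambda>t. indicator I t *\<^sub>R g t - indicator I t *\<^sub>R (W t + m)) = k"
      by (auto simp: k_def indicator_def fun_eq_iff)
    finally show ?thesis .
  qed
  define h where "h = (\<lambda>x. LINT t:{..x}|lborel. k t)"
  have kset: "set_integrable lborel A k" if "A \<in> sets borel" for A
    unfolding set_integrable_def by (rule integrable_mult_indicator[OF _ ki]) (use that in simp)
  have hac: "has_ac_deriv h k"
    unfolding has_ac_deriv_def
  proof (intro allI impI conjI kset)
    fix x y :: real assume xy: "x \<le> y"
    have ae: "AE t in lborel. indicator {..y} t *\<^sub>R k t = indicator {x..y} t *\<^sub>R k t + indicator {..x} t *\<^sub>R k t"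
      by (rule AE_mp[OF AE_lborel_singleton[of x]]) (use xy in \<open>auto simp: indicator_def intro!: AE_I2\<close>)
    have "h y = (LINT t:{x..y}|lborel. k t) + h x"
      unfolding h_def set_lebesgue_integral_def
      by (rule integral_AE_add[OF ae]) (use kset in \<open>auto simp: set_integrable_def\<close>)
    then show "h y - h x = (LINT t:{x..y}|lborel. k t)" by simp
  qed simp
  have hlow: "h x = 0" if "x \<le> b" for x
  proof -
    have "indicator {..x} t *\<^sub>R k t = 0" for t using that by (auto simp: k_def I_def indicator_def)
    then show ?thesis unfolding h_def set_lebesgue_integral_def
      by (simp only: Bochner_Integration.integral_zero)
  qed
  have hhigh: "h x = 0" if "x \<ge> R" for x
  proof -
    have "indicator {..x} t *\<^sub>R k t = k t" for t using that by (auto simp: k_def I_def indicator_def)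
    then show ?thesis unfolding h_def set_lebesgue_integral_def by (simp only: k0)
  qed
  have hout: "h x = 0" if "x \<notin> {b..R}" for x using hlow[of x] hhigh[of x] that by force
  have hp: "osc_pair h k" by (rule osc_pair_compact_support[OF hac kL2 hout])
  have hc: "continuous_on UNIV h" using hac by (rule has_ac_deriv_continuous)
  \<comment> \<open>\<open>h\<close> vanishes at \<open>b\<close> and \<open>- b\<close>, so the
    deltas drop out of the tested equation.\<close>
  have eq1: "osc_energy f g h k = \<mu> * L2_inner f h"
    using osc_eigenpairD(3)[OF ep hp] hlow[of b] hlow[of "- b"] b by simp
  have i1: "integrable lborel (\<lambda>x. (of_real (x\<^sup>2) - \<mu>) * f x * cnj (h x))"
    by (rule compact_support_integrable[of _ b R]) (use hout in \<open>auto intro!: continuous_intros fc hc\<close>)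
  have i2: "integrable lborel (\<lambda>x. W x * cnj (k x))"
  proof -
    have "set_integrable lborel {b..R} (\<lambda>t. cnj (k t) * W t)"
      by (rule set_integrable_mult_continuous[OF L2_set_integrable[OF L2_fun_cnj[OF kL2]]])
        (rule continuous_on_subset[OF Wc subset_UNIV])
    moreover have "indicator {b..R} t *\<^sub>R (cnj (k t) * W t) = W t * cnj (k t)" for t
      using IR by (auto simp: k_def indicator_def)
    ultimately show ?thesis unfolding set_integrable_def by simp
  qed
  have i3: "integrable lborel (\<lambda>x. W x * cnj (h x))"
    by (rule compact_support_integrable[of _ b R]) (use hout in \<open>auto intro!: continuous_intros Wc hc\<close>)
  have "(LINT x|lborel. (of_real (x\<^sup>2) - \<mu>) * f x * cnj (h x) + W x * cnj (k x)) = 0"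
    by (rule integral_ac_deriv_eq_0[OF has_ac_deriv_mult[OF Wac has_ac_deriv_cnj[OF hac]] i3]) (use i1 i2 in simp)
  then have "(LINT x|lborel. (of_real (x\<^sup>2) - \<mu>) * f x * cnj (h x)) = - (LINT x|lborel. W x * cnj (k x))"
    using i1 i2 by (simp add: eq_neg_iff_add_eq_0)
  moreover have "(LINT x|lborel. (of_real (x\<^sup>2) - \<mu>) * f x * cnj (h x)) =
      L2_inner (\<lambda>x. of_real x * f x) (\<lambda>x. of_real x * h x) - \<mu> * L2_inner f h"
  proof -
    have "(LINT x|lborel. (of_real (x\<^sup>2) - \<mu>) * f x * cnj (h x)) =
       (LINT x|lborel. of_real x * f x * cnj (of_real x * h x) - \<mu> * (f x * cnj (h x)))"
      by (intro Bochner_Integration.integral_cong) (auto simp: algebra_simps power2_eq_square)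
    also have "\<dots> = (LINT x|lborel. of_real x * f x * cnj (of_real x * h x)) - (LINT x|lborel. \<mu> * (f x * cnj (h x)))"
      by (intro Bochner_Integration.integral_diff integrable_mult_right L2_inner_integrable osc_pairD[OF fg] osc_pairD[OF hp])
    finally show ?thesis unfolding L2_inner_def by simp
  qed
  moreover have "L2_inner g k + L2_inner (\<lambda>x. of_real x * f x) (\<lambda>x. of_real x * h x) = \<mu> * L2_inner f h"
    using eq1 unfolding osc_energy_def .
  ultimately have gk: "L2_inner g k = (LINT x|lborel. W x * cnj (k x))" by (simp add: algebra_simps)
  have "(LINT x|lborel. cnj (k x)) = 0" using k0 by (simp add: Bochner_Integration.integral_cnj)
  then have mk: "(LINT x|lborel. m * cnj (k x)) = 0" by simp
  have i4: "integrable lborel (\<lambda>x. g x * cnj (k x))" by (rule L2_inner_integrable[OF osc_pairD(3)[OF fg] kL2])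
  have i5: "integrable lborel (\<lambda>x. m * cnj (k x))" using ki by simp
  \<comment> \<open>On the interval \<open>k\<close> is \<open>g - W - m\<close>. By
    \<open>gk\<close> the difference \<open>g - W\<close> is orthogonal to \<open>k\<close>, by
    \<open>mk\<close> constants are, so \<open>k\<close> has norm 0.\<close>
  have "L2_inner k k = (LINT x|lborel. g x * cnj (k x) - W x * cnj (k x) - m * cnj (k x))"
    unfolding L2_inner_def by (intro Bochner_Integration.integral_cong) (auto simp: k_def indicator_def algebra_simps)
  also have "\<dots> = (LINT x|lborel. g x * cnj (k x)) - (LINT x|lborel. W x * cnj (k x)) - (LINT x|lborel. m * cnj (k x))"
    using i2 i4 i5 by (simp only: Bochner_Integration.integral_diff Bochner_Integration.integrable_diff)
  also have "\<dots> = 0" using gk mk unfolding L2_inner_def by simp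
  finally have "L2_sq k = 0" unfolding L2_inner_self by simp
  then have "AE x in lborel. k x = 0" using L2_sq_eq_0_iff[OF kL2] by simp
  then have "AE x in lborel. x \<in> {b<..R} \<longrightarrow> g x = W x + m"
    by eventually_elim (auto simp: k_def I_def indicator_def algebra_simps)
  then show ?thesis by blast
qed

text \<open>With p = |f|, q = |f'|, s = sqrt \<lambda> and n = |Im \<mu>|, the left side bounds the
  rate at which the energy can decrease at x, and the right side is a multiple of the energy. The
  condition x \<le> s / 2 keeps its coefficient s^2 - x^2 above 3/4 s^2.\<close>

lemma energy_rate_inequality:
  fixes s x p q n :: real
  assumes "s > 0" "0 \<le> x" "x \<le> s / 2" "0 \<le> n"
  shows "2 * x * p\<^sup>2 + 2 * (n * (p * q)) \<le> 2 * (1 + n) / s * ((s\<^sup>2 - x\<^sup>2) * p\<^sup>2 + q\<^sup>2)"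
proof -
  have "x\<^sup>2 \<le> (s / 2)\<^sup>2" using assms by (intro power_mono) auto
  then have "3 / 4 * s\<^sup>2 \<le> s\<^sup>2 - x\<^sup>2" by (simp add: power_divide)
  then have "3 / 4 * s\<^sup>2 * p\<^sup>2 + q\<^sup>2 \<le> (s\<^sup>2 - x\<^sup>2) * p\<^sup>2 + q\<^sup>2" by (intro add_right_mono mult_right_mono) auto
  then have 1: "2 * (1 + n) / s * (3 / 4 * s\<^sup>2 * p\<^sup>2 + q\<^sup>2) \<le> 2 * (1 + n) / s * ((s\<^sup>2 - x\<^sup>2) * p\<^sup>2 + q\<^sup>2)"
    using assms by (intro mult_left_mono) auto
  have 2: "2 * (1 + n) / s * (3 / 4 * s\<^sup>2 * p\<^sup>2 + q\<^sup>2) = (1 + n) * (3 / 2 * (s * p\<^sup>2) + 2 * (q\<^sup>2 / s))"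
    using assms(1) by (simp add: field_simps power2_eq_square)
  have "0 \<le> (s * p - q)\<^sup>2 / s" using assms(1) by simp
  also have "\<dots> = s * p\<^sup>2 + q\<^sup>2 / s - 2 * (p * q)" using assms(1) by (simp add: field_simps power2_eq_square)
  finally have "n * (2 * (p * q)) \<le> n * (s * p\<^sup>2 + q\<^sup>2 / s)" using assms(4) by (intro mult_left_mono) auto
  moreover have "2 * x * p\<^sup>2 \<le> s * p\<^sup>2" using assms(3) by (intro mult_right_mono) auto
  moreover have "0 \<le> s * p\<^sup>2" "0 \<le> q\<^sup>2 / s" "0 \<le> n * (s * p\<^sup>2)" "0 \<le> n * (q\<^sup>2 / s)" using assms by auto
  moreover have "n * (2 * (p * q)) = 2 * (n * (p * q))" "n * (s * p\<^sup>2 + q\<^sup>2 / s) = n * (s * p\<^sup>2) + n * (q\<^sup>2 / s)"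
    "(1 + n) * (3 / 2 * (s * p\<^sup>2) + 2 * (q\<^sup>2 / s)) =
      3 / 2 * (s * p\<^sup>2) + 2 * (q\<^sup>2 / s) + 3 / 2 * (n * (s * p\<^sup>2)) + 2 * (n * (q\<^sup>2 / s))"
    by algebra+
  ultimately have "2 * x * p\<^sup>2 + 2 * (n * (p * q)) \<le> (1 + n) * (3 / 2 * (s * p\<^sup>2) + 2 * (q\<^sup>2 / s))"
    by linarith
  with 1 2 show ?thesis by simp
qed

text \<open>With \<open>\<mu> = \<lambda> + i \<nu>\<close>, the energy \<open>(\<lambda> - x^2) |f|^2 + |f'|^2\<close> varies by at most a factor 2 over an
  interval of length about \<open>sqrt \<lambda> / (1 + \<bar>\<nu>\<bar>)\<close> to the right of \<open>b\<close>, so its value at \<open>b\<close> is bounded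
  by its mean.\<close>

lemma eigenpair_point_bound:
  assumes ep: "osc_eigenpair b \<gamma> \<mu> f g" and b: "b > 0" and large: "16 * b\<^sup>2 \<le> Re \<mu>"
  shows "(cmod (f b))\<^sup>2 \<le> 32 * (1 + \<bar>Im \<mu>\<bar>) / sqrt (Re \<mu>) * L2_sq f"
proof -
  note fg = osc_eigenpairD(1)[OF ep]
  have fc: "continuous_on UNIV f" by (rule has_ac_deriv_continuous[OF osc_pairD(4)[OF fg]])
  define s where "s = sqrt (Re \<mu>)"
  define n where "n = \<bar>Im \<mu>\<bar>"
  have "sqrt (16 * b\<^sup>2) \<le> s" unfolding s_def using large by (rule real_sqrt_le_mono)
  then have sb: "4 * b \<le> s" using b by (simp add: real_sqrt_mult)
  have s0: "s > 0" using sb b by simp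
  have "0 < 16 * b\<^sup>2" using b by simp
  with large have l0: "Re \<mu> > 0" by linarith
  have s2: "s\<^sup>2 = Re \<mu>" using l0 by (simp add: s_def)
  have n0: "n \<ge> 0" by (simp add: n_def)
  \<comment> \<open>This length gives \<open>c * l = 1 / 2\<close> for the rate \<open>c\<close>
    below, hence a growth factor of at most exp (1/2) \<le> 2. Together with 4 b \<le> s it also
    keeps the interval inside x \<le> s / 2.\<close>
  define l where "l = s / (4 * (1 + n))"
  have lpos: "l > 0" using s0 n0 by (simp add: l_def)
  have "l \<le> s / 4" unfolding l_def using s0 n0 by (intro divide_left_mono) auto
  define R where "R = b + l"
  have R: "b < R" "R \<le> s / 2" using lpos \<open>l \<le> s / 4\<close> sb by (auto simp: R_def)
  obtain W where W: "\<And>x. (W has_vector_derivative (of_real (x\<^sup>2) - \<mu>) * f x) (at x)"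
  proof -
    have "continuous_on UNIV (\<lambda>x. (of_real (x\<^sup>2) - \<mu>) * f x)" by (intro continuous_intros fc)
    then show thesis
      using einterval_antiderivative[of "-\<infinity>" "\<infinity>" "\<lambda>x. (of_real (x\<^sup>2) - \<mu>) * f x"] that
      by (auto simp: continuous_on_eq_continuous_at)
  qed
  obtain m where m: "AE x in lborel. x \<in> {b<..R} \<longrightarrow> g x = W x + m"
    using eigenpair_regularity[OF ep b R(1) W] by blast
  define v where "v = (\<lambda>x. W x + m)"
  have v: "(v has_vector_derivative (of_real (x\<^sup>2) - \<mu>) * f x) (at x)" for x
    unfolding v_def by (auto intro!: derivative_eq_intros W)
  have vc: "continuous_on UNIV v"
    using v by (meson continuous_at_imp_continuous_on has_vector_derivative_continuous)
  obtain H where H: "\<And>x. (H has_vector_derivative v x) (at x)"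
    using einterval_antiderivative[of "-\<infinity>" "\<infinity>" v] vc by (auto simp: continuous_on_eq_continuous_at)
  \<comment> \<open>\<open>F\<close> is twice continuously differentiable on the whole line and
    agrees with \<open>f\<close> on \<open>{b..R}\<close>. It has two-sided derivatives even at
    \<open>b\<close>, where the derivative of \<open>f\<close> may jump.\<close>
  define F where "F = (\<lambda>x. f b + (H x - H b))"
  have F: "(F has_vector_derivative v x) (at x)" for x
    unfolding F_def by (auto intro!: derivative_eq_intros H)
  have Ff: "F x = f x" if x: "x \<in> {b..R}" for x
  proof -
    have "H x - H b = (LINT t:{b..x}|lborel. v t)"
      using has_ac_derivI_C1[OF H vc] x by (intro has_ac_deriv_diff) auto
    also have "\<dots> = (LINT t:{b..x}|lborel. g t)"
    proof (rule set_lebesgue_integral_cong_AE)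
      show "v \<in> borel_measurable lborel" using vc by (simp add: borel_measurable_continuous_onI)
      show "g \<in> borel_measurable lborel" using osc_pairD(3)[OF fg] by (simp add: L2_fun_measurable)
      show "AE t \<in> {b..x} in lborel. v t = g t"
        using m AE_lborel_singleton[of b] by eventually_elim (use x in \<open>auto simp: v_def\<close>)
    qed simp
    also have "\<dots> = f x - f b" using osc_pairD(4)[OF fg] x by (intro has_ac_deriv_diff[symmetric]) auto
    finally show ?thesis by (simp add: F_def)
  qed
  define c where "c = 2 * (1 + n) / s"
  define E where "E = (\<lambda>x. (s\<^sup>2 - x\<^sup>2) * (F x \<bullet> F x) + v x \<bullet> v x)"
  \<comment> \<open>A Gronwall argument: in E' the contributions of s^2 - y^2 cancel, and what
    remains, from the explicit y and from \<open>Im \<mu>\<close>, is at least - c E.\<close>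
  have grow: "exp (c * b) * E b \<le> exp (c * x) * E x" if x: "x \<in> {b..R}" for x
  proof (rule DERIV_nonneg_imp_nondecreasing[of b x "\<lambda>x. exp (c * x) * E x"])
    show "b \<le> x" using x by simp
    fix y assume y: "b \<le> y" "y \<le> x"
    have Fy: "F y = f y" by (rule Ff) (use x y in auto)
    have dF: "((\<lambda>x. F x \<bullet> F x) has_field_derivative 2 * (F y \<bullet> v y)) (at y)"
      using bounded_bilinear.has_vector_derivative[OF bounded_bilinear_inner F[of y] F[of y]]
      by (simp add: has_real_derivative_iff_has_vector_derivative inner_commute)
    have dv: "((\<lambda>x. v x \<bullet> v x) has_field_derivative 2 * (v y \<bullet> ((of_real (y\<^sup>2) - \<mu>) * F y))) (at y)"
      using bounded_bilinear.has_vector_derivative[OF bounded_bilinear_inner v[of y] v[of y]]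
      by (simp add: has_real_derivative_iff_has_vector_derivative inner_commute Fy)
    define E' where "E' = - 2 * y * (F y \<bullet> F y) + (s\<^sup>2 - y\<^sup>2) * (2 * (F y \<bullet> v y)) + 2 * (v y \<bullet> ((of_real (y\<^sup>2) - \<mu>) * F y))"
    have dE: "(E has_field_derivative E') (at y)"
      unfolding E_def E'_def by (auto intro!: derivative_eq_intros dF dv)
    have decomp: "(of_real (y\<^sup>2) - \<mu>) * F y = (y\<^sup>2 - s\<^sup>2) *\<^sub>R F y - \<i> * of_real (Im \<mu>) * F y"
      unfolding s2 scaleR_conv_of_real by (simp add: complex_eq_iff algebra_simps)
    have E'_eq: "E' = - 2 * y * (F y \<bullet> F y) - 2 * (v y \<bullet> (\<i> * of_real (Im \<mu>) * F y))"
      unfolding E'_def decomp by (simp add: inner_diff_right inner_commute algebra_simps)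
    have "\<bar>v y \<bullet> (\<i> * of_real (Im \<mu>) * F y)\<bar> \<le> cmod (v y) * cmod (\<i> * of_real (Im \<mu>) * F y)"
      by (rule Cauchy_Schwarz_ineq2)
    also have "\<dots> = n * (cmod (F y) * cmod (v y))" by (simp add: norm_mult n_def)
    finally have CS: "v y \<bullet> (\<i> * of_real (Im \<mu>) * F y) \<le> n * (cmod (F y) * cmod (v y))" by simp
    have "2 * y * (cmod (F y))\<^sup>2 + 2 * (n * (cmod (F y) * cmod (v y)))
        \<le> c * ((s\<^sup>2 - y\<^sup>2) * (cmod (F y))\<^sup>2 + (cmod (v y))\<^sup>2)"
      unfolding c_def by (rule energy_rate_inequality) (use s0 n0 b x y R in auto)
    then have "0 \<le> c * E y + E'"
      using CS unfolding E'_eq E_def power2_norm_eq_inner by simp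
    then have nn: "0 \<le> exp (c * y) * (c * E y + E')" by simp
    have "((\<lambda>x. exp (c * x) * E x) has_field_derivative exp (c * y) * (c * E y + E')) (at y)"
      by (auto intro!: derivative_eq_intros dE simp: algebra_simps)
    with nn show "\<exists>d. ((\<lambda>x. exp (c * x) * E x) has_field_derivative d) (at y) \<and> 0 \<le> d" by blast
  qed
  have Epos: "0 \<le> E x" if "x \<in> {b..R}" for x
  proof -
    have "x\<^sup>2 \<le> s\<^sup>2" using that b R s0 by (intro power_mono) auto
    then show ?thesis by (simp add: E_def)
  qed
  have Ecomp: "E b \<le> 2 * E x" if x: "x \<in> {b..R}" for x
  proof -
    have "c * (x - b) \<le> c * l" using x n0 s0 by (intro mult_left_mono) (auto simp: c_def R_def)
    also have "c * l = 1 / 2" using n0 s0 by (simp add: c_def l_def divide_simps)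
    finally have "exp (c * (x - b)) \<le> exp (1 / 2)" by simp
    also have "\<dots> \<le> 2" by (rule exp_half_le2)
    finally have e2: "exp (c * (x - b)) \<le> 2" .
    have "E b = exp (- (c * b)) * (exp (c * b) * E b)" by (simp add: exp_minus)
    also have "\<dots> \<le> exp (- (c * b)) * (exp (c * x) * E x)" using grow[OF x] by (intro mult_left_mono) auto
    also have "\<dots> = exp (c * (x - b)) * E x" by (simp add: right_diff_distrib exp_diff exp_minus field_simps)
    also have "\<dots> \<le> 2 * E x" using e2 Epos[OF x] by (rule mult_right_mono)
    finally show ?thesis .
  qed
  have "indicator {b<..R} x * E b \<le> 2 * (Re \<mu> * (cmod (f x))\<^sup>2 + (cmod (g x))\<^sup>2)"
    if "x \<in> {b<..R} \<longrightarrow> g x = W x + m" for x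
  proof (cases "x \<in> {b<..R}")
    case True
    then have x: "x \<in> {b..R}" and gx: "g x = v x" using that by (auto simp: v_def)
    have "E x \<le> s\<^sup>2 * (F x \<bullet> F x) + v x \<bullet> v x"
      unfolding E_def by (intro add_right_mono mult_right_mono) auto
    then show ?thesis using Ecomp[OF x] True unfolding s2 Ff[OF x] gx power2_norm_eq_inner by simp
  next
    case False
    then show ?thesis using l0 by simp
  qed
  then have "AE x in lborel. indicator {b<..R} x * E b \<le> 2 * (Re \<mu> * (cmod (f x))\<^sup>2 + (cmod (g x))\<^sup>2)"
    using m by (auto elim!: eventually_mono)
  moreover have "integrable lborel (\<lambda>x. 2 * (Re \<mu> * (cmod (f x))\<^sup>2 + (cmod (g x))\<^sup>2))"
    using osc_pairD[OF fg] by (simp add: L2_fun_integrable_norm_sq)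
  moreover have "integrable lborel (\<lambda>x. indicator {b<..R} x * E b)"
    by (intro integrable_mult_left integrable_real_indicator) (use R in auto)
  ultimately have "(LINT x|lborel. indicator {b<..R} x * E b) \<le> (LINT x|lborel. 2 * (Re \<mu> * (cmod (f x))\<^sup>2 + (cmod (g x))\<^sup>2))"
    by (intro integral_mono_AE)
  also have "(LINT x|lborel. 2 * (Re \<mu> * (cmod (f x))\<^sup>2 + (cmod (g x))\<^sup>2)) = 2 * (Re \<mu> * L2_sq f + L2_sq g)"
    using osc_pairD[OF fg] by (simp add: L2_fun_integrable_norm_sq L2_sq_def)
  \<comment> \<open>The energy identity bounds \<open>L2_sq g\<close> by
    \<open>Re \<mu> * L2_sq f\<close>.\<close>
  also have "\<dots> \<le> 4 * Re \<mu> * L2_sq f"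
    using osc_eigenpair_real_part(1)[OF ep] L2_sq_nonneg[of "\<lambda>x. of_real x * f x"] by argo
  also have "(LINT x|lborel. indicator {b<..R} x * E b) = l * E b"
    using R by (simp add: R_def)
  finally have upper: "l * E b \<le> 4 * Re \<mu> * L2_sq f" .
  have "b\<^sup>2 \<le> (s / 4)\<^sup>2" using sb b by (intro power_mono) auto
  then have "Re \<mu> / 2 \<le> s\<^sup>2 - b\<^sup>2" using s2 l0 by (simp add: power_divide)
  then have "Re \<mu> / 2 * (cmod (f b))\<^sup>2 \<le> (s\<^sup>2 - b\<^sup>2) * (cmod (f b))\<^sup>2" by (rule mult_right_mono) simp
  also have "\<dots> \<le> E b" using Ff[of b] R unfolding E_def by (simp add: power2_norm_eq_inner)
  finally have "l * (Re \<mu> / 2 * (cmod (f b))\<^sup>2) \<le> 4 * Re \<mu> * L2_sq f"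
    using upper lpos by (meson mult_left_mono less_imp_le order_trans)
  then have "l * (cmod (f b))\<^sup>2 \<le> 8 * L2_sq f" using l0 by (simp add: field_simps)
  then have "(cmod (f b))\<^sup>2 \<le> 8 * L2_sq f / l" using lpos by (simp add: field_simps)
  also have "\<dots> = 32 * (1 + n) / s * L2_sq f" using s0 n0 by (simp add: l_def field_simps)
  finally show ?thesis by (simp add: s_def n_def)
qed

section \<open>Location of non-real eigenvalues\<close>

lemma osc_energy_add_right:
  assumes "osc_pair f g" "osc_pair f' g'" "osc_pair h k"
  shows "osc_energy h k (\<lambda>x. f x + f' x) (\<lambda>x. g x + g' x) = osc_energy h k f g + osc_energy h k f' g'"
  using arg_cong[OF osc_energy_add_left[OF assms], of cnj] by (simp add: osc_energy_cnj)

lemma osc_energy_scale_right: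
  "osc_energy h k (\<lambda>x. c * f x) (\<lambda>x. c * g x) = cnj c * osc_energy h k f g"
  using arg_cong[OF osc_energy_scale_left[of c f g h k], of cnj] by (simp add: osc_energy_cnj)

text \<open>A Hermite function is an eigenvector of the oscillator, so splitting off its component
  is orthogonal for the norm and for the energy at once.\<close>

lemma hermite_component_removal:
  fixes j :: nat
  assumes f: "osc_pair f g"
  defines "c \<equiv> L2_inner f (hermite j)"
  defines "r \<equiv> \<lambda>x. f x + (- c) * hermite j x" and "r' \<equiv> \<lambda>x. g x + (- c) * hermite_deriv j x"
  shows "osc_pair r r'"
    "L2_inner r (hermite i) = (if i = j then 0 else L2_inner f (hermite i))"
    "L2_sq r = L2_sq f - (cmod c)\<^sup>2"
    "L2_sq r' + L2_sq (\<lambda>x. of_real x * r x) =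
       L2_sq g + L2_sq (\<lambda>x. of_real x * f x) - (2 * real j + 1) * (cmod c)\<^sup>2"
proof -
  have h: "osc_pair (\<lambda>x. (- c) * hermite j x) (\<lambda>x. (- c) * hermite_deriv j x)"
    by (rule osc_pair_scale[OF osc_pair_hermite])
  show "osc_pair r r'" unfolding r_def r'_def by (rule osc_pair_add[OF f h])
  show "L2_inner r (hermite i) = (if i = j then 0 else L2_inner f (hermite i))"
    unfolding r_def L2_inner_add_left[OF osc_pairD(1)[OF f] osc_pairD(1)[OF h] hermite_L2(1)] L2_inner_scale_left
      hermite_orthonormal by (simp add: c_def)
  have "L2_sq r = L2_sq f + (cmod c)\<^sup>2 + 2 * Re (cnj (- c) * c)"
    unfolding r_def L2_sq_add[OF osc_pairD(1)[OF f] osc_pairD(1)[OF h]] L2_inner_scale_right L2_sq_scale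
    by (simp add: c_def)
  also have "cnj (- c) * c = - of_real ((cmod c)\<^sup>2)" unfolding complex_norm_square by simp
  finally show "L2_sq r = L2_sq f - (cmod c)\<^sup>2" by simp
  have e1: "osc_energy f g (hermite j) (hermite_deriv j) = of_real (2 * real j + 1) * c"
    unfolding c_def by (rule osc_energy_hermite[OF f])
  then have e2: "osc_energy (hermite j) (hermite_deriv j) f g = of_real (2 * real j + 1) * cnj c"
    using osc_energy_cnj[of f g "hermite j" "hermite_deriv j"] by simp
  have e3: "osc_energy (hermite j) (hermite_deriv j) (hermite j) (hermite_deriv j) = of_real (2 * real j + 1)"
    using osc_energy_hermite[OF osc_pair_hermite[of j], of j] by (simp add: hermite_orthonormal)
  have "osc_energy r r' r r' = osc_energy f g f g - of_real (2 * real j + 1) * (c * cnj c)"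
    unfolding r_def r'_def osc_energy_add_left[OF f h osc_pair_add[OF f h]] osc_energy_scale_left
      osc_energy_add_right[OF f h f] osc_energy_add_right[OF f h osc_pair_hermite] osc_energy_scale_right e1 e2 e3
    by (simp add: algebra_simps)
  then have "complex_of_real (L2_sq r' + L2_sq (\<lambda>x. of_real x * r x)) =
       of_real (L2_sq g + L2_sq (\<lambda>x. of_real x * f x) - (2 * real j + 1) * (cmod c)\<^sup>2)"
    unfolding osc_energy_self complex_norm_square[symmetric] by simp
  then show "L2_sq r' + L2_sq (\<lambda>x. of_real x * r x) =
       L2_sq g + L2_sq (\<lambda>x. of_real x * f x) - (2 * real j + 1) * (cmod c)\<^sup>2"
    by (simp only: of_real_eq_iff)
qed

lemma hermite_remainder:
  assumes f: "osc_pair f g"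
  shows "\<exists>r r'. osc_pair r r' \<and>
     (\<forall>i. L2_inner r (hermite i) = (if i < K then 0 else L2_inner f (hermite i))) \<and>
     L2_sq r = L2_sq f - (\<Sum>k<K. (cmod (L2_inner f (hermite k)))\<^sup>2) \<and>
     L2_sq r' + L2_sq (\<lambda>x. of_real x * r x) \<le> L2_sq g + L2_sq (\<lambda>x. of_real x * f x)"
proof (induction K)
  case 0
  show ?case using f by auto
next
  case (Suc K)
  then obtain r r' where r: "osc_pair r r'" "\<And>i. L2_inner r (hermite i) = (if i < K then 0 else L2_inner f (hermite i))"
     "L2_sq r = L2_sq f - (\<Sum>k<K. (cmod (L2_inner f (hermite k)))\<^sup>2)"
     "L2_sq r' + L2_sq (\<lambda>x. of_real x * r x) \<le> L2_sq g + L2_sq (\<lambda>x. of_real x * f x)" by blast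
  note s = hermite_component_removal[OF r(1), of K]
  have "0 \<le> (2 * real K + 1) * (cmod (L2_inner r (hermite K)))\<^sup>2" by simp
  with s r(2-4) have "\<forall>i. L2_inner (\<lambda>x. r x + - L2_inner r (hermite K) * hermite K x) (hermite i)
       = (if i < Suc K then 0 else L2_inner f (hermite i))"
    "L2_sq (\<lambda>x. r x + - L2_inner r (hermite K) * hermite K x) = L2_sq f - (\<Sum>k<Suc K. (cmod (L2_inner f (hermite k)))\<^sup>2)"
    by (auto simp: less_Suc_eq)
  moreover have "L2_sq (\<lambda>x. r' x + - L2_inner r (hermite K) * hermite_deriv K x) +
       L2_sq (\<lambda>x. of_real x * (r x + - L2_inner r (hermite K) * hermite K x)) \<le> L2_sq g + L2_sq (\<lambda>x. of_real x * f x)"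
    using s(4) r(4) \<open>0 \<le> (2 * real K + 1) * (cmod (L2_inner r (hermite K)))\<^sup>2\<close> by linarith
  moreover note s(1)
  ultimately show ?case by blast
qed

text \<open>A Markov inequality for the energy: mass beyond the first \<open>K\<close> Hermite
  functions costs at least 2 K + 1 per unit. It bounds that mass from above when the energy is
  known.\<close>

lemma hermite_tail_inequality:
  assumes f: "osc_pair f g"
  shows "(2 * real K + 1) * (L2_sq f - (\<Sum>k<K. (cmod (L2_inner f (hermite k)))\<^sup>2))
     \<le> L2_sq g + L2_sq (\<lambda>x. of_real x * f x)"
proof -
  obtain r r' where r: "osc_pair r r'" "\<And>i. L2_inner r (hermite i) = (if i < K then 0 else L2_inner f (hermite i))"
     "L2_sq r = L2_sq f - (\<Sum>k<K. (cmod (L2_inner f (hermite k)))\<^sup>2)"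
     "L2_sq r' + L2_sq (\<lambda>x. of_real x * r x) \<le> L2_sq g + L2_sq (\<lambda>x. of_real x * f x)"
    using hermite_remainder[OF f, of K] by blast
  have "(2 * real K + 1) * L2_sq r \<le> L2_sq r' + L2_sq (\<lambda>x. of_real x * r x)"
    by (rule energy_lower_bound[OF r(1)]) (simp add: r(2))
  with r show ?thesis by simp
qed

text \<open>The case \<gamma> = 0, which makes \<open>eigenpair_point_bound\<close> available for
  Hermite functions.\<close>

lemma hermite_eigenpair: "osc_eigenpair b 0 (of_real (2 * real k + 1)) (hermite k) (hermite_deriv k)"
  unfolding osc_eigenpair_def
proof (intro conjI allI impI osc_pair_hermite)
  fix f g assume f: "osc_pair f g"
  have "cnj (osc_energy f g (hermite k) (hermite_deriv k)) = cnj (of_real (2 * real k + 1) * L2_inner f (hermite k))"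
    unfolding osc_energy_hermite[OF f] ..
  then show "osc_energy (hermite k) (hermite_deriv k) f g +
      \<i> * of_real 0 * (hermite k b * cnj (f b) - hermite k (- b) * cnj (f (- b))) =
      of_real (2 * real k + 1) * L2_inner (hermite k) f"
    by (simp add: osc_energy_cnj L2_inner_cnj)
qed simp

lemma hermite_point_bound:
  assumes b: "b > 0"
  shows "\<exists>M>0. \<forall>k. (cmod (hermite k b))\<^sup>2 \<le> M / sqrt (2 * real k + 1)"
proof -
  obtain K :: nat where K: "16 * b\<^sup>2 \<le> real K" using real_arch_simple by blast
  \<comment> \<open>The energy estimate covers every k \<ge> K with the constant 32; the sum absorbs
    the finitely many smaller indices.\<close>
  define M where "M = 32 + (\<Sum>k<K. (cmod (hermite k b))\<^sup>2 * sqrt (2 * real k + 1))"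
  have sum0: "0 \<le> (\<Sum>k<K. (cmod (hermite k b))\<^sup>2 * sqrt (2 * real k + 1))" by (intro sum_nonneg) auto
  have "(cmod (hermite k b))\<^sup>2 \<le> M / sqrt (2 * real k + 1)" for k
  proof (cases "k < K")
    case True
    have "(cmod (hermite k b))\<^sup>2 * sqrt (2 * real k + 1) \<le> (\<Sum>k<K. (cmod (hermite k b))\<^sup>2 * sqrt (2 * real k + 1))"
      by (rule member_le_sum) (use True in auto)
    then have "(cmod (hermite k b))\<^sup>2 * sqrt (2 * real k + 1) \<le> M" by (simp add: M_def)
    then show ?thesis by (simp add: pos_le_divide_eq)
  next
    case False
    then have "(cmod (hermite k b))\<^sup>2 \<le> 32 / sqrt (2 * real k + 1)"
      using eigenpair_point_bound[OF hermite_eigenpair[of b k] b] K by simp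
    also have "\<dots> \<le> M / sqrt (2 * real k + 1)" using sum0 by (intro divide_right_mono) (auto simp: M_def)
    finally show ?thesis .
  qed
  moreover have "M > 0" using sum0 by (simp add: M_def)
  ultimately show ?thesis by blast
qed

section \<open>Summation over the Hermite levels\<close>

lemma sum_distance_powers_bounded:
  "\<exists>Z>0. \<forall>K n. (\<Sum>k\<in>{..<K} - {n}. 1 / (\<bar>real k - real n\<bar> * sqrt \<bar>real k - real n\<bar>)) \<le> Z"
proof -
  define t where "t = (\<lambda>j::nat. 1 / (real j * sqrt (real j)))"
  have t0: "t j \<ge> 0" for j by (simp add: t_def)
  have tj: "real j powr (- 3 / 2) = t j" if "j \<ge> 1" for j
  proof -
    have "real j powr (1 + 1 / 2) = real j powr 1 * real j powr (1 / 2)" by (rule powr_add)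
    also have "\<dots> = real j * sqrt (real j)" by (simp only: powr_half_sqrt of_nat_0_le_iff powr_one)
    finally have e: "real j powr (1 + 1 / 2) = real j * sqrt (real j)" .
    have "real j powr (- 3 / 2) = real j powr (- (1 + 1 / 2))" by (rule arg_cong) simp
    also have "\<dots> = inverse (real j powr (1 + 1 / 2))" by (rule powr_minus)
    also have "\<dots> = t j" by (simp only: e t_def inverse_eq_divide)
    finally show ?thesis .
  qed
  have "\<forall>\<^sub>F j in sequentially. real j powr (- 3 / 2) = t j"
    using tj by (intro eventually_sequentiallyI[of 1])
  from summable_cong[OF this] have sm: "summable t" by (simp add: summable_real_powr_iff)
  have part: "(\<Sum>k\<in>A. t (\<phi> k)) \<le> suminf t" if "finite A" "inj_on \<phi> A" for A :: "nat set" and \<phi>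
  proof -
    have "(\<Sum>k\<in>A. t (\<phi> k)) = sum t (\<phi> ` A)" using that(2) by (simp add: sum.reindex)
    also have "\<dots> \<le> suminf t" by (rule sum_le_suminf[OF sm]) (use that t0 in auto)
    finally show ?thesis .
  qed
  have "(\<Sum>k\<in>{..<K} - {n}. 1 / (\<bar>real k - real n\<bar> * sqrt \<bar>real k - real n\<bar>)) \<le> 2 * suminf t + 1" for K n
  proof -
    \<comment> \<open>The larger range includes k = n, whose term is 1 / 0 = 0.\<close>
    have "(\<Sum>k\<in>{..<K} - {n}. 1 / (\<bar>real k - real n\<bar> * sqrt \<bar>real k - real n\<bar>))
      \<le> (\<Sum>k\<in>{..<n} \<union> {n..<n+K}. 1 / (\<bar>real k - real n\<bar> * sqrt \<bar>real k - real n\<bar>))"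
      by (rule sum_mono2) auto
    also have "\<dots> = (\<Sum>k\<in>{..<n}. 1 / (\<bar>real k - real n\<bar> * sqrt \<bar>real k - real n\<bar>))
       + (\<Sum>k\<in>{n..<n+K}. 1 / (\<bar>real k - real n\<bar> * sqrt \<bar>real k - real n\<bar>))"
      by (rule sum.union_disjoint) auto
    also have "(\<Sum>k\<in>{..<n}. 1 / (\<bar>real k - real n\<bar> * sqrt \<bar>real k - real n\<bar>)) = (\<Sum>k\<in>{..<n}. t (n - k))"
      by (intro sum.cong) (auto simp: t_def of_nat_diff)
    also have "\<dots> \<le> suminf t" by (rule part) (auto simp: inj_on_def)
    also have "(\<Sum>k\<in>{n..<n+K}. 1 / (\<bar>real k - real n\<bar> * sqrt \<bar>real k - real n\<bar>)) = (\<Sum>k\<in>{n..<n+K}. t (k - n))"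
      by (intro sum.cong) (auto simp: t_def of_nat_diff)
    also have "\<dots> \<le> suminf t" by (rule part) (auto simp: inj_on_def)
    finally show ?thesis by simp
  qed
  moreover have "2 * suminf t + 1 > 0" using suminf_nonneg[OF sm t0] by simp
  ultimately show ?thesis by blast
qed

text \<open>With D = |2 k + 1 - \<lambda>| \<ge> d, two regimes give the same factor sqrt \<lambda>
  / 2. If 2 k + 1 \<ge> \<lambda> / 4, it comes from sqrt (2 k + 1), and D^2 dominates d^(3/2). For
  smaller k that root is too small, but then D \<ge> \<lambda> / 4, so sqrt D supplies the factor
  and D^(3/2) remains.\<close>

lemma weight_distance_bound:
  fixes l :: real
  assumes l: "l > 0" and n: "\<bar>2 * real n + 1 - l\<bar> \<le> 1" and "k \<noteq> n"
  defines "d \<equiv> \<bar>real k - real n\<bar>"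
  shows "sqrt l / 2 * (d * sqrt d) \<le> sqrt (2 * real k + 1) * (2 * real k + 1 - l)\<^sup>2"
proof -
  define D where "D = \<bar>2 * real k + 1 - l\<bar>"
  have d1: "d \<ge> 1" using assms(3) unfolding d_def by linarith
  have Dd: "D \<ge> d" using n d1 unfolding D_def d_def by linarith
  have D2: "(2 * real k + 1 - l)\<^sup>2 = D * D" unfolding D_def by (simp add: power2_eq_square flip: abs_mult)
  have sd: "sqrt d \<le> d" using d1 real_sqrt_le_mono[of d "d * d"] by (simp add: mult_le_cancel_left1 del: real_sqrt_le_iff)
  show ?thesis
  proof (cases "2 * real k + 1 \<ge> l / 4")
    case True
    have "sqrt l / 2 = sqrt (l / 4)" by (simp add: real_sqrt_divide)
    also have "\<dots> \<le> sqrt (2 * real k + 1)" using True by simp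
    finally have "sqrt l / 2 \<le> sqrt (2 * real k + 1)" .
    moreover have "d * sqrt d \<le> D * D" using Dd sd d1 by (intro mult_mono) auto
    ultimately show ?thesis unfolding D2 by (rule mult_mono) (use d1 in auto)
  next
    case False
    then have "l / 4 \<le> D" unfolding D_def using l by linarith
    have "sqrt l / 2 = sqrt (l / 4)" by (simp add: real_sqrt_divide)
    also have "\<dots> \<le> sqrt D" using \<open>l / 4 \<le> D\<close> by simp
    finally have a: "sqrt l / 2 \<le> sqrt D" .
    have "sqrt l / 2 * (d * sqrt d) \<le> sqrt D * (D * sqrt D)"
      using a Dd d1 l by (intro mult_mono) auto
    also have "\<dots> = 1 * (D * D)" using Dd d1 by (simp add: mult.left_commute)
    also have "\<dots> \<le> sqrt (2 * real k + 1) * (D * D)" by (intro mult_right_mono) auto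
    finally show ?thesis unfolding D2 .
  qed
qed

text \<open>Hermite functions have a parity, so with \<open>c\<close> the n-th coefficient and \<open>r\<close> the remainder of \<open>f\<close>,
  orthogonality gives \<open>|c|^2 = |<r, r (- x)>|\<close>, which is at most the squared norm of \<open>r\<close>.\<close>

lemma reflect_orthogonal_half_mass:
  assumes f: "osc_pair f g" and orth: "L2_inner f (\<lambda>x. f (- x)) = 0"
  shows "2 * (cmod (L2_inner f (hermite n)))\<^sup>2 \<le> L2_sq f"
proof -
  define c where "c = L2_inner f (hermite n)"
  define r where "r = (\<lambda>x. f x + (- c) * hermite n x)"
  note rem = hermite_component_removal[OF f, of n, folded c_def, folded r_def]
  have rL2: "r \<in> L2_fun" using rem(1) by (rule osc_pairD)
  let ?s = "(-1) ^ n :: complex"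
  have fr: "f = (\<lambda>x. r x + c * hermite n x)" by (simp add: r_def)
  have fr': "(\<lambda>x. f (- x)) = (\<lambda>x. r (- x) + (c * ?s) * hermite n x)"
    unfolding fun_eq_iff by (subst fr) (simp add: hermite_reflect)
  have rh: "L2_inner r (hermite n) = 0" using rem(2)[of n] by simp
  have "L2_inner (hermite n) (\<lambda>x. r (- x)) = L2_inner (\<lambda>x. hermite n (- x)) r"
    using L2_inner_reflect[of "hermite n" "\<lambda>x. r (- x)"] by simp
  also have "\<dots> = ?s * cnj (L2_inner r (hermite n))"
    unfolding hermite_reflect L2_inner_scale_left L2_inner_cnj ..
  finally have hr: "L2_inner (hermite n) (\<lambda>x. r (- x)) = 0" using rh by simp
  have "0 = L2_inner (\<lambda>x. r x + c * hermite n x) (\<lambda>x. r (- x) + (c * ?s) * hermite n x)"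
    using orth fr fr' by metis
  also have "\<dots> = L2_inner r (\<lambda>x. r (- x)) + c * cnj (c * ?s)"
    by (simp add: L2_inner_add_left L2_inner_add_right L2_fun_add L2_fun_scale L2_fun_reflect rL2 L2_inner_scale_left
        L2_inner_scale_right rh hr hermite_orthonormal del: complex_cnj_mult)
  also have "c * cnj (c * ?s) = ?s * of_real ((cmod c)\<^sup>2)"
    unfolding complex_norm_square by simp
  finally have "L2_inner r (\<lambda>x. r (- x)) = - (?s * of_real ((cmod c)\<^sup>2))"
    by (simp add: eq_neg_iff_add_eq_0)
  then have re: "\<bar>Re (L2_inner r (\<lambda>x. r (- x)))\<bar> = (cmod c)\<^sup>2"
    by (cases "even n") auto
  have rr: "L2_sq (\<lambda>x. r (- x)) = L2_sq r" by (rule L2_sq_reflect)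
  \<comment> \<open>The sign of the real part in \<open>re\<close> depends on the parity of
    \<open>n\<close>, so the squares of both the sum and the difference of r and its reflection are
    used.\<close>
  have "0 \<le> L2_sq (\<lambda>x. r x + r (- x))" by simp
  also have "\<dots> = 2 * L2_sq r + 2 * Re (L2_inner r (\<lambda>x. r (- x)))"
    unfolding L2_sq_add[OF rL2 L2_fun_reflect[OF rL2]] rr by simp
  finally have 1: "- L2_sq r \<le> Re (L2_inner r (\<lambda>x. r (- x)))" by simp
  have "0 \<le> L2_sq (\<lambda>x. r x + (-1) * r (- x))" by simp
  also have "\<dots> = 2 * L2_sq r - 2 * Re (L2_inner r (\<lambda>x. r (- x)))"
    unfolding L2_sq_add[OF rL2 L2_fun_scale[OF L2_fun_reflect[OF rL2]]] L2_sq_scale rr L2_inner_scale_right by simp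
  finally have "(cmod c)\<^sup>2 \<le> L2_sq r" using 1 re by simp
  then show ?thesis using rem(3) by (simp add: c_def)
qed

lemma nonreal_eigenvalue_location:
  assumes b: "b > 0"
  shows "\<exists>A>0. \<forall>\<gamma> \<mu> f g. osc_eigenpair b \<gamma> \<mu> f g \<longrightarrow> Im \<mu> \<noteq> 0 \<longrightarrow> Re \<mu> \<le> A * (1 + \<gamma>\<^sup>2)"
proof -
  obtain M where M: "M > 0" "\<And>k. (cmod (hermite k b))\<^sup>2 \<le> M / sqrt (2 * real k + 1)"
    using hermite_point_bound[OF b] by blast
  obtain Z where Z: "Z > 0"
    "\<And>K n. (\<Sum>k\<in>{..<K} - {n}. 1 / (\<bar>real k - real n\<bar> * sqrt \<bar>real k - real n\<bar>)) \<le> Z"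
    using sum_distance_powers_bounded by blast
  \<comment> \<open>16 b^2 meets the hypothesis of \<open>eigenpair_point_bound\<close>, and 4096 =
    64^2 gives 64 |\<gamma>| \<le> sqrt \<lambda>. The final comparison is 3/8 \<lambda> \<le> 512 M
    Z \<gamma>^2, which 2048 M Z contradicts.\<close>
  define A where "A = 16 * b\<^sup>2 + 4096 + 2048 * M * Z"
  have "0 < 2048 * M * Z" using M(1) Z(1) by simp
  then have A0: "A > 0" unfolding A_def using zero_le_power2[of b] by linarith
  have "Re \<mu> \<le> A * (1 + \<gamma>\<^sup>2)" if ep: "osc_eigenpair b \<gamma> \<mu> f g" and nr: "Im \<mu> \<noteq> 0" for \<gamma> \<mu> f g
  proof (rule ccontr)
    assume "\<not> ?thesis"
    then have big: "Re \<mu> > A * (1 + \<gamma>\<^sup>2)" by simp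
    define l where "l = Re \<mu>"
    define s where "s = sqrt l"
    define N where "N = L2_sq f"
    have fg: "osc_pair f g" and N0: "N > 0" using osc_eigenpairD[OF ep] by (auto simp: N_def)
    have MZ: "M * Z > 0" using M Z by simp
    have g2: "0 \<le> \<gamma>\<^sup>2" "0 \<le> b\<^sup>2 * \<gamma>\<^sup>2" "0 \<le> M * Z * \<gamma>\<^sup>2" "0 \<le> b\<^sup>2" using MZ by auto
    have expand: "A * (1 + \<gamma>\<^sup>2) = 16 * b\<^sup>2 + 4096 + 2048 * (M * Z) + 16 * (b\<^sup>2 * \<gamma>\<^sup>2) + 4096 * \<gamma>\<^sup>2 + 2048 * (M * Z * \<gamma>\<^sup>2)"
      by (simp add: A_def algebra_simps)
    have l1: "16 * b\<^sup>2 \<le> l" and l2: "4096 * \<gamma>\<^sup>2 < l" and l3: "2048 * (M * Z * \<gamma>\<^sup>2) < l" and l0: "l > 0"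
      using big g2 MZ unfolding expand l_def by linarith+
    have s0: "s > 0" and ss: "s * s = l" using l0 by (auto simp: s_def)
    have "sqrt (4096 * \<gamma>\<^sup>2) \<le> s" unfolding s_def using l2 by (intro real_sqrt_le_mono) simp
    moreover have "sqrt (4096 * \<gamma>\<^sup>2) = 64 * \<bar>\<gamma>\<bar>"
      using real_sqrt_mult[of "64\<^sup>2" "\<gamma>\<^sup>2"] by simp
    ultimately have gs: "64 * \<bar>\<gamma>\<bar> \<le> s" by simp
    define n where "n = \<bar>Im \<mu>\<bar>"
    have pb1: "(cmod (f b))\<^sup>2 \<le> 32 * (1 + n) / s * N"
      using eigenpair_point_bound[OF ep b] l1 by (simp add: l_def s_def n_def N_def)
    have pb2: "(cmod (f (- b)))\<^sup>2 \<le> 32 * (1 + n) / s * N"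
      using eigenpair_point_bound[OF osc_eigenpair_reflect[OF ep] b] l1
      by (simp add: l_def s_def n_def N_def L2_sq_reflect)
    \<comment> \<open>The imaginary part is bounded by point values whose own bound contains it. The
      factor |\<gamma>| / s \<le> 1/64 turns this into n \<le> (1 + n) / 2.\<close>
    have "n * N = \<bar>Im \<mu> * L2_sq f\<bar>" using N0 by (simp add: abs_mult n_def N_def)
    also have "\<dots> = \<bar>\<gamma>\<bar> * \<bar>(cmod (f b))\<^sup>2 - (cmod (f (- b)))\<^sup>2\<bar>"
      unfolding osc_eigenpair_real_part(2)[OF ep, symmetric] by (simp add: abs_mult)
    also have "\<dots> \<le> \<bar>\<gamma>\<bar> * (32 * (1 + n) / s * N)"
    proof (intro mult_left_mono)
      show "\<bar>(cmod (f b))\<^sup>2 - (cmod (f (- b)))\<^sup>2\<bar> \<le> 32 * (1 + n) / s * N"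
        using pb1 pb2 zero_le_power2[of "cmod (f b)"] zero_le_power2[of "cmod (f (- b))"] by linarith
    qed simp
    also have "\<dots> = (64 * \<bar>\<gamma>\<bar>) * ((1 + n) * N / (2 * s))" by simp
    also have "\<dots> \<le> s * ((1 + n) * N / (2 * s))"
      using gs N0 s0 by (intro mult_right_mono) (auto simp: n_def)
    also have "\<dots> = (1 + n) / 2 * N" using s0 by simp
    finally have "n \<le> (1 + n) / 2" using N0 by simp
    then have n1: "n \<le> 1" by simp
    then have "32 * (1 + n) / s * N \<le> 64 / s * N"
      using s0 N0 by (intro mult_right_mono divide_right_mono) auto
    then have p1: "(cmod (f b))\<^sup>2 \<le> 64 / s * N" and p2: "(cmod (f (- b)))\<^sup>2 \<le> 64 / s * N" using pb1 pb2 by auto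
    \<comment> \<open>2 m + 1 lies within 1 of \<lambda>; this level is left to the reflection
      argument.\<close>
    define m where "m = nat \<lfloor>l / 2\<rfloor>"
    have "real m = of_int \<lfloor>l / 2\<rfloor>" using l0 by (simp add: m_def)
    then have m: "\<bar>2 * real m + 1 - l\<bar> \<le> 1" by linarith
    define c where "c = (\<lambda>k. (cmod (L2_inner f (hermite k)))\<^sup>2)"
    have ck: "c k \<le> 512 * \<gamma>\<^sup>2 * M * N / l * (1 / (\<bar>real k - real m\<bar> * sqrt \<bar>real k - real m\<bar>))" if km: "k \<noteq> m" for k
    proof -
      define d where "d = \<bar>real k - real m\<bar>"
      define w where "w = f b * cnj (hermite k b) - f (- b) * cnj (hermite k (- b))"
      have d0: "d * sqrt d > 0" using km by (auto simp: d_def)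
      have q: "sqrt (2 * real k + 1) > 0" by simp
      have "of_real (2 * real k + 1) * L2_inner f (hermite k) + \<i> * of_real \<gamma> * w = \<mu> * L2_inner f (hermite k)"
        using osc_eigenpairD(3)[OF ep osc_pair_hermite[of k]] unfolding osc_energy_hermite[OF fg] w_def .
      then have "(\<mu> - of_real (2 * real k + 1)) * L2_inner f (hermite k) = \<i> * of_real \<gamma> * w"
        by (simp add: algebra_simps)
      then have "cmod ((\<mu> - of_real (2 * real k + 1)) * L2_inner f (hermite k)) = cmod (\<i> * of_real \<gamma> * w)" by simp
      then have "(cmod (\<mu> - of_real (2 * real k + 1)))\<^sup>2 * c k = \<gamma>\<^sup>2 * (cmod w)\<^sup>2"
        unfolding c_def norm_mult by (metis power_mult_distrib mult_1 norm_ii norm_of_real power2_abs)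
      moreover have "(2 * real k + 1 - l)\<^sup>2 \<le> (cmod (\<mu> - of_real (2 * real k + 1)))\<^sup>2"
        using abs_Re_le_cmod[of "\<mu> - of_real (2 * real k + 1)"]
        unfolding l_def by (simp add: abs_le_square_iff[symmetric])
      ultimately have "(2 * real k + 1 - l)\<^sup>2 * c k \<le> \<gamma>\<^sup>2 * (cmod w)\<^sup>2"
        by (metis c_def mult_right_mono zero_le_power2)
      also have "(cmod w)\<^sup>2 \<le> 2 * ((cmod (f b))\<^sup>2 * (cmod (hermite k b))\<^sup>2) + 2 * ((cmod (f (- b)))\<^sup>2 * (cmod (hermite k b))\<^sup>2)"
      proof -
        have hb: "cmod (hermite k (- b)) = cmod (hermite k b)" by (simp add: hermite_reflect norm_mult norm_power)
        have "cmod w \<le> cmod (f b) * cmod (hermite k b) + cmod (f (- b)) * cmod (hermite k b)"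
          unfolding w_def by (rule order_trans[OF norm_triangle_ineq4]) (simp add: norm_mult hb)
        then have "(cmod w)\<^sup>2 \<le> (cmod (f b) * cmod (hermite k b) + cmod (f (- b)) * cmod (hermite k b))\<^sup>2"
          by (rule power_mono) simp
        also have "\<dots> \<le> 2 * (cmod (f b) * cmod (hermite k b))\<^sup>2 + 2 * (cmod (f (- b)) * cmod (hermite k b))\<^sup>2"
          using zero_le_power2[of "cmod (f b) * cmod (hermite k b) - cmod (f (- b)) * cmod (hermite k b)"]
          unfolding power2_sum power2_diff by simp
        finally show ?thesis by (simp add: power_mult_distrib)
      qed
      also have "\<dots> \<le> 2 * (64 / s * N * (M / sqrt (2 * real k + 1))) + 2 * (64 / s * N * (M / sqrt (2 * real k + 1)))"
        using p1 p2 M(2)[of k] s0 N0 by (intro add_mono mult_left_mono mult_mono) auto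
      also have "\<dots> = 256 * M * N / s / sqrt (2 * real k + 1)" by simp
      finally have "(2 * real k + 1 - l)\<^sup>2 * c k \<le> \<gamma>\<^sup>2 * (256 * M * N / s / sqrt (2 * real k + 1))"
        by (simp add: mult_left_mono)
      then have "sqrt (2 * real k + 1) * ((2 * real k + 1 - l)\<^sup>2 * c k)
          \<le> sqrt (2 * real k + 1) * (\<gamma>\<^sup>2 * (256 * M * N / s / sqrt (2 * real k + 1)))"
        by (rule mult_left_mono) simp
      also have "\<dots> = 256 * \<gamma>\<^sup>2 * M * N / s" using q by (simp add: less_imp_neq[symmetric])
      finally have u: "sqrt (2 * real k + 1) * (2 * real k + 1 - l)\<^sup>2 * c k \<le> 256 * \<gamma>\<^sup>2 * M * N / s"
        by (simp add: mult.assoc)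
      have "s / 2 * (d * sqrt d) * c k \<le> sqrt (2 * real k + 1) * (2 * real k + 1 - l)\<^sup>2 * c k"
        using weight_distance_bound[OF l0 m km] unfolding s_def d_def
        by (rule mult_right_mono) (simp add: c_def)
      with u have "s / 2 * (d * sqrt d) * c k \<le> 256 * \<gamma>\<^sup>2 * M * N / s" by linarith
      then have "c k * (s / 2 * (d * sqrt d)) \<le> 256 * \<gamma>\<^sup>2 * M * N / s" by (simp only: mult.commute)
      then have "c k \<le> 256 * \<gamma>\<^sup>2 * M * N / s / (s / 2 * (d * sqrt d))"
        by (rule mult_imp_le_div_pos[rotated]) (use s0 d0 in simp)
      also have "\<dots> = 512 * \<gamma>\<^sup>2 * M * N / (s * s) * (1 / (d * sqrt d))" by simp
      finally show ?thesis unfolding ss d_def .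
    qed
    \<comment> \<open>\<open>Suc m\<close> keeps level m inside the sum. Since the energy is at most
      \<lambda> N, K \<ge> 4 \<lambda> leaves at most N / 8 of the mass beyond the first K
      levels.\<close>
    define K where "K = max (Suc m) (nat \<lceil>4 * l\<rceil>)"
    have Km: "m < K" and K4: "4 * l \<le> real K" by (auto simp: K_def) linarith
    have "(2 * real K + 1) * (N - (\<Sum>k<K. c k)) \<le> l * N"
      using hermite_tail_inequality[OF fg, of K] osc_eigenpair_real_part(1)[OF ep] by (simp add: c_def N_def l_def)
    moreover have "l * N \<le> (2 * real K + 1) * (N / 8)"
      using K4 N0 l0 mult_right_mono[of "8 * l" "2 * real K + 1" "N / 8"] by simp
    ultimately have "(2 * real K + 1) * (N - (\<Sum>k<K. c k)) \<le> (2 * real K + 1) * (N / 8)" by linarith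
    then have "N - (\<Sum>k<K. c k) \<le> N / 8" by simp
    moreover have "(\<Sum>k<K. c k) = c m + (\<Sum>k\<in>{..<K} - {m}. c k)"
      using Km by (intro sum.remove) auto
    moreover have "2 * c m \<le> N"
      using reflect_orthogonal_half_mass[OF fg osc_eigenpair_reflect_orthogonal[OF ep nr], of m]
      by (simp add: c_def N_def)
    \<comment> \<open>3/8 = 1 - 1/8 - 1/2: the total mass minus the tail and minus level m.\<close>
    ultimately have "3 / 8 * N \<le> (\<Sum>k\<in>{..<K} - {m}. c k)" by simp
    also have "\<dots> \<le> (\<Sum>k\<in>{..<K} - {m}. 512 * \<gamma>\<^sup>2 * M * N / l * (1 / (\<bar>real k - real m\<bar> * sqrt \<bar>real k - real m\<bar>)))"
      by (intro sum_mono ck) auto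
    also have "\<dots> \<le> 512 * \<gamma>\<^sup>2 * M * N / l * Z"
      unfolding sum_distrib_left[symmetric] using M(1) N0 l0 by (intro mult_left_mono Z(2)) auto
    finally have "3 / 8 * N * l \<le> 512 * \<gamma>\<^sup>2 * M * N * Z" using l0 by (simp add: field_simps)
    then have "(3 / 8 * l) * N \<le> (512 * (M * Z * \<gamma>\<^sup>2)) * N" by (simp add: mult_ac)
    then have "3 / 8 * l \<le> 512 * (M * Z * \<gamma>\<^sup>2)" using N0 by (simp only: mult_le_cancel_right_pos)
    with l3 l0 show False by simp
  qed
  with A0 show ?thesis by blast
qed

section \<open>Counting eigenvalues\<close>

text \<open>Continuity upgrades zero norm to vanishing everywhere. The form involves the values at
  \<open>b\<close> and \<open>- b\<close>, for which vanishing almost everywhere says nothing by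
  itself.\<close>

lemma osc_pair_AE_zero_imp_zero:
  assumes f: "osc_pair f g" and zero: "L2_sq f = 0"
  shows "f x = 0"
proof (rule ccontr)
  assume nz: "f x \<noteq> 0"
  have "continuous_on UNIV f" by (rule has_ac_deriv_continuous[OF osc_pairD(4)[OF f]])
  then have "isCont f x" by (simp add: continuous_on_eq_continuous_at)
  then obtain e where e: "e > 0" "\<And>y. dist x y < e \<Longrightarrow> f y \<noteq> 0"
    using continuous_at_avoid[of x f 0] nz by auto
  have "AE y in lborel. f y = 0" using zero L2_sq_eq_0_iff[OF osc_pairD(1)[OF f]] by simp
  then have "AE y in lborel. y \<notin> {x..x + e / 2}"
    by eventually_elim (use e in \<open>auto simp: dist_real_def\<close>)
  then have "{x..x + e / 2} \<in> null_sets lborel" by (subst AE_iff_null_sets) auto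
  then show False using e(1) by (auto simp: null_sets_def)
qed

lemma osc_energy_sum_left:
  assumes "\<And>i. i \<in> I \<Longrightarrow> osc_pair (f i) (g i)" "osc_pair h k"
  shows "osc_energy (\<lambda>x. \<Sum>i\<in>I. c i * f i x) (\<lambda>x. \<Sum>i\<in>I. c i * g i x) h k = (\<Sum>i\<in>I. c i * osc_energy (f i) (g i) h k)"
  using assms(1)
proof (induction I rule: infinite_finite_induct)
  case (insert j I)
  have fj: "osc_pair (f j) (g j)" using insert.prems by simp
  have "osc_pair (\<lambda>x. \<Sum>i\<in>I. c i * f i x) (\<lambda>x. \<Sum>i\<in>I. c i * g i x)"
    using insert.prems by (intro osc_pair_sum) auto
  from osc_energy_add_left[OF osc_pair_scale[OF fj] this assms(2)] insert show ?case
    by (simp add: osc_energy_scale_left)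
qed (simp_all add: osc_energy_def)

lemma eigenpair_combination:
  assumes ep: "\<And>i. i \<in> I \<Longrightarrow> osc_eigenpair b \<gamma> (\<mu> i) (f i) (g i)" and h: "osc_pair h k"
  shows "osc_energy (\<lambda>x. \<Sum>i\<in>I. c i * f i x) (\<lambda>x. \<Sum>i\<in>I. c i * g i x) h k
      + \<i> * of_real \<gamma> * ((\<Sum>i\<in>I. c i * f i b) * cnj (h b) - (\<Sum>i\<in>I. c i * f i (- b)) * cnj (h (- b)))
    = L2_inner (\<lambda>x. \<Sum>i\<in>I. (c i * \<mu> i) * f i x) h"
proof -
  have "L2_inner (\<lambda>x. \<Sum>i\<in>I. (c i * \<mu> i) * f i x) h = (\<Sum>i\<in>I. c i * (\<mu> i * L2_inner (f i) h))"
    by (subst L2_inner_sum_left) (auto simp: mult.assoc intro: osc_pairD(1)[OF osc_eigenpairD(1)[OF ep]] osc_pairD(1)[OF h])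
  also have "\<dots> = (\<Sum>i\<in>I. c i * (osc_energy (f i) (g i) h k + \<i> * of_real \<gamma> * (f i b * cnj (h b) - f i (- b) * cnj (h (- b)))))"
    using osc_eigenpairD(3)[OF ep h] by simp
  also have "\<dots> = (\<Sum>i\<in>I. c i * osc_energy (f i) (g i) h k)
      + \<i> * of_real \<gamma> * ((\<Sum>i\<in>I. c i * f i b) * cnj (h b) - (\<Sum>i\<in>I. c i * f i (- b)) * cnj (h (- b)))"
    by (simp add: sum.distrib sum_subtractf sum_distrib_left sum_distrib_right algebra_simps)
  also have "(\<Sum>i\<in>I. c i * osc_energy (f i) (g i) h k) =
      osc_energy (\<lambda>x. \<Sum>i\<in>I. c i * f i x) (\<lambda>x. \<Sum>i\<in>I. c i * g i x) h k"
    by (rule osc_energy_sum_left[symmetric]) (use osc_eigenpairD(1)[OF ep] h in auto)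
  finally show ?thesis by simp
qed

text \<open>Elimination of the last coefficient in weak form. Let p be the vanishing combination and
  q the one with coefficients \<open>c i * \<mu> i\<close>. The form of p against q is 0 and equals
  |q|^2, so q = 0 as well, and q - \<mu> n p is a shorter relation.\<close>

lemma eigenpairs_independent:
  fixes n :: nat
  assumes ep: "\<And>i. i < n \<Longrightarrow> osc_eigenpair b \<gamma> (\<mu> i) (f i) (g i)" and inj: "inj_on \<mu> {..<n}"
    and zero: "L2_sq (\<lambda>x. \<Sum>i<n. c i * f i x) = 0"
  shows "\<forall>i<n. c i = 0"
  using assms
proof (induction n arbitrary: c)
  case (Suc n)
  let ?p = "\<lambda>x. \<Sum>i<Suc n. c i * f i x" and ?p' = "\<lambda>x. \<Sum>i<Suc n. c i * g i x"
  let ?q = "\<lambda>x. \<Sum>i<Suc n. (c i * \<mu> i) * f i x"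
  have fp: "osc_pair (f i) (g i)" if "i < Suc n" for i using Suc.prems(1)[OF that] by (rule osc_eigenpairD)
  have p: "osc_pair ?p ?p'" using fp by (intro osc_pair_sum) auto
  have q: "osc_pair ?q (\<lambda>x. \<Sum>i<Suc n. (c i * \<mu> i) * g i x)" using fp by (intro osc_pair_sum) auto
  have p0: "?p x = 0" for x by (rule osc_pair_AE_zero_imp_zero[OF p Suc.prems(3)])
  have "osc_pair (\<lambda>x. 0) ?p'" using p unfolding p0 .
  then have "AE x in lborel. ?p' x = 0" by (intro ac_deriv_of_const_AE[of 0]) (rule osc_pairD(4))
  then have p'0: "L2_sq ?p' = 0" using L2_sq_eq_0_iff[OF osc_pairD(3)[OF p]] by simp
  have "L2_inner ?q ?q = osc_energy ?p ?p' ?q (\<lambda>x. \<Sum>i<Suc n. (c i * \<mu> i) * g i x)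
      + \<i> * of_real \<gamma> * (?p b * cnj (?q b) - ?p (- b) * cnj (?q (- b)))"
    by (rule eigenpair_combination[OF _ q, symmetric]) (use Suc.prems(1) in auto)
  also have "\<dots> = L2_inner ?p' (\<lambda>x. \<Sum>i<Suc n. (c i * \<mu> i) * g i x)"
    unfolding p0 osc_energy_def by simp
  also have "\<dots> = cnj (L2_inner (\<lambda>x. \<Sum>i<Suc n. (c i * \<mu> i) * g i x) ?p')" by (simp only: L2_inner_cnj)
  also have "\<dots> = 0" using L2_inner_AE_zero[OF osc_pairD(3)[OF p] osc_pairD(3)[OF q] p'0] by simp
  finally have "L2_sq ?q = 0" unfolding L2_inner_self by simp
  then have q0: "?q x = 0" for x by (rule osc_pair_AE_zero_imp_zero[OF q])
  have "(\<Sum>i<n. (c i * (\<mu> i - \<mu> n)) * f i x) = 0" for x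
  proof -
    have "?q x - \<mu> n * ?p x = (\<Sum>i<n. (c i * (\<mu> i - \<mu> n)) * f i x)"
      by (simp add: sum_distrib_left sum_subtractf[symmetric] algebra_simps)
    then show ?thesis using p0 q0 by simp
  qed
  then have z: "L2_sq (\<lambda>x. \<Sum>i<n. (c i * (\<mu> i - \<mu> n)) * f i x) = 0" by (simp add: L2_sq_def)
  have IH: "\<forall>i<n. c i * (\<mu> i - \<mu> n) = 0"
    by (rule Suc.IH[OF _ _ z]) (use Suc.prems(1,2) in \<open>auto simp: inj_on_def\<close>)
  have low: "c i = 0" if "i < n" for i
  proof -
    have "\<mu> i \<noteq> \<mu> n" using Suc.prems(2) that by (auto simp: inj_on_def)
    then show ?thesis using IH that by auto
  qed
  then have "?p x = c n * f n x" for x by simp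
  then have "(cmod (c n))\<^sup>2 * L2_sq (f n) = 0" using Suc.prems(3) by (simp add: L2_sq_scale)
  then have "c n = 0" using osc_eigenpairD(2)[OF Suc.prems(1)[of n]] by simp
  then show ?case using low by (auto simp: less_Suc_eq)
qed simp

section \<open>Orthogonal projection and Bessel's inequality\<close>

lemma L2_projection_exists:
  fixes n :: nat
  assumes "\<And>i. i < n \<Longrightarrow> f i \<in> L2_fun" "u \<in> L2_fun"
  shows "\<exists>s. \<forall>i<n. L2_inner (\<lambda>x. u x + (\<Sum>j<n. s j * f j x)) (f i) = 0"
  using assms
proof (induction n arbitrary: u)
  case (Suc n)
  have fL2: "f i \<in> L2_fun" if "i < Suc n" for i using Suc.prems(1)[OF that] .
  \<comment> \<open>\<open>f n\<close> is first made orthogonal to the earlier functions. A multiple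
    of the result \<open>?r\<close> can then be added to \<open>?v\<close> without disturbing the
    orthogonality that \<open>?v\<close> already has.\<close>
  obtain t where t: "\<And>i. i < n \<Longrightarrow> L2_inner (\<lambda>x. f n x + (\<Sum>j<n. t j * f j x)) (f i) = 0"
    using Suc.IH[OF _ fL2[of n]] fL2 by (metis less_Suc_eq)
  obtain s where s: "\<And>i. i < n \<Longrightarrow> L2_inner (\<lambda>x. u x + (\<Sum>j<n. s j * f j x)) (f i) = 0"
    using Suc.IH[OF _ Suc.prems(2)] fL2 by (metis less_Suc_eq)
  let ?r = "\<lambda>x. f n x + (\<Sum>j<n. t j * f j x)" and ?v = "\<lambda>x. u x + (\<Sum>j<n. s j * f j x)"
  have sumL2: "(\<lambda>x. \<Sum>j<n. d j * f j x) \<in> L2_fun" for d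
    using fL2 by (intro L2_fun_sum L2_fun_scale) auto
  have r: "?r \<in> L2_fun" and v: "?v \<in> L2_fun" using sumL2 fL2 Suc.prems(2) by (auto intro: L2_fun_add)
  have to_fn: "L2_inner h ?r = L2_inner h (f n)" if "h \<in> L2_fun" "\<And>i. i < n \<Longrightarrow> L2_inner h (f i) = 0" for h
  proof -
    have "L2_inner h (\<lambda>x. \<Sum>j<n. t j * f j x) = 0"
      by (subst L2_inner_sum_right) (use that fL2 in \<open>auto intro!: sum.neutral\<close>)
    then show ?thesis using L2_inner_add_right[OF fL2[of n] sumL2[of t] that(1)] by simp
  qed
  \<comment> \<open>If \<open>?r\<close> has norm 0, every inner product with it vanishes and the
    coefficient 0 serves.\<close>
  define a where "a = (if L2_sq ?r = 0 then 0 else - L2_inner ?v ?r / of_real (L2_sq ?r))"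
  have perp: "L2_inner (\<lambda>x. ?v x + a * ?r x) ?r = 0"
    using L2_inner_AE_zero[OF r v]
    by (simp add: L2_inner_add_left[OF v L2_fun_scale[OF r] r] L2_inner_scale_left L2_inner_self a_def)
  have vaL2: "(\<lambda>x. ?v x + a * ?r x) \<in> L2_fun" by (intro L2_fun_add L2_fun_scale r v)
  have perp_i: "L2_inner (\<lambda>x. ?v x + a * ?r x) (f i) = 0" if "i < n" for i
    using s[OF that] t[OF that] that fL2[of i]
    by (simp add: L2_inner_add_left[OF v L2_fun_scale[OF r]] L2_inner_scale_left)
  have perp_n: "L2_inner (\<lambda>x. ?v x + a * ?r x) (f n) = 0"
    using to_fn[OF vaL2 perp_i] perp by simp
  define s' where "s' = (\<lambda>j. if j < n then s j + a * t j else a)"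
  have eq: "(\<lambda>x. u x + (\<Sum>j<Suc n. s' j * f j x)) = (\<lambda>x. ?v x + a * ?r x)"
  proof
    fix x
    have "(\<Sum>j<n. s' j * f j x) = (\<Sum>j<n. s j * f j x) + a * (\<Sum>j<n. t j * f j x)"
      by (simp add: s'_def sum_distrib_left sum.distrib[symmetric] algebra_simps)
    then show "u x + (\<Sum>j<Suc n. s' j * f j x) = ?v x + a * ?r x" by (simp add: s'_def algebra_simps)
  qed
  show ?case
  proof (intro exI[of _ s'] allI impI)
    fix i assume "i < Suc n"
    then show "L2_inner (\<lambda>x. u x + (\<Sum>j<Suc n. s' j * f j x)) (f i) = 0"
      unfolding eq using perp_i[of i] perp_n by (cases "i = n") auto
  qed
qed simp

lemma bessel_inequality:
  fixes n :: nat
  assumes e: "\<And>i. i < n \<Longrightarrow> e i \<in> L2_fun" "\<And>i. i < n \<Longrightarrow> L2_sq (e i) > 0"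
    and orth: "\<And>i j. i < n \<Longrightarrow> j < n \<Longrightarrow> i \<noteq> j \<Longrightarrow> L2_inner (e i) (e j) = 0"
    and h: "h \<in> L2_fun"
  shows "(\<Sum>i<n. (cmod (L2_inner (e i) h))\<^sup>2 / L2_sq (e i)) \<le> L2_sq h"
proof -
  define a where "a = (\<lambda>i. - L2_inner h (e i) / of_real (L2_sq (e i)))"
  let ?s = "\<lambda>x. \<Sum>i<n. a i * e i x"
  have s: "?s \<in> L2_fun" using e by (intro L2_fun_sum L2_fun_scale) auto
  have "L2_inner ?s (e j) = - L2_inner h (e j)" if j: "j < n" for j
  proof -
    have "L2_inner ?s (e j) = (\<Sum>i<n. a i * L2_inner (e i) (e j))"
      using e(1) j by (intro L2_inner_sum_left) auto
    also have "\<dots> = (\<Sum>i<n. if i = j then a j * L2_inner (e j) (e j) else 0)"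
      using orth j by (intro sum.cong) auto
    also have "\<dots> = - L2_inner h (e j)"
      using j e(2)[OF j] by (simp add: L2_inner_self a_def)
    finally show ?thesis .
  qed
  then have ej: "L2_inner (\<lambda>x. h x + ?s x) (e j) = 0" if "j < n" for j
    using that L2_inner_add_left[OF h s e(1)[OF that]] by simp
  have hs: "(\<lambda>x. h x + ?s x) \<in> L2_fun" by (rule L2_fun_add[OF h s])
  have "L2_inner (\<lambda>x. h x + ?s x) ?s = 0"
    by (subst L2_inner_sum_right) (use ej e(1) hs in \<open>auto intro!: sum.neutral\<close>)
  then have "of_real (L2_sq (\<lambda>x. h x + ?s x)) = L2_inner (\<lambda>x. h x + ?s x) h"
    unfolding L2_inner_self[symmetric] L2_inner_add_right[OF h s hs] by simp
  also have "\<dots> = of_real (L2_sq h) + (\<Sum>i<n. a i * L2_inner (e i) h)"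
    unfolding L2_inner_add_left[OF h s h] using e(1) h
    by (subst L2_inner_sum_left) (auto simp: L2_inner_self)
  also have "(\<Sum>i<n. a i * L2_inner (e i) h) = of_real (- (\<Sum>i<n. (cmod (L2_inner (e i) h))\<^sup>2 / L2_sq (e i)))"
    unfolding of_real_minus of_real_sum sum_negf[symmetric]
  proof (rule sum.cong[OF refl])
    fix i
    have eq: "complex_of_real ((cmod (L2_inner (e i) h))\<^sup>2 / L2_sq (e i)) = L2_inner (e i) h * L2_inner h (e i) / of_real (L2_sq (e i))"
      unfolding of_real_divide complex_norm_square L2_inner_cnj ..
    show "a i * L2_inner (e i) h = - complex_of_real ((cmod (L2_inner (e i) h))\<^sup>2 / L2_sq (e i))"
      unfolding eq a_def by (simp add: mult.commute)
  qed
  finally have "complex_of_real (L2_sq (\<lambda>x. h x + ?s x)) =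
      of_real (L2_sq h - (\<Sum>i<n. (cmod (L2_inner (e i) h))\<^sup>2 / L2_sq (e i)))" by simp
  then have "L2_sq (\<lambda>x. h x + ?s x) = L2_sq h - (\<Sum>i<n. (cmod (L2_inner (e i) h))\<^sup>2 / L2_sq (e i))"
    by (simp only: of_real_eq_iff)
  then show ?thesis using L2_sq_nonneg[of "\<lambda>x. h x + ?s x"] by simp
qed

text \<open>Gram-Schmidt makes the operator upper triangular on the span of the eigenfunctions, so the real part of
  the form on the n-th orthogonalised vector is the real part of the n-th eigenvalue.\<close>

lemma orthogonalised_eigenpairs:
  fixes n :: nat
  assumes ep: "\<And>i. i < n \<Longrightarrow> osc_eigenpair b \<gamma> (\<mu> i) (f i) (g i)" and inj: "inj_on \<mu> {..<n}"
  shows "\<exists>e e'. (\<forall>i<n. osc_pair (e i) (e' i) \<and> L2_sq (e i) > 0 \<and>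
           L2_sq (e' i) + L2_sq (\<lambda>x. of_real x * e i x) = Re (\<mu> i) * L2_sq (e i)) \<and>
         (\<forall>i<n. \<forall>j<n. i \<noteq> j \<longrightarrow> L2_inner (e i) (e j) = 0)"
proof -
  have fp: "osc_pair (f i) (g i)" if "i < n" for i using ep[OF that] by (rule osc_eigenpairD)
  have fL2: "f i \<in> L2_fun" if "i < n" for i by (rule osc_pairD(1)[OF fp[OF that]])
  have "\<exists>s. \<forall>i<m. L2_inner (\<lambda>x. f m x + (\<Sum>j<m. s j * f j x)) (f i) = 0" if "m < n" for m
    by (rule L2_projection_exists) (use that fL2 in auto)
  then obtain s where s: "\<And>m i. m < n \<Longrightarrow> i < m \<Longrightarrow> L2_inner (\<lambda>x. f m x + (\<Sum>j<m. s m j * f j x)) (f i) = 0"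
    by metis
  \<comment> \<open>The unit coefficient at m makes \<open>e m\<close> nonzero by independence and
    puts \<open>\<mu> m\<close> on the diagonal.\<close>
  define c where "c = (\<lambda>m j. if j = m then 1 else s m j)"
  define e where "e = (\<lambda>m x. \<Sum>j<Suc m. c m j * f j x)"
  define e' where "e' = (\<lambda>m x. \<Sum>j<Suc m. c m j * g j x)"
  have em: "(\<lambda>x. \<Sum>j<Suc m. c m j * f j x) = e m" "(\<lambda>x. \<Sum>j<Suc m. c m j * g j x) = e' m"
    "(\<Sum>j<Suc m. c m j * f j x) = e m x" for m x
    by (simp_all only: e_def e'_def)
  have e_eq: "e m = (\<lambda>x. f m x + (\<Sum>j<m. s m j * f j x))" for m
    unfolding e_def c_def by (auto simp: fun_eq_iff intro!: sum.cong)
  have ee': "osc_pair (e m) (e' m)" if "m < n" for m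
    unfolding e_def e'_def by (rule osc_pair_sum) (use that fp in auto)
  have eL2: "e m \<in> L2_fun" if "m < n" for m by (rule osc_pairD(1)[OF ee'[OF that]])
  have ef: "L2_inner (e m) (f i) = 0" if "m < n" "i < m" for m i
    unfolding e_eq by (rule s[OF that])
  have fe: "L2_inner (f i) (e m) = 0" if "m < n" "i < m" for m i
    using ef[OF that] L2_inner_cnj[of "e m" "f i"] by simp
  \<comment> \<open>\<open>e m\<close> is orthogonal to all earlier \<open>f j\<close>, so only the
    top coefficient survives. This is the triangular structure.\<close>
  have comb: "L2_inner (\<lambda>x. \<Sum>j<Suc m. d j * f j x) (e m) = d m * L2_inner (f m) (e m)" if m: "m < n" for d m
  proof -
    have "L2_inner (\<lambda>x. \<Sum>j<Suc m. d j * f j x) (e m) = (\<Sum>j<Suc m. d j * L2_inner (f j) (e m))"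
      by (rule L2_inner_sum_left) (use m fL2 eL2 in auto)
    also have "\<dots> = d m * L2_inner (f m) (e m)" using fe[OF m] by simp
    finally show ?thesis .
  qed
  have self: "L2_inner (f m) (e m) = of_real (L2_sq (e m))" if "m < n" for m
    using comb[OF that, of "c m"] unfolding em by (simp add: c_def L2_inner_self)
  have pos: "L2_sq (e m) > 0" if m: "m < n" for m
  proof (rule ccontr)
    assume "\<not> ?thesis"
    then have z: "L2_sq (\<lambda>x. \<Sum>j<Suc m. c m j * f j x) = 0"
      using L2_sq_nonneg[of "e m"] unfolding e_def by linarith
    have "\<forall>i<Suc m. c m i = 0"
      by (rule eigenpairs_independent[where b = b and \<gamma> = \<gamma> and \<mu> = \<mu> and f = f and g = g, OF _ _ z]) (use m ep inj in \<open>auto simp: inj_on_def\<close>)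
    then show False by (auto simp: c_def)
  qed
  have energy: "L2_sq (e' m) + L2_sq (\<lambda>x. of_real x * e m x) = Re (\<mu> m) * L2_sq (e m)" if m: "m < n" for m
  proof -
    have "osc_energy (e m) (e' m) (e m) (e' m) + \<i> * of_real \<gamma> * (e m b * cnj (e m b) - e m (- b) * cnj (e m (- b)))
        = L2_inner (\<lambda>x. \<Sum>j<Suc m. (c m j * \<mu> j) * f j x) (e m)"
      using eigenpair_combination[of "{..<Suc m}" b \<gamma> \<mu> f g "e m" "e' m" "c m", unfolded em] ee'[OF m] ep m
      by auto
    also have "\<dots> = \<mu> m * of_real (L2_sq (e m))"
      unfolding comb[OF m] self[OF m] by (simp add: c_def)
    finally have "of_real (L2_sq (e' m) + L2_sq (\<lambda>x. of_real x * e m x)) +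
        \<i> * of_real (\<gamma> * ((cmod (e m b))\<^sup>2 - (cmod (e m (- b)))\<^sup>2)) = \<mu> m * of_real (L2_sq (e m))"
      unfolding osc_energy_self complex_norm_square[symmetric] by (simp add: mult.assoc)
    then show ?thesis by (simp add: complex_eq_iff)
  qed
  have orth_less: "L2_inner (e i) (e m) = 0" if "i < m" "m < n" for i m
  proof -
    have "L2_inner (e i) (e m) = (\<Sum>j<Suc i. c i j * L2_inner (f j) (e m))"
      unfolding em(1)[where m = i, symmetric] by (rule L2_inner_sum_left) (use that fL2 eL2 in auto)
    also have "\<dots> = 0" using fe that by (intro sum.neutral) auto
    finally show ?thesis .
  qed
  have orth: "L2_inner (e i) (e j) = 0" if "i < n" "j < n" "i \<noteq> j" for i j
    using orth_less[of i j] orth_less[of j i] that L2_inner_cnj[of "e j" "e i"]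
    by (cases i j rule: linorder_cases) auto
  show ?thesis using ee' pos energy orth by blast
qed

text \<open>By Bessel, each Hermite function takes weight at most 1 from the whole orthogonal
  family, so the first K of them take at most K out of n. The remaining n - K costs 2 K + 1 per
  unit, while the total is at most n R. With K = n div 2 both n - K \<ge> n / 2 and 2 K + 1 \<ge> n
  hold, whatever the parity of n.\<close>

lemma card_eigenvalues_le:
  fixes n :: nat
  assumes ep: "\<And>i. i < n \<Longrightarrow> osc_eigenpair b \<gamma> (\<mu> i) (f i) (g i)" and inj: "inj_on \<mu> {..<n}"
    and R: "\<And>i. i < n \<Longrightarrow> Re (\<mu> i) \<le> R"
  shows "n = 0 \<or> real n \<le> 2 * R"
proof -
  obtain e e' where e: "\<And>i. i < n \<Longrightarrow> osc_pair (e i) (e' i)" "\<And>i. i < n \<Longrightarrow> L2_sq (e i) > 0"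
      "\<And>i. i < n \<Longrightarrow> L2_sq (e' i) + L2_sq (\<lambda>x. of_real x * e i x) = Re (\<mu> i) * L2_sq (e i)"
      "\<And>i j. i < n \<Longrightarrow> j < n \<Longrightarrow> i \<noteq> j \<Longrightarrow> L2_inner (e i) (e j) = 0"
  proof -
    have "\<exists>e e'. (\<forall>i<n. osc_pair (e i) (e' i) \<and> L2_sq (e i) > 0 \<and>
           L2_sq (e' i) + L2_sq (\<lambda>x. of_real x * e i x) = Re (\<mu> i) * L2_sq (e i)) \<and>
         (\<forall>i<n. \<forall>j<n. i \<noteq> j \<longrightarrow> L2_inner (e i) (e j) = 0)"
      by (rule orthogonalised_eigenpairs[OF _ inj]) (rule ep)
    then obtain e e' where "\<forall>i<n. osc_pair (e i) (e' i) \<and> L2_sq (e i) > 0 \<and>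
           L2_sq (e' i) + L2_sq (\<lambda>x. of_real x * e i x) = Re (\<mu> i) * L2_sq (e i)"
         "\<forall>i<n. \<forall>j<n. i \<noteq> j \<longrightarrow> L2_inner (e i) (e j) = 0" by blast
    then show thesis by (intro that[of e e']) auto
  qed
  define K where "K = n div 2"
  define w where "w = (\<lambda>i k. (cmod (L2_inner (e i) (hermite k)))\<^sup>2 / L2_sq (e i))"
  have bound: "(2 * real K + 1) * (1 - (\<Sum>k<K. w i k)) \<le> R" if i: "i < n" for i
  proof -
    have "(2 * real K + 1) * (L2_sq (e i) - (\<Sum>k<K. (cmod (L2_inner (e i) (hermite k)))\<^sup>2)) \<le> Re (\<mu> i) * L2_sq (e i)"
      using hermite_tail_inequality[OF e(1)[OF i], of K] unfolding e(3)[OF i] .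
    also have "\<dots> \<le> R * L2_sq (e i)" using R[OF i] by (rule mult_right_mono) simp
    also have "L2_sq (e i) - (\<Sum>k<K. (cmod (L2_inner (e i) (hermite k)))\<^sup>2) = (1 - (\<Sum>k<K. w i k)) * L2_sq (e i)"
      using e(2)[OF i] by (simp add: w_def left_diff_distrib sum_distrib_right)
    finally have "((2 * real K + 1) * (1 - (\<Sum>k<K. w i k))) * L2_sq (e i) \<le> R * L2_sq (e i)"
      by (simp only: mult.assoc)
    then show ?thesis using e(2)[OF i] by (simp only: mult_le_cancel_right_pos)
  qed
  have bessel: "(\<Sum>i<n. w i k) \<le> 1" for k
    unfolding w_def using bessel_inequality[of n e "hermite k"] e osc_pairD(1)[OF e(1)] by simp
  have "(\<Sum>i<n. \<Sum>k<K. w i k) = (\<Sum>k<K. \<Sum>i<n. w i k)" by (rule sum.swap)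
  also have "\<dots> \<le> (\<Sum>k<K. 1)" by (intro sum_mono bessel)
  finally have wK: "(\<Sum>i<n. \<Sum>k<K. w i k) \<le> real K" by simp
  have "(2 * real K + 1) * (real n - real K) \<le> (2 * real K + 1) * (real n - (\<Sum>i<n. \<Sum>k<K. w i k))"
    using wK by (intro mult_left_mono) auto
  also have "\<dots> = (\<Sum>i<n. (2 * real K + 1) * (1 - (\<Sum>k<K. w i k)))"
    by (simp add: sum_distrib_left[symmetric] sum_subtractf)
  also have "\<dots> \<le> (\<Sum>i<n. R)" by (intro sum_mono bound) auto
  finally have main: "(2 * real K + 1) * (real n - real K) \<le> real n * R" by simp
  have K: "real n \<le> 2 * real K + 1" "real n / 2 \<le> real n - real K" by (auto simp: K_def)
  have "real n * (real n / 2) \<le> (2 * real K + 1) * (real n - real K)" using K by (intro mult_mono) auto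
  with main have "real n * (real n / 2) \<le> real n * R" by linarith
  then show ?thesis by (cases "n = 0") auto
qed

theorem mainTheorem2:
  fixes b :: real
  assumes "b \<noteq> 0"
  shows "\<exists>C::real. C > 0 \<and>
    (\<forall>\<gamma>::real. finite (nonreal_eigenvalues b \<gamma>) \<and>
       real (card (nonreal_eigenvalues b \<gamma>)) \<le> (C * (1 + \<bar>\<gamma>\<bar>) * ln (exp 1 + \<bar>\<gamma>\<bar>))\<^sup>2)"
proof -
  obtain A where A: "A > 0"
    "\<And>\<gamma> \<mu> f g. osc_eigenpair b \<gamma> \<mu> f g \<Longrightarrow> Im \<mu> \<noteq> 0 \<Longrightarrow> Re \<mu> \<le> A * (1 + \<gamma>\<^sup>2)"
  proof (cases "b > 0")
    case True
    then show thesis using nonreal_eigenvalue_location[OF True] that by blast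
  next
    case False
    with assms have "- b > 0" by simp
    from nonreal_eigenvalue_location[OF this] obtain A where "A > 0"
      "\<And>\<gamma> \<mu> f g. osc_eigenpair (- b) \<gamma> \<mu> f g \<Longrightarrow> Im \<mu> \<noteq> 0 \<Longrightarrow> Re \<mu> \<le> A * (1 + \<gamma>\<^sup>2)" by blast
    \<comment> \<open>Exchanging \<open>b\<close> and \<open>- b\<close> changes the sign of
      \<gamma>, and the bound depends on \<gamma>^2 alone.\<close>
    then show thesis using that[of A] osc_eigenpair_swap by (metis power2_minus)
  qed
  define C where "C = sqrt (2 * A)"
  have "finite (nonreal_eigenvalues b \<gamma>) \<and>
      real (card (nonreal_eigenvalues b \<gamma>)) \<le> (C * (1 + \<bar>\<gamma>\<bar>) * ln (exp 1 + \<bar>\<gamma>\<bar>))\<^sup>2" for \<gamma>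
  proof -
    define R where "R = A * (1 + \<gamma>\<^sup>2)"
    have R0: "R \<ge> 0" using A(1) by (simp add: R_def)
    \<comment> \<open>A bound valid for all finite subsets yields finiteness and the count
      together.\<close>
    have card_le: "real (card S) \<le> 2 * R" if S: "S \<subseteq> nonreal_eigenvalues b \<gamma>" "finite S" for S
    proof -
      obtain \<mu> where \<mu>: "bij_betw \<mu> {..<card S} S"
        using ex_bij_betw_nat_finite[OF S(2)] by (auto simp: atLeast0LessThan)
      then have mem: "\<mu> i \<in> nonreal_eigenvalues b \<gamma>" if "i < card S" for i
        using that S(1) by (auto simp: bij_betw_def)
      then have "\<exists>f g. osc_eigenpair b \<gamma> (\<mu> i) f g" if "i < card S" for i
        using osc_eigenvalue_imp_eigenpair that by (auto simp: nonreal_eigenvalues_def)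
      then obtain f g where fg: "\<And>i. i < card S \<Longrightarrow> osc_eigenpair b \<gamma> (\<mu> i) (f i) (g i)" by metis
      have "Im (\<mu> i) \<noteq> 0" if "i < card S" for i
        using mem[OF that] by (auto simp: nonreal_eigenvalues_def complex_is_Real_iff)
      then have "Re (\<mu> i) \<le> R" if "i < card S" for i
        unfolding R_def using A(2)[OF fg[OF that]] that by blast
      with card_eigenvalues_le[where n = "card S" and R = R and \<mu> = \<mu> and f = f and g = g, OF fg] \<mu> R0 show ?thesis
        by (auto simp: bij_betw_def)
    qed
    have "finite (nonreal_eigenvalues b \<gamma>) \<and> card (nonreal_eigenvalues b \<gamma>) \<le> nat \<lfloor>2 * R\<rfloor>"
    proof (rule finite_if_finite_subsets_card_bdd)
      fix S assume "S \<subseteq> nonreal_eigenvalues b \<gamma>" "finite S"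
      from card_le[OF this] show "card S \<le> nat \<lfloor>2 * R\<rfloor>" by (simp add: le_nat_floor)
    qed
    then have fin: "finite (nonreal_eigenvalues b \<gamma>)" by blast
    have "real (card (nonreal_eigenvalues b \<gamma>)) \<le> 2 * R" by (rule card_le[OF subset_refl fin])
    also have "\<dots> \<le> 2 * A * (1 + \<bar>\<gamma>\<bar>)\<^sup>2"
      using A(1) by (simp add: R_def power2_sum)
    also have "\<dots> = (C * (1 + \<bar>\<gamma>\<bar>) * 1)\<^sup>2" using A(1) by (simp add: C_def power_mult_distrib)
    also have "\<dots> \<le> (C * (1 + \<bar>\<gamma>\<bar>) * ln (exp 1 + \<bar>\<gamma>\<bar>))\<^sup>2"
    proof (intro power_mono mult_left_mono)
      have "ln (exp 1) \<le> ln (exp 1 + \<bar>\<gamma>\<bar>)" by (subst ln_le_cancel_iff) (auto intro: add_pos_nonneg)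
      then show "1 \<le> ln (exp 1 + \<bar>\<gamma>\<bar>)" by simp
    qed (use A(1) in \<open>auto simp: C_def\<close>)
    finally show ?thesis using fin by blast
  qed
  moreover have "C > 0" using A(1) by (simp add: C_def)
  ultimately show ?thesis by blast
qed

end
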